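(* Assume $\mathsf M$ is uniformly $\Delta$-absorbing. Then the family $\mathbb C_{d+1}$ of chattering stationary policies of order $d+1$ is sufficient: $\mathcal R(\mathbb C_{d+1})=\mathcal R(\mathbf\Pi)$, i.e. for every $\pi\in\mathbf\Pi$ there is $\gamma\in\mathbb C_{d+1}$ with $\mu_\pi(r)=\mu_\gamma(r)$.
   Context: Model. $(\mathbf X,\mathfrak X)$ is a measurable space (state space), $\mathbf A$ is a Borel space (action space) with Borel $\sigma$-algebra $\mathfrak B(\mathbf A)$; for each $x\in\mathbf X$, $\mathbf A(x)\subseteq\mathbf A$ is a nonempty measurable set of admissible actions; $\mathbf K=\{(x,a)\in\mathbf X\times\mathbf A: a\in\mathbf A(x)\}$; $Q$ is a stochastic kernel on $\mathbf X$ given $(\mathbf X\times\mathbf A,\mathfrak X\otimes\mathfrak B(\mathbf A))$; $\eta$ is a probability measure on $\mathbf X$; $r:\mathbf X\times\mathbf A\to\mathbb R^d$ ($d\ge1$) is bounded measurable. The model $\mathsf M=(\mathbf X,\mathbf A,\{\mathbf A(x)\}_{x},Q,\eta,r)$ satisfies the measurability conditions: $\mathbf K\in\mathfrak X\otimes\mathfrak B(\mathbf A)$, and there is a measurable $\theta:\mathbf X\to\mathbf A$ with $\theta(x)\in\mathbf A(x)$ for all $x$. Policies. $\mathbf H_0=\mathbf X$, $\mathbf H_n=\mathbf H_{n-1}\times\mathbf A\times\mathbf X$. A policy $\pi=\{\pi_n\}_{n\ge0}$ is a sequence of stochastic kernels $\pi_n$ on $\mathbf A$ given $\mathbf H_n$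 with $\pi_n(\mathbf A(x_n)|h_n)=1$ for all $h_n=(x_0,a_0,\dots,x_n)$; $\mathbf\Pi$ is the set of all policies. For $\pi\in\mathbf\Pi$, $\mathbb P_\pi$ is the unique probability on $\Omega=(\mathbf X\times\mathbf A)^\infty$ (product $\sigma$-algebra, coordinate processes $X_n,A_n$, histories $H_n$) with $X_0\sim\eta$, $\mathbb P_\pi(A_n\in\cdot\,|H_n)=\pi_n(\cdot|H_n)$ and $\mathbb P_\pi(X_{n+1}\in\cdot\,|H_n,A_n)=Q(\cdot|X_n,A_n)$; $\mathbb E_\pi$ is its expectation. $\mathbb S$ is the set of stochastic kernels $\varphi$ on $\mathbf A$ given $\mathbf X$ with $\varphi(\mathbf A(x)|x)=1$ for all $x$. For $p\ge1$, $\mathbb C_p$ is the set of $\varphi\in\mathbb S$ of the form $\varphi(da|x)=\sum_{i=1}^p\beta_i(x)\delta_{\phi_i(x)}(da)$ with measurable $\phi_i:\mathbf X\to\mathbf A$ and measurable $\beta=(\beta_1,\dots,\beta_p):\mathbf X\to\{b\in\mathbb R_+^p:\sum_ib_i=1\}$; each $\varphi\in\mathbb C_p$ is identified with the chattering stationary policy $\pi_n(\cdot|h_n)=\varphi(\cdot|x_n)$. Absorbing models. For $\Delta\in\mathfrak X$ let $T_\Delta=\min\{n\ge0:X_n\in\Delta\}$ ($\min\emptyset=\infty$). $\mathsf M$ is $\Delta$-absorbing if $Q(\Delta|x,a)=1$ and $r(x,a)=0$ for all $(x,a)\in\Delta\times\mathbf A$, and $\mathbb E_\pi[T_\Delta]<\infty$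 for all $\pi\in\mathbf\Pi$; it is uniformly $\Delta$-absorbing if moreover $\lim_{n\to\infty}\sup_{\pi\in\mathbf\Pi}\sum_{t\ge n}\mathbb P_\pi(T_\Delta>t)=0$. Occupation measures and performance. $\mu_\pi(\Gamma)=\mathbb E_\pi\big[\sum_{t\ge0}\mathbf 1_{\{T_\Delta>t\}}\mathbf 1_{\{(X_t,A_t)\in\Gamma\}}\big]$; $\mu(r)=(\int r_1d\mu,\dots,\int r_dd\mu)$; $\mathcal R(\pi)=\mathbb E_\pi[\sum_{t\ge0}r(X_t,A_t)]=\mu_\pi(r)$ and $\mathcal R(\Lambda)=\{\mathcal R(\pi):\pi\in\Lambda\}$. *)

theory Defs
  imports "HOL-Probability.Probability"
begin

(* State space MX (a measurable space; its measure is irrelevant),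
   action space MA, admissible actions Aadm, transition kernel Q,
   initial law eta, vector reward r. *)

definition XA :: "'x measure \<Rightarrow> 'a measure \<Rightarrow> ('x \<times> 'a) measure" where
  "XA MX MA = MX \<Otimes>\<^sub>M MA"

definition Omega_n :: "'x measure \<Rightarrow> 'a measure \<Rightarrow> nat \<Rightarrow> (nat \<Rightarrow> 'x \<times> 'a) measure" where
  "Omega_n MX MA n = PiM {..<n} (\<lambda>_. XA MX MA)"

definition Omega :: "'x measure \<Rightarrow> 'a measure \<Rightarrow> (nat \<Rightarrow> 'x \<times> 'a) measure" where
  "Omega MX MA = PiM UNIV (\<lambda>_. XA MX MA)"

text \<open>History h_n = (x_0,a_0,...,a_{n-1},x_n), represented as (prefix, x_n).\<close>
definition Hist :: "'x measure \<Rightarrow> 'a measure \<Rightarrow> nat \<Rightarrow> ((nat \<Rightarrow> 'x \<times> 'a) \<times> 'x) measure" where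
  "Hist MX MA n = Omega_n MX MA n \<Otimes>\<^sub>M MX"

definition is_policy ::
  "'x measure \<Rightarrow> 'a measure \<Rightarrow> ('x \<Rightarrow> 'a set) \<Rightarrow>
   (nat \<Rightarrow> (nat \<Rightarrow> 'x \<times> 'a) \<times> 'x \<Rightarrow> 'a measure) \<Rightarrow> bool" where
  "is_policy MX MA Aadm \<pi> \<longleftrightarrow>
     (\<forall>n. \<pi> n \<in> measurable (Hist MX MA n) (prob_algebra MA) \<and>
          (\<forall>h\<in>space (Hist MX MA n). emeasure (\<pi> n h) (Aadm (snd h)) = 1))"

fun fdd ::
  "'x measure \<Rightarrow> 'a measure \<Rightarrow> ('x \<times> 'a \<Rightarrow> 'x measure) \<Rightarrow> 'x measure \<Rightarrow>
   (nat \<Rightarrow> (nat \<Rightarrow> 'x \<times> 'a) \<times> 'x \<Rightarrow> 'a measure) \<Rightarrow> nat \<Rightarrow> (nat \<Rightarrow> 'x \<times> 'a) measure" where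
  "fdd MX MA Q \<eta> \<pi> 0 = return (Omega_n MX MA 0) (\<lambda>_. undefined)"
| "fdd MX MA Q \<eta> \<pi> (Suc n) =
     fdd MX MA Q \<eta> \<pi> n \<bind> (\<lambda>\<omega>.
       (if n = 0 then \<eta> else Q (\<omega> (n - 1))) \<bind> (\<lambda>x.
         \<pi> n (\<omega>, x) \<bind> (\<lambda>a. return (Omega_n MX MA (Suc n)) (fun_upd \<omega> n (x, a)))))"

text \<open>The strategic measure P_pi: the unique probability on Omega with these
  finite-dimensional distributions (Ionescu-Tulcea).\<close>
definition strat ::
  "'x measure \<Rightarrow> 'a measure \<Rightarrow> ('x \<times> 'a \<Rightarrow> 'x measure) \<Rightarrow> 'x measure \<Rightarrow>
   (nat \<Rightarrow> (nat \<Rightarrow> 'x \<times> 'a) \<times> 'x \<Rightarrow> 'a measure) \<Rightarrow> (nat \<Rightarrow> 'x \<times> 'a) measure" where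
  "strat MX MA Q \<eta> \<pi> =
     (THE P. P \<in> space (prob_algebra (Omega MX MA)) \<and>
        (\<forall>n. distr P (Omega_n MX MA n) (\<lambda>\<omega>. restrict \<omega> {..<n}) = fdd MX MA Q \<eta> \<pi> n))"

definition T_Delta :: "'x set \<Rightarrow> (nat \<Rightarrow> 'x \<times> 'a) \<Rightarrow> enat" where
  "T_Delta \<Delta> \<omega> = (if \<exists>n. fst (\<omega> n) \<in> \<Delta> then enat (LEAST n. fst (\<omega> n) \<in> \<Delta>) else \<infinity>)"

definition mdp_model ::
  "'x measure \<Rightarrow> 'a measure \<Rightarrow> ('x \<Rightarrow> 'a set) \<Rightarrow> ('x \<times> 'a \<Rightarrow> 'x measure) \<Rightarrow> 'x measure \<Rightarrow>
   ('x \<times> 'a \<Rightarrow> 'v::real_normed_vector) \<Rightarrow> bool" where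
  "mdp_model MX MA Aadm Q \<eta> r \<longleftrightarrow>
     (\<forall>x\<in>space MX. Aadm x \<in> sets MA \<and> Aadm x \<noteq> {}) \<and>
     Q \<in> measurable (XA MX MA) (prob_algebra MX) \<and>
     \<eta> \<in> space (prob_algebra MX) \<and>
     r \<in> borel_measurable (XA MX MA) \<and> bounded (r ` space (XA MX MA)) \<and>
     {(x, a) \<in> space MX \<times> space MA. a \<in> Aadm x} \<in> sets (XA MX MA) \<and>
     (\<exists>\<theta>\<in>measurable MX MA. \<forall>x\<in>space MX. \<theta> x \<in> Aadm x)"

definition absorbing ::
  "'x measure \<Rightarrow> 'a measure \<Rightarrow> ('x \<Rightarrow> 'a set) \<Rightarrow> ('x \<times> 'a \<Rightarrow> 'x measure) \<Rightarrow> 'x measure \<Rightarrow>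
   ('x \<times> 'a \<Rightarrow> 'v::real_normed_vector) \<Rightarrow> 'x set \<Rightarrow> bool" where
  "absorbing MX MA Aadm Q \<eta> r \<Delta> \<longleftrightarrow>
     \<Delta> \<in> sets MX \<and>
     (\<forall>x\<in>\<Delta>. \<forall>a\<in>space MA. emeasure (Q (x, a)) \<Delta> = 1 \<and> r (x, a) = 0) \<and>
     (\<forall>\<pi>. is_policy MX MA Aadm \<pi> \<longrightarrow>
        (\<integral>\<^sup>+ \<omega>. ennreal_of_enat (T_Delta \<Delta> \<omega>) \<partial>strat MX MA Q \<eta> \<pi>) < \<infinity>)"

definition uniformly_absorbing ::
  "'x measure \<Rightarrow> 'a measure \<Rightarrow> ('x \<Rightarrow> 'a set) \<Rightarrow> ('x \<times> 'a \<Rightarrow> 'x measure) \<Rightarrow> 'x measure \<Rightarrow>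
   ('x \<times> 'a \<Rightarrow> 'v::real_normed_vector) \<Rightarrow> 'x set \<Rightarrow> bool" where
  "uniformly_absorbing MX MA Aadm Q \<eta> r \<Delta> \<longleftrightarrow>
     absorbing MX MA Aadm Q \<eta> r \<Delta> \<and>
     ((\<lambda>n. SUP \<pi>\<in>{\<pi>. is_policy MX MA Aadm \<pi>}.
        (\<Sum>k. emeasure (strat MX MA Q \<eta> \<pi>)
                {\<omega>\<in>space (Omega MX MA). enat (n + k) < T_Delta \<Delta> \<omega>}))
      \<longlonglongrightarrow> 0)"

definition occ ::
  "'x measure \<Rightarrow> 'a measure \<Rightarrow> ('x \<times> 'a \<Rightarrow> 'x measure) \<Rightarrow> 'x measure \<Rightarrow> 'x set \<Rightarrow>
   (nat \<Rightarrow> (nat \<Rightarrow> 'x \<times> 'a) \<times> 'x \<Rightarrow> 'a measure) \<Rightarrow> ('x \<times> 'a) measure" where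
  "occ MX MA Q \<eta> \<Delta> \<pi> =
     measure_of (space (XA MX MA)) (sets (XA MX MA))
       (\<lambda>\<Gamma>. \<integral>\<^sup>+ \<omega>. (\<Sum>t. indicator {\<omega>. enat t < T_Delta \<Delta> \<omega>} \<omega> * indicator \<Gamma> (\<omega> t))
              \<partial>strat MX MA Q \<eta> \<pi>)"

definition occ_reward ::
  "'x measure \<Rightarrow> 'a measure \<Rightarrow> ('x \<times> 'a \<Rightarrow> 'x measure) \<Rightarrow> 'x measure \<Rightarrow> 'x set \<Rightarrow>
   ('x \<times> 'a \<Rightarrow> real ^ 'd) \<Rightarrow> (nat \<Rightarrow> (nat \<Rightarrow> 'x \<times> 'a) \<times> 'x \<Rightarrow> 'a measure) \<Rightarrow> real ^ 'd" where
  "occ_reward MX MA Q \<eta> \<Delta> r \<pi> = (\<chi> i. \<integral> z. r z $ i \<partial>occ MX MA Q \<eta> \<Delta> \<pi>)"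

definition chat_kernel ::
  "'a measure \<Rightarrow> nat \<Rightarrow> (nat \<Rightarrow> 'x \<Rightarrow> real) \<Rightarrow> (nat \<Rightarrow> 'x \<Rightarrow> 'a) \<Rightarrow> 'x \<Rightarrow> 'a measure" where
  "chat_kernel MA p \<beta> \<phi> x =
     measure_of (space MA) (sets MA) (\<lambda>B. \<Sum>i<p. ennreal (\<beta> i x) * indicator B (\<phi> i x))"

definition chattering ::
  "'x measure \<Rightarrow> 'a measure \<Rightarrow> ('x \<Rightarrow> 'a set) \<Rightarrow> nat \<Rightarrow>
   (nat \<Rightarrow> 'x \<Rightarrow> real) \<Rightarrow> (nat \<Rightarrow> 'x \<Rightarrow> 'a) \<Rightarrow> bool" where
  "chattering MX MA Aadm p \<beta> \<phi> \<longleftrightarrow>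
     (\<forall>i<p. \<phi> i \<in> measurable MX MA \<and> \<beta> i \<in> borel_measurable MX) \<and>
     (\<forall>x\<in>space MX. (\<forall>i<p. 0 \<le> \<beta> i x) \<and> (\<Sum>i<p. \<beta> i x) = 1 \<and>
        emeasure (chat_kernel MA p \<beta> \<phi> x) (Aadm x) = 1)"

definition stat_policy ::
  "('x \<Rightarrow> 'a measure) \<Rightarrow> nat \<Rightarrow> (nat \<Rightarrow> 'x \<times> 'a) \<times> 'x \<Rightarrow> 'a measure" where
  "stat_policy \<phi> n h = \<phi> (snd h)"

end

theory Submission
  imports Defs
begin

text \<open>
  Disintegrate the occupation measure of a policy along its state marginal: this gives a stationary kernel
  \<open>\<kappa>\<close> with the same reward, whose vector of expected total rewards from \<open>x\<close> we call \<open>h x\<close>. The evaluation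
  equation says that \<open>h x\<close> is the mean, under \<open>\<kappa> x\<close>, of the one-step look-ahead \<open>G (x, a) = r (x, a) + Q h (x, a)\<close>,
  hence a convex combination of \<open>d + 1\<close> values \<open>G (x, a\<^sub>i)\<close> by Caratheodory's theorem. Choosing the actions and
  weights measurably yields a chattering kernel \<open>\<gamma>\<close> that solves the same evaluation equation. Iterating it
  along \<open>\<gamma>\<close> leaves a remainder bounded by the expected time to absorption after time \<open>n\<close> when \<open>\<gamma>\<close> is followed
  up to time \<open>n\<close> and \<open>\<kappa>\<close> afterwards; this is where absorption has to be uniform over all policies.
  No topology on the state space is available, so disintegration and selection both go through a
  representation of kernels by a uniform random variable on the unit interval.
\<close>


section \<open>Disintegration by a uniform random variable\<close>

text \<open>Two obstacles shape the proof. The mean of \<open>G (x, a)\<close> under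
  \<open>\<kappa> x\<close> must lie in the convex hull itself, not only in its closure, of values
  of \<open>G\<close> at admissible actions chosen measurably in \<open>x\<close>. Writing the
  action as \<open>S (x, u)\<close> with uniform \<open>u\<close> moves the choice to sets of noise
  values of positive length, where selection rests on inner regularity and measurable section
  lengths. Countably many selections give values dense in the support of the law of
  \<open>G (x, u)\<close>, and a dense part of the support already has the mean in its hull.
  Secondly, the expected absorption time \<open>w\<close> under \<open>\<kappa>\<close> may be
  infinite at some states, where \<open>h\<close> has no meaning. Such states are null for the state
  laws of every policy, since switching to \<open>\<kappa>\<close> at any time gives again an
  admissible policy; the evaluation equation is therefore solved only on
  \<open>{w < \<infinity>}\<close>. Signed values are kept as two nonnegative extended integrals,
  one for each sign of each reward component, so that infinite values never have to be
  subtracted.\<close>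

abbreviation unif01 :: "real measure" where
  "unif01 \<equiv> uniform_measure lborel {0..1}"

lemma prob_space_unif01: "prob_space unif01"
  by (rule prob_space_uniform_measure) auto

lemma emeasure_unif01_less:
  assumes "c \<le> 1"
  shows "emeasure unif01 {u. ennreal u < c} = c"
proof -
  obtain r where r: "c = ennreal r" "0 \<le> r" "r \<le> 1"
    using assms by (cases c) (auto simp: top_unique)
  have "{0..1} \<inter> {u. ennreal u < c} = {0..<r}"
    using r by (auto simp: ennreal_less_iff)
  then show ?thesis using r by (simp add: divide_ennreal_def)
qed

text \<open>On the set where \<open>g < f\<close> the difference \<open>f - g\<close> is positive
  but has integral zero, so the set is null. The finite integral of \<open>f\<close> makes the
  subtraction legitimate in \<open>ennreal\<close>.\<close>

lemma AE_le_of_nn_integral_le: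
  assumes [measurable]: "f \<in> borel_measurable M" "g \<in> borel_measurable M"
    and fin: "(\<integral>\<^sup>+x. f x \<partial>M) < \<infinity>"
    and le: "\<And>A. A \<in> sets M \<Longrightarrow> (\<integral>\<^sup>+x. f x * indicator A x \<partial>M) \<le> (\<integral>\<^sup>+x. g x * indicator A x \<partial>M)"
  shows "AE x in M. f x \<le> g x"
proof -
  let ?N = "{x\<in>space M. g x < f x}"
  have N[measurable]: "?N \<in> sets M" by measurable
  have "(\<integral>\<^sup>+x. g x * indicator ?N x \<partial>M) \<le> (\<integral>\<^sup>+x. f x \<partial>M)"
    by (intro nn_integral_mono) (auto split: split_indicator)
  then have finN: "(\<integral>\<^sup>+x. g x * indicator ?N x \<partial>M) \<noteq> \<infinity>" using fin by (auto simp: top_unique)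
  have "(\<integral>\<^sup>+x. f x * indicator ?N x - g x * indicator ?N x \<partial>M)
      = (\<integral>\<^sup>+x. f x * indicator ?N x \<partial>M) - (\<integral>\<^sup>+x. g x * indicator ?N x \<partial>M)"
    using finN by (intro nn_integral_diff) (auto split: split_indicator)
  also have "\<dots> = 0" using le[OF N] finN by (simp add: diff_eq_0_iff_ennreal less_top)
  finally have "AE x in M. f x * indicator ?N x - g x * indicator ?N x = 0"
    by (subst (asm) nn_integral_0_iff_AE) auto
  then show ?thesis
    by (rule AE_mp, intro AE_I2)
      (auto split: split_indicator_asm simp: diff_eq_0_iff_ennreal not_less[symmetric])
qed

text \<open>The dyadic points \<open>(floor (2^n * t) + 1) / 2^n\<close> do it. They stay strictly
  above \<open>t\<close>, so the half-lines \<open>{q n<..}\<close> increase to exactly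
  \<open>{t<..}\<close>.\<close>

lemma decreasing_rational_approx:
  fixes t :: real
  obtains q :: "nat \<Rightarrow> real"
  where "\<And>n. q n \<in> \<rat>" "\<And>n. t < q n" "\<And>n. q (Suc n) \<le> q n" "q \<longlonglongrightarrow> t"
proof -
  define q :: "nat \<Rightarrow> real" where "q n = (of_int \<lfloor>2^n * t\<rfloor> + 1) / 2^n" for n :: nat
  have up: "2^n * t < of_int \<lfloor>2^n * t\<rfloor> + 1" and lo: "of_int \<lfloor>2^n * t\<rfloor> \<le> 2^n * t" for n by linarith+
  have gt: "t < q n" for n unfolding q_def using up[of n] by (simp add: field_simps)
  have le: "q n \<le> t + (1/2)^n" for n
    unfolding q_def using lo[of n] by (simp add: field_simps power_divide)
  have lim: "(\<lambda>n. t + (1/2)^n) \<longlonglongrightarrow> t + 0"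
    by (intro tendsto_intros LIMSEQ_realpow_zero) auto
  have "q \<longlonglongrightarrow> t"
    using gt le lim by (intro real_tendsto_sandwich[of "\<lambda>_. t" q _ "\<lambda>n. t + (1/2)^n"])
      (auto intro!: always_eventually intro: less_imp_le)
  moreover have "q (Suc n) \<le> q n" for n
  proof -
    have "2^Suc n * t = 2 * (2^n * t)" by simp
    also have "\<dots> < 2 * (of_int \<lfloor>2^n * t\<rfloor> + 1)" by (rule mult_strict_left_mono[OF up]) simp
    also have "\<dots> = of_int (2 * (\<lfloor>2^n * t\<rfloor> + 1))" by simp
    finally have "\<lfloor>2^Suc n * t\<rfloor> < 2 * (\<lfloor>2^n * t\<rfloor> + 1)" by (simp only: floor_less_iff)
    then have "\<lfloor>2^Suc n * t\<rfloor> + 1 \<le> 2 * (\<lfloor>2^n * t\<rfloor> + 1)" by linarith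
    then have "real_of_int (\<lfloor>2^Suc n * t\<rfloor> + 1) \<le> real_of_int (2 * (\<lfloor>2^n * t\<rfloor> + 1))"
      by (simp only: of_int_le_iff)
    then have "(of_int \<lfloor>2^Suc n * t\<rfloor> + 1) / 2^Suc n \<le> 2 * (of_int \<lfloor>2^n * t\<rfloor> + 1) / (2^Suc n :: real)"
      by (intro divide_right_mono) auto
    also have "\<dots> = (of_int \<lfloor>2^n * t\<rfloor> + 1) / 2^n" by (simp add: field_simps)
    finally show ?thesis by (simp only: q_def)
  qed
  moreover have "q n \<in> \<rat>" for n unfolding q_def by auto
  ultimately show ?thesis using that gt by blast
qed

text \<open>The conditional quantile transform: \<open>T x\<close> pushes the uniform law forward to the conditional law
  whose survival function at \<open>q\<close> is the Radon-Nikodym derivative \<open>G q\<close>.\<close>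
lemma randomization_unit_interval:
  fixes M :: "('x \<times> real) measure"
  assumes fin: "finite_measure M" and sM: "sets M = sets (MX \<Otimes>\<^sub>M borel)"
    and conc: "AE z in M. 0 < snd z \<and> snd z \<le> 1"
  shows "\<exists>T\<in>borel_measurable (MX \<Otimes>\<^sub>M borel).
    M = distr (distr M MX fst \<Otimes>\<^sub>M unif01) (MX \<Otimes>\<^sub>M borel) (\<lambda>(x, u). (x, T (x, u)))"
proof -
  interpret finite_measure M by fact
  interpret U: prob_space unif01 by (rule prob_space_unif01)
  note [measurable_cong] = sM
  let ?V = "distr M MX fst"
  interpret V: finite_measure ?V by (rule finite_measure_distr) measurable
  \<comment> \<open>\<open>F q\<close> is the state marginal of the part of \<open>M\<close> whose
    second coordinate exceeds \<open>q\<close>; its density with respect to \<open>?V\<close> is the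
    conditional probability of exceeding \<open>q\<close>.\<close>
  define F where "F q = distr (density M (indicator (space MX \<times> {q<..}))) MX fst" for q :: real
  have F: "emeasure (F q) A = emeasure M (A \<times> {q<..})" if [measurable]: "A \<in> sets MX" for q A
  proof -
    have "fst -` A \<inter> space M \<inter> space MX \<times> {q<..} = A \<times> {q<..}"
      using sets.sets_into_space[OF that] by (auto simp: sets_eq_imp_space_eq[OF sM] space_pair_measure)
    moreover have "fst -` A \<inter> space M \<in> sets M" by measurable
    moreover have "space MX \<times> {q<..} \<in> sets M" by measurable
    ultimately show ?thesis unfolding F_def
      by (simp add: emeasure_distr emeasure_density indicator_inter_arith[symmetric] mult.commute)
  qed
  define G where "G q = RN_deriv ?V (F q)" for q
  have G[measurable]: "G q \<in> borel_measurable MX" for q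
    using borel_measurable_RN_deriv[of ?V "F q"] unfolding G_def by simp
  have V: "emeasure ?V A = emeasure M (A \<times> UNIV)" if "A \<in> sets MX" for A
    using that sets.sets_into_space[OF that]
    by (auto simp: emeasure_distr sets_eq_imp_space_eq[OF sM] space_pair_measure intro!: arg_cong[where f="emeasure M"])
  have dens: "density ?V (G q) = F q" for q
    unfolding G_def
  proof (rule V.density_RN_deriv)
    show "absolutely_continuous ?V (F q)"
      unfolding absolutely_continuous_def
    proof
      fix A assume A: "A \<in> null_sets ?V"
      then have A': "A \<in> sets MX" by auto
      have "emeasure M (A \<times> {q<..}) \<le> emeasure M (A \<times> UNIV)"
        by (rule emeasure_mono) (use A' in auto)
      then show "A \<in> null_sets (F q)" using A A' V[OF A'] F[OF A'] by (auto simp: F_def null_sets_def)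
    qed
  qed (simp add: F_def)
  have intG: "(\<integral>\<^sup>+x. G q x * indicator A x \<partial>?V) = emeasure M (A \<times> {q<..})" if "A \<in> sets MX" for q A
    using F[OF that, of q] that unfolding dens[of q, symmetric] by (simp add: emeasure_density)
  have intG1: "(\<integral>\<^sup>+x. G q x \<partial>?V) < \<infinity>" for q
  proof -
    have "(\<integral>\<^sup>+x. G q x \<partial>?V) = (\<integral>\<^sup>+x. G q x * indicator (space MX) x \<partial>?V)"
      by (intro nn_integral_cong) auto
    also have "\<dots> = emeasure M (space MX \<times> {q<..})" by (rule intG) simp
    finally show ?thesis by (simp add: emeasure_eq_measure)
  qed
  have Gmono: "AE x in ?V. G q' x \<le> G q x" if "q \<le> q'" for q q'
    using that intG1 by (intro AE_le_of_nn_integral_le) (auto simp: intG intro!: emeasure_mono)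
  have G1: "AE x in ?V. G q x \<le> 1" for q
    using intG1 by (intro AE_le_of_nn_integral_le) (auto simp: intG V intro!: emeasure_mono)
  \<comment> \<open>Each \<open>G q\<close> is fixed only up to a null set depending on
    \<open>q\<close>, so monotonicity is claimed simultaneously for rational thresholds
    only.\<close>
  have "AE x in ?V. \<forall>q\<in>\<rat>. G q x \<le> 1 \<and> (\<forall>q'\<in>\<rat>. q \<le> q' \<longrightarrow> G q' x \<le> G q x)"
  proof -
    have "AE x in ?V. \<forall>q\<in>\<rat>. G q x \<le> 1" using G1 by (intro AE_ball_countable' countable_rat)
    moreover have "AE x in ?V. \<forall>q\<in>\<rat>. \<forall>q'\<in>\<rat>. q \<le> q' \<longrightarrow> G q' x \<le> G q x"
    proof (intro AE_ball_countable' countable_rat)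
      fix q q' :: real show "AE x in ?V. q \<le> q' \<longrightarrow> G q' x \<le> G q x"
        using Gmono[of q q'] by (cases "q \<le> q'") auto
    qed
    ultimately show ?thesis by eventually_elim auto
  qed
  then have AEG: "AE x in ?V. (\<forall>q\<in>\<rat>. G q x \<le> 1) \<and> (\<forall>q\<in>\<rat>. \<forall>q'\<in>\<rat>. q \<le> q' \<longrightarrow> G q' x \<le> G q x)"
    by (rule AE_mp) auto
  \<comment> \<open>The inserted 0 keeps the supremum over a nonempty bounded set at every point,
    also on the null set where \<open>G\<close> is not monotone; so \<open>T\<close> takes values in
    the unit interval everywhere.\<close>
  define J where "J x u = insert 0 {q\<in>\<rat>. 0 \<le> q \<and> q < 1 \<and> ennreal u < G q x}" for x and u :: real
  define T where "T z = Sup (J (fst z) (snd z))" for z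
  have bJ: "bdd_above (J x u)" for x u unfolding J_def by (rule bdd_aboveI[of _ 1]) auto
  have T_gr: "t < T (x, u) \<longleftrightarrow> t < 0 \<or> (\<exists>q\<in>\<rat>. 0 \<le> q \<and> q < 1 \<and> t < q \<and> ennreal u < G q x)" for t x u
    unfolding T_def fst_conv snd_conv
    by (subst less_cSup_iff[OF _ bJ]) (auto simp: J_def)
  have T_bd: "0 \<le> T z" "T z \<le> 1" for z
    unfolding T_def by (rule cSup_upper[OF _ bJ], simp add: J_def) (rule cSup_least, auto simp: J_def)
  have T[measurable]: "T \<in> borel_measurable (MX \<Otimes>\<^sub>M borel)"
  proof (rule borel_measurableI_greater)
    fix t
    have "{z\<in>space (MX \<Otimes>\<^sub>M borel). t < T z} = {z\<in>space (MX \<Otimes>\<^sub>M borel).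
       t < 0 \<or> (\<exists>q\<in>\<rat>. 0 \<le> q \<and> q < 1 \<and> t < q \<and> ennreal (snd z) < G q (fst z))}"
      by (intro Collect_cong conj_cong refl) (metis T_gr prod.collapse)
    also have "\<dots> \<in> sets (MX \<Otimes>\<^sub>M borel)" using countable_rat by measurable
    finally show "{z\<in>space (MX \<Otimes>\<^sub>M borel). t < T z} \<in> sets (MX \<Otimes>\<^sub>M borel)" .
  qed
  let ?N = "distr (?V \<Otimes>\<^sub>M unif01) (MX \<Otimes>\<^sub>M borel) (\<lambda>(x, u). (x, T (x, u)))"
  have sU: "sets (?V \<Otimes>\<^sub>M unif01) = sets (MX \<Otimes>\<^sub>M borel)" by (intro sets_pair_measure_cong) auto
  note [measurable_cong] = sU
  have N: "emeasure ?N (B \<times> C) = (\<integral>\<^sup>+x. emeasure unif01 {u. T (x, u) \<in> C} * indicator B x \<partial>?V)"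
    if [measurable]: "B \<in> sets MX" "C \<in> sets borel" for B C
  proof -
    have "emeasure ?N (B \<times> C) = (\<integral>\<^sup>+z. indicator (B \<times> C) (fst z, T z) \<partial>(?V \<Otimes>\<^sub>M unif01))"
      by (subst nn_integral_indicator[symmetric], simp, subst nn_integral_distr)
         (auto simp: case_prod_beta intro!: nn_integral_cong)
    also have "\<dots> = (\<integral>\<^sup>+x. \<integral>\<^sup>+u. indicator (B \<times> C) (x, T (x, u)) \<partial>unif01 \<partial>?V)"
      by (subst U.nn_integral_fst[symmetric]) (auto simp: )
    also have "\<dots> = (\<integral>\<^sup>+x. emeasure unif01 {u. T (x, u) \<in> C} * indicator B x \<partial>?V)"
    proof (intro nn_integral_cong)
      fix x assume "x \<in> space ?V"
      then have x: "x \<in> space MX" by simp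
      have [measurable]: "(\<lambda>u. T (x, u)) \<in> borel_measurable borel" using measurable_compose[OF measurable_Pair1'[OF x] T] .
      have [measurable]: "{u. T (x, u) \<in> C} \<in> sets borel" using measurable_sets[OF \<open>(\<lambda>u. T (x, u)) \<in> _\<close> that(2)] by (simp add: vimage_def)
      have "(\<integral>\<^sup>+u. indicator (B \<times> C) (x, T (x, u)) \<partial>unif01) = (\<integral>\<^sup>+u. indicator B x * indicator {u. T (x, u) \<in> C} u \<partial>unif01)"
        by (intro nn_integral_cong) (auto split: split_indicator)
      also have "\<dots> = indicator B x * emeasure unif01 {u. T (x, u) \<in> C}"
        by (subst nn_integral_cmult) auto
      finally show "(\<integral>\<^sup>+u. indicator (B \<times> C) (x, T (x, u)) \<partial>unif01) = emeasure unif01 {u. T (x, u) \<in> C} * indicator B x"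
        by (simp add: mult.commute)
    qed
    finally show ?thesis .
  qed
  have half: "emeasure ?N (B \<times> {t<..}) = emeasure M (B \<times> {t<..})" if B[measurable]: "B \<in> sets MX" for B t
  proof -
    consider "t < 0" | "1 \<le> t" | "0 \<le> t" "t < 1" by linarith
    then show ?thesis
    proof cases
      case 1
      have "emeasure ?N (B \<times> {t<..}) = emeasure ?V B"
        using 1 T_bd(1) U.emeasure_space_1 by (subst N) (auto simp: less_le_trans[OF 1] simp del: emeasure_uniform_measure)
      also have "\<dots> = emeasure M (B \<times> UNIV)" by (rule V) fact
      also have "\<dots> = emeasure M (B \<times> {t<..})"
        using conc 1 by (intro emeasure_eq_AE) auto
      finally show ?thesis .
    next
      case 2
      have "{u. T (x, u) \<in> {t<..}} = {}" for x using T_bd(2) 2 by (auto simp: not_less intro: order_trans)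
      then have "emeasure ?N (B \<times> {t<..}) = 0" by (subst N) (auto simp del: emeasure_uniform_measure)
      moreover have "emeasure M (B \<times> {t<..}) = emeasure M {}"
        using conc 2 by (intro emeasure_eq_AE) auto
      ultimately show ?thesis by simp
    next
      case 3
      \<comment> \<open>The threshold \<open>t\<close> may be irrational; rational thresholds
        decreasing to it recover the survival function at \<open>t\<close> by continuity from
        below.\<close>
      obtain q where q: "\<And>n. q n \<in> \<rat>" "\<And>n. t < q n" "\<And>n. q (Suc n) \<le> q n" "q \<longlonglongrightarrow> t"
        using decreasing_rational_approx[of t] by blast
      have q0: "0 \<le> q n" for n using q(2)[of n] 3 by linarith
      \<comment> \<open>The set \<open>J\<close> admits only thresholds below 1; the ones left out
        carry no mass.\<close>
      have G0: "AE x in ?V. G q' x = 0" if "1 \<le> q'" for q'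
      proof -
        have "(\<integral>\<^sup>+x. G q' x * indicator (space MX) x \<partial>?V) = emeasure M (space MX \<times> {q'<..})"
          by (rule intG) simp
        also have "\<dots> = emeasure M {}" using conc that by (intro emeasure_eq_AE) auto
        also have "\<dots> = 0" by simp
        finally have "AE x in ?V. G q' x * indicator (space MX) x = 0"
          by (subst (asm) nn_integral_0_iff_AE) auto
        then show ?thesis by (rule AE_mp) (auto simp: indicator_def)
      qed
      have "AE x in ?V. \<forall>n. 1 \<le> q n \<longrightarrow> G (q n) x = 0"
        using G0 by (auto simp: AE_all_countable)
      with AEG have "AE x in ?V. emeasure unif01 {u. T (x, u) \<in> {t<..}} = (SUP n. G (q n) x)"
      proof eventually_elim
        case (elim x)
        have "t < T (x, u) \<longleftrightarrow> ennreal u < (SUP n. G (q n) x)" for u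
        proof
          assume "t < T (x, u)"
          then obtain p where p: "p \<in> \<rat>" "t < p" "ennreal u < G p x" using 3 unfolding T_gr by auto
          from order_tendstoD(2)[OF q(4) p(2)] obtain n where "q n < p" by (auto simp: eventually_sequentially)
          then have "G p x \<le> G (q n) x" using elim(1) q(1)[of n] p(1) by auto
          with p(3) show "ennreal u < (SUP n. G (q n) x)" by (auto simp: less_SUP_iff intro: less_le_trans)
        next
          assume "ennreal u < (SUP n. G (q n) x)"
          then obtain n where u: "ennreal u < G (q n) x" by (auto simp: less_SUP_iff)
          then have "q n < 1" using elim(2) by (metis not_less not_less_zero)
          with u show "t < T (x, u)" unfolding T_gr using q(1)[of n] q(2)[of n] q0[of n] by blast
        qed
        then have "{u. T (x, u) \<in> {t<..}} = {u. ennreal u < (SUP n. G (q n) x)}" by simp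
        moreover have "(SUP n. G (q n) x) \<le> 1" using elim(1) q(1) by (auto intro!: SUP_least)
        ultimately show ?case by (simp only: emeasure_unif01_less)
      qed
      then have "emeasure ?N (B \<times> {t<..}) = (\<integral>\<^sup>+x. (SUP n. G (q n) x) * indicator B x \<partial>?V)"
        by (subst N) (auto intro!: nn_integral_cong_AE)
      also have "\<dots> = (\<integral>\<^sup>+x. (SUP n. G (q n) x * indicator B x) \<partial>?V)"
        by (simp add: SUP_mult_right_ennreal)
      also have "\<dots> = (SUP n. (\<integral>\<^sup>+x. G (q n) x * indicator B x \<partial>?V))"
      proof (rule nn_integral_monotone_convergence_SUP_AE)
        fix n show "AE x in ?V. G (q n) x * indicator B x \<le> G (q (Suc n)) x * indicator B x"
          using Gmono[OF q(3)[of n]] by eventually_elim (auto split: split_indicator)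
      qed simp
      also have "\<dots> = (SUP n. emeasure M (B \<times> {q n<..}))" by (simp add: intG)
      also have "\<dots> = emeasure M (\<Union>n. B \<times> {q n<..})"
        using q(3) by (intro SUP_emeasure_incseq) (auto intro!: incseq_SucI intro: order.strict_trans1)
      also have "(\<Union>n. B \<times> {q n<..}) = B \<times> {t<..}"
      proof safe
        fix x y assume "x \<in> B" "t < y"
        from order_tendstoD(2)[OF q(4) \<open>t < y\<close>] obtain n where "q n < y" by (auto simp: eventually_sequentially)
        with \<open>x \<in> B\<close> show "(x, y) \<in> (\<Union>n. B \<times> {q n<..})" by auto
      qed (use q(2) in \<open>auto intro: less_trans\<close>)
      finally show ?thesis .
    qed
  qed
  have finN: "finite_measure ?N"
    by (intro finite_measure.finite_measure_distr finite_measure_pair_measure V.finite_measure_axioms U.finite_measure_axioms) measurable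
  have rect: "emeasure M (B \<times> C) = emeasure ?N (B \<times> C)" if B[measurable]: "B \<in> sets MX" and C[measurable]: "C \<in> sets borel" for B C
  proof -
    \<comment> \<open>For fixed \<open>B\<close>, restrict to \<open>B \<times> UNIV\<close> and
      project to the line: a finite measure there is determined by its values on half-lines.\<close>
    let ?D = "\<lambda>K. distr (density K (indicator (B \<times> UNIV))) borel snd"
    have D: "emeasure (?D K) C = emeasure K (B \<times> C)"
      if K: "sets K = sets (MX \<Otimes>\<^sub>M borel)" and C[measurable]: "C \<in> sets borel" for K and C :: "real set"
    proof -
      note [measurable_cong] = K
      have "B \<times> UNIV \<inter> (snd -` C \<inter> space K) = B \<times> C"
        using sets.sets_into_space[OF B] by (auto simp: sets_eq_imp_space_eq[OF K] space_pair_measure)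
      moreover have "snd -` C \<inter> space K \<in> sets K" "B \<times> UNIV \<in> sets K" by measurable
      ultimately show ?thesis
        by (simp add: emeasure_distr emeasure_density indicator_inter_arith[symmetric] mult.commute)
    qed
    have "?D M = ?D ?N"
    proof (rule measure_eqI_lessThan)
      show "emeasure (?D M) {x<..} < \<infinity>" for x by (simp add: D[OF sM] emeasure_eq_measure)
      show "emeasure (?D M) {x<..} = emeasure (?D ?N) {x<..}" for x
        by (simp add: D[OF sM] D[of ?N] half)
    qed auto
    then show ?thesis using D[OF sM C] D[OF _ C, of ?N] by simp
  qed
  let ?E = "{a \<times> b | a b. a \<in> sets MX \<and> b \<in> sets (borel :: real measure)}"
  have "M = ?N"
  proof (rule measure_eqI_generator_eq[where E="?E" and \<Omega>="space MX \<times> UNIV" and A="\<lambda>_. space MX \<times> UNIV"])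
    show "?E \<subseteq> Pow (space MX \<times> UNIV)" using sets.sets_into_space by fastforce
    show "Int_stable ?E" by (rule Int_stable_pair_measure_generator)
    show "sets M = sigma_sets (space MX \<times> UNIV) ?E" "sets ?N = sigma_sets (space MX \<times> UNIV) ?E"
      by (simp_all add: sM sets_pair_measure)
    fix X assume "X \<in> ?E"
    then obtain B C where X: "X = B \<times> C" "B \<in> sets MX" "C \<in> sets borel" by blast
    show "emeasure M X = emeasure ?N X" unfolding X(1) by (rule rect[OF X(2,3)])
  next
    show "range (\<lambda>_. space MX \<times> UNIV) \<subseteq> ?E"
      by (intro image_subsetI CollectI exI[of _ "space MX"] exI[of _ UNIV] conjI) auto
  qed (auto simp: emeasure_eq_measure)
  with T show ?thesis by blast
qed

section \<open>Coding the points of a Polish space by real numbers\<close>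

definition quaternary_sum :: "(nat \<Rightarrow> bool) \<Rightarrow> real" where
  "quaternary_sum c = (\<Sum>n. of_bool (c n) * (1/4) ^ Suc n)"

lemma summable_quaternary: "summable (\<lambda>n. of_bool (c n) * (1/4 :: real) ^ Suc n)"
  by (rule summable_comparison_test'[of "\<lambda>n. (1/4 :: real) ^ Suc n" 0])
     (auto simp: summable_Suc_iff[of "\<lambda>n. (1/4 :: real) ^ n"])

lemma quaternary_sum_bounds: "0 \<le> quaternary_sum c" "quaternary_sum c \<le> 1/3"
proof -
  show "0 \<le> quaternary_sum c"
    unfolding quaternary_sum_def by (intro suminf_nonneg summable_quaternary) auto
  have "quaternary_sum c \<le> (\<Sum>n. (1/4) ^ Suc n)"
    unfolding quaternary_sum_def
    by (intro suminf_le summable_quaternary) (auto simp: summable_Suc_iff[of "\<lambda>n. (1/4 :: real) ^ n"])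
  also have "\<dots> = (1/4) * (\<Sum>n. (1/4) ^ n)"
    by (subst suminf_mult[symmetric]) (auto intro: summable_geometric)
  also have "\<dots> = 1/3" by (simp add: suminf_geometric)
  finally show "quaternary_sum c \<le> 1/3" .
qed

lemma quaternary_sum_pos: "c n \<Longrightarrow> 0 < quaternary_sum c"
  unfolding quaternary_sum_def by (rule suminf_pos2[OF summable_quaternary, of _ n]) auto

lemma quaternary_sum_shift: "4 * quaternary_sum c = of_bool (c 0) + quaternary_sum (\<lambda>n. c (Suc n))"
proof -
  have "quaternary_sum c = of_bool (c 0) * (1/4) ^ Suc 0 + (\<Sum>n. of_bool (c (Suc n)) * (1/4) ^ Suc (Suc n))"
    unfolding quaternary_sum_def by (subst suminf_split_head[OF summable_quaternary]) simp
  also have "(\<Sum>n. of_bool (c (Suc n)) * (1/4 :: real) ^ Suc (Suc n)) = (1/4) * quaternary_sum (\<lambda>n. c (Suc n))"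
    unfolding quaternary_sum_def by (subst suminf_mult[OF summable_quaternary, symmetric]) (simp add: algebra_simps)
  finally show ?thesis by simp
qed

text \<open>Base 4 with digits 0 and 1 leaves a tail of at most 1/3, so no carry occurs and the
  digits can be read back, unlike in binary expansions. Digits before position \<open>n\<close>
  contribute multiples of 4 to the floor, so its parity is digit \<open>n\<close>.\<close>

lemma quaternary_digit: "odd \<lfloor>4 ^ Suc n * quaternary_sum c\<rfloor> \<longleftrightarrow> c n"
proof (induction n arbitrary: c)
  case 0
  have "\<lfloor>4 * quaternary_sum c\<rfloor> = of_bool (c 0)"
    using quaternary_sum_bounds[of "\<lambda>n. c (Suc n)"] unfolding quaternary_sum_shift[of c]
    by (intro floor_unique) auto
  then show ?case by simp
next
  case (Suc n)
  have "4 ^ Suc (Suc n) * quaternary_sum c = 4 ^ Suc n * (4 * quaternary_sum c)" by simp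
  also have "\<dots> = of_int (4 ^ Suc n * of_bool (c 0)) + 4 ^ Suc n * quaternary_sum (\<lambda>n. c (Suc n))"
    unfolding quaternary_sum_shift[of c] by (simp add: algebra_simps)
  finally have "\<lfloor>4 ^ Suc (Suc n) * quaternary_sum c\<rfloor>
      = 4 ^ Suc n * of_bool (c 0) + \<lfloor>4 ^ Suc n * quaternary_sum (\<lambda>n. c (Suc n))\<rfloor>"
    by (simp only: int_add_floor)
  then show ?case using Suc.IH[of "\<lambda>n. c (Suc n)"] by simp
qed

text \<open>A point is encoded by the set of balls of a countable base that contain it; the inverse reads off the
  centres of the balls of radius \<open>1/(k+1)\<close> and takes the limit.\<close>
lemma polish_embeds_in_unit_interval:
  "\<exists>(f :: 'a::polish_space \<Rightarrow> real) g. f \<in> borel_measurable borel \<and> g \<in> borel_measurable borel \<and>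
     (\<forall>a. 0 < f a \<and> f a \<le> 1 \<and> g (f a) = a)"
proof -
  obtain D :: "'a set" where D: "countable D" "\<And>X. open X \<Longrightarrow> X \<noteq> {} \<Longrightarrow> \<exists>d\<in>D. d \<in> X"
    using countable_dense_setE by blast
  have "D \<noteq> {}" using D(2)[of UNIV] by auto
  define d where "d = from_nat_into D"
  \<comment> \<open>Through \<open>prod_decode\<close>, \<open>n\<close> codes a centre in the dense
    set and a number \<open>k\<close> giving the radius \<open>1/(k+1)\<close>.\<close>
  define W where "W n = ball (d (fst (prod_decode n))) (1 / real (Suc (snd (prod_decode n))))" for n
  define f where "f a = quaternary_sum (\<lambda>n. a \<in> W n)" for a
  define i where "i k z = (LEAST n. snd (prod_decode n) = k \<and> odd \<lfloor>4 ^ Suc n * z\<rfloor>)" for k and z :: real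
  define h where "h k z = d (fst (prod_decode (i k z)))" for k z
  \<comment> \<open>An arbitrary real need not code a point; the default \<open>d 0\<close> is used
    when the centres are not Cauchy, which is a Borel condition.\<close>
  define g where "g z = (if Cauchy (\<lambda>k. h k z) then lim (\<lambda>k. h k z) else d 0)" for z
  have ex: "\<exists>n. snd (prod_decode n) = k \<and> a \<in> W n" for k a
  proof -
    obtain x where "x \<in> D" "x \<in> ball a (1 / real (Suc k))"
      using D(2)[of "ball a (1 / real (Suc k))"] by auto
    moreover then obtain m where "x = d m" unfolding d_def by (metis D(1) from_nat_into_surj)
    ultimately show ?thesis
      by (intro exI[of _ "prod_encode (m, k)"]) (auto simp: W_def dist_commute)
  qed
  have f_pos: "0 < f a" "f a \<le> 1" for a
    using ex[of 0 a] quaternary_sum_pos quaternary_sum_bounds(2)[of "\<lambda>n. a \<in> W n"] unfolding f_def by auto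
  have h_dist: "dist (h k (f a)) a < 1 / real (Suc k)" for k a
  proof -
    have i: "i k (f a) = (LEAST n. snd (prod_decode n) = k \<and> a \<in> W n)"
      unfolding i_def f_def quaternary_digit ..
    have "snd (prod_decode (i k (f a))) = k \<and> a \<in> W (i k (f a))"
      unfolding i by (rule LeastI_ex[OF ex])
    then show ?thesis by (auto simp: W_def h_def)
  qed
  have "(\<lambda>k. h k (f a)) \<longlonglongrightarrow> a" for a
  proof (rule metric_LIMSEQ_I)
    fix e :: real assume "e > 0"
    then obtain n where n: "1 / real (Suc n) < e" using nat_approx_posE by blast
    have "dist (h k (f a)) a < e" if "k \<ge> n" for k
    proof -
      have "1 / real (Suc k) \<le> 1 / real (Suc n)" using that by (intro divide_left_mono) auto
      with h_dist[of k a] n show ?thesis by linarith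
    qed
    then show "\<exists>no. \<forall>n\<ge>no. dist (h n (f a)) a < e" by blast
  qed
  then have gf: "g (f a) = a" for a
    unfolding g_def using LIMSEQ_imp_Cauchy limI by metis
  have W[measurable]: "W n \<in> sets borel" for n unfolding W_def by simp
  have f_meas: "f \<in> borel_measurable borel"
    unfolding f_def quaternary_sum_def by measurable
  have [measurable]: "i k \<in> measurable borel (count_space UNIV)" for k
    unfolding i_def by measurable
  have h_meas[measurable]: "h k \<in> borel_measurable borel" for k
    unfolding h_def by measurable
  have g_meas: "g \<in> borel_measurable borel"
  proof (rule borel_measurable_LIMSEQ_metric)
    have [measurable]: "Measurable.pred borel (\<lambda>z. Cauchy (\<lambda>k. h k z))"
      unfolding pred_def by (rule sets_Collect_Cauchy) (rule h_meas)
    show "(\<lambda>z. if Cauchy (\<lambda>k. h k z) then h n z else d 0) \<in> borel_measurable borel" for n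
      by measurable
    show "(\<lambda>n. if Cauchy (\<lambda>k. h k z) then h n z else d 0) \<longlonglongrightarrow> g z" for z
      unfolding g_def using Cauchy_convergent convergent_LIMSEQ_iff by auto
  qed
  show ?thesis using f_pos gf f_meas g_meas by blast
qed

text \<open>The action space is coded in the unit interval, the conditional quantile transform is
  applied there, and its output is decoded. The law of \<open>S (x, u)\<close> then serves as the
  conditional law of the action given \<open>x\<close>.\<close>

theorem randomization:
  fixes AA :: "'a::polish_space set" and M :: "('x \<times> 'a) measure"
  defines "MA \<equiv> restrict_space borel AA"
  assumes AA: "AA \<in> sets borel" "AA \<noteq> {}" and fin: "finite_measure M" and sM: "sets M = sets (MX \<Otimes>\<^sub>M MA)"
  shows "\<exists>S\<in>measurable (MX \<Otimes>\<^sub>M borel) MA. \<forall>F\<in>borel_measurable (MX \<Otimes>\<^sub>M MA).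
    (\<integral>\<^sup>+z. F z \<partial>M) = (\<integral>\<^sup>+x. \<integral>\<^sup>+u. F (x, S (x, u)) \<partial>unif01 \<partial>distr M MX fst)"
proof -
  interpret finite_measure M by fact
  interpret U: prob_space unif01 by (rule prob_space_unif01)
  note [measurable_cong] = sM
  obtain f :: "'a \<Rightarrow> real" and g where f[measurable]: "f \<in> borel_measurable borel"
    and g[measurable]: "g \<in> borel_measurable borel" and fg: "\<And>a. 0 < f a" "\<And>a. f a \<le> 1" "\<And>a. g (f a) = a"
    using polish_embeds_in_unit_interval[where 'a='a] by blast
  obtain a0 where a0: "a0 \<in> AA" using AA(2) by auto
  have [measurable]: "AA \<in> sets borel" by fact
  have f'[measurable]: "f \<in> borel_measurable MA" unfolding MA_def by (rule measurable_restrict_space1) fact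
  \<comment> \<open>Decoded values outside \<open>AA\<close> are sent to \<open>a0\<close>, so that
    every real code yields an action.\<close>
  define g' where "g' z = (if g z \<in> AA then g z else a0)" for z
  have g'[measurable]: "g' \<in> measurable borel MA"
    unfolding MA_def g'_def using a0 by (intro measurable_restrict_space2) auto
  have sp: "space MA = AA" unfolding MA_def by (simp add: space_restrict_space)
  let ?M' = "distr M (MX \<Otimes>\<^sub>M borel) (\<lambda>(x, a). (x, f a))"
  have "\<exists>T\<in>borel_measurable (MX \<Otimes>\<^sub>M borel).
    ?M' = distr (distr ?M' MX fst \<Otimes>\<^sub>M unif01) (MX \<Otimes>\<^sub>M borel) (\<lambda>(x, u). (x, T (x, u)))"
  proof (rule randomization_unit_interval)
    show "finite_measure ?M'" by (rule finite_measure_distr) measurable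
    show "AE z in ?M'. 0 < snd z \<and> snd z \<le> 1"
      by (subst AE_distr_iff) (auto simp: fg case_prod_beta)
  qed simp
  then obtain T where T[measurable]: "T \<in> borel_measurable (MX \<Otimes>\<^sub>M borel)"
    and eq: "?M' = distr (distr ?M' MX fst \<Otimes>\<^sub>M unif01) (MX \<Otimes>\<^sub>M borel) (\<lambda>(x, u). (x, T (x, u)))" by blast
  have marg: "distr ?M' MX fst = distr M MX fst"
    by (subst distr_distr) (auto simp: comp_def case_prod_beta)
  have sU: "sets (distr M MX fst \<Otimes>\<^sub>M unif01) = sets (MX \<Otimes>\<^sub>M borel)" by (intro sets_pair_measure_cong) auto
  note [measurable_cong] = sU
  have "(\<integral>\<^sup>+z. F z \<partial>M) = (\<integral>\<^sup>+x. \<integral>\<^sup>+u. F (x, g' (T (x, u))) \<partial>unif01 \<partial>distr M MX fst)"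
    if [measurable]: "F \<in> borel_measurable (MX \<Otimes>\<^sub>M MA)" for F
  proof -
    have "(\<integral>\<^sup>+z. F z \<partial>M) = (\<integral>\<^sup>+z. F (fst z, g' (f (snd z))) \<partial>M)"
      by (intro nn_integral_cong) (auto simp: sets_eq_imp_space_eq[OF sM] space_pair_measure sp g'_def fg)
    also have "\<dots> = (\<integral>\<^sup>+z. F (fst z, g' (snd z)) \<partial>?M')"
      by (subst nn_integral_distr) (auto simp: case_prod_beta)
    also have "\<dots> = (\<integral>\<^sup>+z. F (fst z, g' (T z)) \<partial>(distr M MX fst \<Otimes>\<^sub>M unif01))"
      by (subst eq, subst marg, subst nn_integral_distr) (auto simp: case_prod_beta)
    also have "\<dots> = (\<integral>\<^sup>+x. \<integral>\<^sup>+u. F (x, g' (T (x, u))) \<partial>unif01 \<partial>distr M MX fst)"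
      by (subst U.nn_integral_fst[symmetric]) auto
    finally show ?thesis .
  qed
  then show ?thesis by (intro bexI[of _ "\<lambda>z. g' (T z)"]) auto
qed


section \<open>Selection from sections of positive measure\<close>

text \<open>Inner approximation by closed sections with one error bound for every \<open>x\<close>.
  The joint measurability of \<open>C\<close> is what lets selections made in its sections be
  measurable in \<open>x\<close>.\<close>

definition inner_closed :: "'x measure \<Rightarrow> 'b::topological_space measure \<Rightarrow> ('x \<times> 'b) set \<Rightarrow> bool" where
  "inner_closed M U B \<longleftrightarrow> (\<forall>e>0. \<exists>C\<in>sets (M \<Otimes>\<^sub>M borel). C \<subseteq> B \<and>
     (\<forall>x\<in>space M. closed (Pair x -` C) \<and> emeasure U (Pair x -` (B - C)) \<le> ennreal e))"

lemma borel_section: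
  fixes B :: "('x \<times> 'b::topological_space) set"
  shows "B \<in> sets (M \<Otimes>\<^sub>M borel) \<Longrightarrow> Pair x -` B \<in> sets (borel :: 'b measure)"
  by (rule sets_Pair1)

text \<open>Only the second factor needs approximation: a finite Borel measure on a Polish space is
  inner regular by compact sets, and one compact \<open>K\<close> serves all
  \<open>x\<close>.\<close>

lemma inner_closed_rect:
  fixes U :: "'b::polish_space measure"
  assumes U: "finite_measure U" "sets U = sets borel"
    and A: "A \<in> sets M" and V: "V \<in> sets borel"
  shows "inner_closed M U (A \<times> V)"
  unfolding inner_closed_def
proof (intro allI impI)
  interpret finite_measure U by fact
  fix e :: real assume e: "e > 0"
  have fin: "emeasure U V < \<infinity>" by (simp add: emeasure_eq_measure)
  have "\<exists>K. K \<subseteq> V \<and> compact K \<and> emeasure U V \<le> emeasure U K + ennreal e"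
  proof (cases "emeasure U V = 0")
    case True then show ?thesis by (intro exI[of _ "{}"]) auto
  next
    case False
    have "emeasure U V - ennreal e < emeasure U V"
      using False fin e by (intro ennreal_between) (auto simp: zero_less_iff_neq_zero)
    also have "emeasure U V = (SUP K \<in> {K. K \<subseteq> V \<and> compact K}. emeasure U K)"
      by (rule inner_regular) (use U V in \<open>auto simp: emeasure_eq_measure\<close>)
    finally obtain K where K: "K \<subseteq> V" "compact K" "emeasure U V - ennreal e < emeasure U K"
      unfolding less_SUP_iff by auto
    then have "emeasure U V \<le> emeasure U K + ennreal e"
      by (metis add.commute diff_le_self_ennreal ennreal_minus_le_iff less_imp_le  order_trans)
    with K show ?thesis by auto
  qed
  then obtain K where K: "K \<subseteq> V" "compact K" "emeasure U V \<le> emeasure U K + ennreal e" by auto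
  have Kb: "K \<in> sets U" unfolding U(2) by (intro borel_closed compact_imp_closed K)
  have "emeasure U (V - K) \<le> ennreal e"
    using K Kb V U fin
    by (subst emeasure_Diff) (auto simp: ennreal_minus_le_iff emeasure_eq_measure)
  then show "\<exists>C\<in>sets (M \<Otimes>\<^sub>M borel). C \<subseteq> A \<times> V \<and>
     (\<forall>x\<in>space M. closed (Pair x -` C) \<and> emeasure U (Pair x -` (A \<times> V - C)) \<le> ennreal e)"
  proof (intro bexI[of _ "A \<times> K"] conjI ballI)
    fix x
    show "closed (Pair x -` (A \<times> K))" using K compact_imp_closed by (cases "x \<in> A") auto
    assume "emeasure U (V - K) \<le> ennreal e"
    moreover have "Pair x -` (A \<times> V - A \<times> K) \<subseteq> V - K" by auto
    ultimately show "emeasure U (Pair x -` (A \<times> V - A \<times> K)) \<le> ennreal e"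
      using emeasure_mono[of _ "V - K" U] Kb V unfolding U(2) by (meson order_trans sets.Diff)
  next
    show "A \<times> K \<in> sets (M \<Otimes>\<^sub>M borel)" using A Kb unfolding U(2) by (rule pair_measureI)
    show "A \<times> K \<subseteq> A \<times> V" using K(1) by auto
  qed
qed

lemma eps_pow2:
  assumes "e > 0"
  shows "(\<Sum>n. ennreal (e * (1/2)^Suc n)) = ennreal e"
proof -
  have "(\<lambda>n. e * (1/2)^Suc n) sums (e * 1)"
    by (rule sums_mult) (use power_half_series in simp)
  then show ?thesis using assms
    by (intro sums_unique[symmetric]) (simp add: sums_ennreal del: power_Suc)
qed

text \<open>The error \<open>e\<close> is split into the pieces \<open>e/2^(n+1)\<close>, and
  intersections keep sections closed.\<close>

lemma inner_closed_INT:
  fixes U :: "'b::topological_space measure" and B :: "nat \<Rightarrow> ('x \<times> 'b) set"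
  assumes U: "sets U = sets borel" and B: "\<And>n. inner_closed M U (B n)" "\<And>n. B n \<in> sets (M \<Otimes>\<^sub>M borel)"
  shows "inner_closed M U (\<Inter>n. B n)"
  unfolding inner_closed_def
proof (intro allI impI)
  fix e :: real assume e: "e > 0"
  have "\<exists>C. \<forall>n. C n \<in> sets (M \<Otimes>\<^sub>M borel) \<and> C n \<subseteq> B n \<and>
     (\<forall>x\<in>space M. closed (Pair x -` C n) \<and> emeasure U (Pair x -` (B n - C n)) \<le> ennreal (e * (1/2)^Suc n))"
    using B(1) e unfolding inner_closed_def Bex_def by (intro choice) (auto dest!: spec[of _ "e * (1/2)^Suc _"])
  then obtain C where C: "\<And>n. C n \<in> sets (M \<Otimes>\<^sub>M borel)" "\<And>n. C n \<subseteq> B n"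
    "\<And>n x. x\<in>space M \<Longrightarrow> closed (Pair x -` C n)"
    "\<And>n x. x\<in>space M \<Longrightarrow> emeasure U (Pair x -` (B n - C n)) \<le> ennreal (e * (1/2)^Suc n)"
    by blast
  show "\<exists>C\<in>sets (M \<Otimes>\<^sub>M borel). C \<subseteq> (\<Inter>n. B n) \<and>
     (\<forall>x\<in>space M. closed (Pair x -` C) \<and> emeasure U (Pair x -` ((\<Inter>n. B n) - C)) \<le> ennreal e)"
  proof (intro bexI[of _ "\<Inter>n. C n"] conjI ballI)
    fix x assume x: "x \<in> space M"
    show "closed (Pair x -` (\<Inter>n. C n))" using C(3)[OF x] by (auto simp: vimage_INT)
    have m: "Pair x -` (B n - C n) \<in> sets U" for n
      unfolding U by (intro borel_section[of _ M]) (use B(2) C(1) in auto)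
    have "emeasure U (Pair x -` ((\<Inter>n. B n) - (\<Inter>n. C n))) \<le> emeasure U (\<Union>n. Pair x -` (B n - C n))"
      by (rule emeasure_mono) (use m in auto)
    also have "\<dots> \<le> (\<Sum>n. emeasure U (Pair x -` (B n - C n)))"
      by (rule emeasure_subadditive_countably) (use m in auto)
    also have "\<dots> \<le> (\<Sum>n. ennreal (e * (1/2)^Suc n))"
      by (intro suminf_le C(4)[OF x]) auto
    finally show "emeasure U (Pair x -` ((\<Inter>n. B n) - (\<Inter>n. C n))) \<le> ennreal e"
      using eps_pow2[OF e] by simp
  next
    show "(\<Inter>n. C n) \<subseteq> (\<Inter>n. B n)" using C(2) by blast
  qed (use C(1) in auto)
qed

text \<open>A union of infinitely many closed sections need not be closed, so at \<open>x\<close>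
  only the first \<open>N x\<close> approximants are kept, where \<open>N x\<close> is the first
  \<open>m\<close> such that the part of the union outside \<open>B 0, ..., B (m-1)\<close> has a
  section of measure at most \<open>e/2\<close>. The other \<open>e/2\<close> pays for the
  approximations. \<open>N\<close> is measurable because section measures are.\<close>

lemma inner_closed_UN:
  fixes U :: "'b::topological_space measure" and B :: "nat \<Rightarrow> ('x \<times> 'b) set"
  assumes fin: "finite_measure U" and U: "sets U = sets borel"
    and B: "\<And>n. inner_closed M U (B n)" "\<And>n. B n \<in> sets (M \<Otimes>\<^sub>M borel)"
  shows "inner_closed M U (\<Union>n. B n)"
  unfolding inner_closed_def
proof (intro allI impI)
  interpret finite_measure U by fact
  fix e :: real assume e: "e > 0"
  then have e2: "e/2 > 0" by simp
  have "\<exists>C. \<forall>n. C n \<in> sets (M \<Otimes>\<^sub>M borel) \<and> C n \<subseteq> B n \<and>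
     (\<forall>x\<in>space M. closed (Pair x -` C n) \<and> emeasure U (Pair x -` (B n - C n)) \<le> ennreal (e/2 * (1/2)^Suc n))"
    using B(1) e unfolding inner_closed_def Bex_def by (intro choice) (auto dest!: spec[of _ "e/2 * (1/2)^Suc _"])
  then obtain C where C: "\<And>n. C n \<in> sets (M \<Otimes>\<^sub>M borel)" "\<And>n. C n \<subseteq> B n"
    "\<And>n x. x\<in>space M \<Longrightarrow> closed (Pair x -` C n)"
    "\<And>n x. x\<in>space M \<Longrightarrow> emeasure U (Pair x -` (B n - C n)) \<le> ennreal (e/2 * (1/2)^Suc n)"
    by blast
  define D where "D m = (\<Union>n. B n) - (\<Union>n<m. B n)" for m
  have Dm: "D m \<in> sets (M \<Otimes>\<^sub>M borel)" for m unfolding D_def using B(2) by auto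
  then have Dm': "Pair x -` D m \<in> sets U" for m x unfolding U by (rule borel_section)
  have Dmeas: "(\<lambda>x. emeasure U (Pair x -` D m)) \<in> borel_measurable M" for m
    using measurable_emeasure_Pair[of "D m" M] Dm U by (simp cong: sets_pair_measure_cong)
  have ex: "\<exists>m. emeasure U (Pair x -` D m) \<le> ennreal (e/2)" for x
  proof -
    have "(\<lambda>m. emeasure U (Pair x -` D m)) \<longlonglongrightarrow> emeasure U (\<Inter>m. Pair x -` D m)"
    proof (rule Lim_emeasure_decseq)
      show "range (\<lambda>m. Pair x -` D m) \<subseteq> sets U" using Dm' by auto
      show "decseq (\<lambda>m. Pair x -` D m)" unfolding D_def by (rule decseq_SucI) auto
    qed (simp add: emeasure_eq_measure)
    also have "(\<Inter>m. Pair x -` D m) = {}" unfolding D_def by force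
    finally have "(\<lambda>m. emeasure U (Pair x -` D m)) \<longlonglongrightarrow> 0" by simp
    from order_tendstoD(2)[OF this, of "ennreal (e/2)"] e2 show ?thesis
      by (auto simp: eventually_sequentially intro: less_imp_le)
  qed
  define N where "N x = (LEAST m. emeasure U (Pair x -` D m) \<le> ennreal (e/2))" for x
  have Nmeas[measurable]: "N \<in> measurable M (count_space UNIV)"
    unfolding N_def using Dmeas by measurable
  have N: "emeasure U (Pair x -` D (N x)) \<le> ennreal (e/2)" for x
    unfolding N_def using ex[of x] by (rule LeastI_ex)
  define E where "E = (\<Union>n. C n \<inter> ({x\<in>space M. n < N x} \<times> UNIV))"
  show "\<exists>C\<in>sets (M \<Otimes>\<^sub>M borel). C \<subseteq> (\<Union>n. B n) \<and>
     (\<forall>x\<in>space M. closed (Pair x -` C) \<and> emeasure U (Pair x -` ((\<Union>n. B n) - C)) \<le> ennreal e)"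
  proof (intro bexI[of _ E] conjI ballI)
    have "{x\<in>space M. n < N x} \<times> UNIV \<in> sets (M \<Otimes>\<^sub>M borel)" for n
      by (intro pair_measureI) auto
    then show "E \<in> sets (M \<Otimes>\<^sub>M borel)" unfolding E_def using C(1) by auto
    show "E \<subseteq> (\<Union>n. B n)" unfolding E_def using C(2) by auto
    fix x assume x: "x \<in> space M"
    have "Pair x -` E = (\<Union>n<N x. Pair x -` C n)" unfolding E_def using x by auto
    then show "closed (Pair x -` E)" using C(3)[OF x] by auto
    have m: "Pair x -` (B n - C n) \<in> sets U" for n
      unfolding U by (intro borel_section[of _ M]) (use B(2) C(1) in auto)
    have "emeasure U (Pair x -` ((\<Union>n. B n) - E)) \<le> emeasure U (Pair x -` D (N x) \<union> (\<Union>n. Pair x -` (B n - C n)))"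
      by (rule emeasure_mono) (use m Dm' x in \<open>auto simp: D_def E_def\<close>)
    also have "\<dots> \<le> emeasure U (Pair x -` D (N x)) + emeasure U (\<Union>n. Pair x -` (B n - C n))"
      by (rule emeasure_subadditive) (use m Dm' in auto)
    also have "emeasure U (\<Union>n. Pair x -` (B n - C n)) \<le> (\<Sum>n. emeasure U (Pair x -` (B n - C n)))"
      by (rule emeasure_subadditive_countably) (use m in auto)
    also have "\<dots> \<le> (\<Sum>n. ennreal (e/2 * (1/2)^Suc n))"
      by (intro suminf_le C(4)[OF x]) auto
    also have "\<dots> = ennreal (e/2)" by (rule eps_pow2[OF e2])
    finally have "emeasure U (Pair x -` ((\<Union>n. B n) - E)) \<le> ennreal (e/2) + ennreal (e/2)"
      using N[of x] by (meson add_mono order_refl order_trans)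
    then show "emeasure U (Pair x -` ((\<Union>n. B n) - E)) \<le> ennreal e"
      using e by (simp flip: ennreal_plus)
  qed
qed

text \<open>The property is not visibly stable under complements; carrying it for \<open>B\<close>
  and its complement together makes the induction over the generated sigma-algebra work.\<close>

lemma inner_closed_sets:
  fixes U :: "'b::polish_space measure"
  assumes U: "finite_measure U" "sets U = sets borel"
    and B: "B \<in> sets (M \<Otimes>\<^sub>M (borel :: 'b measure))"
  shows "inner_closed M U B"
proof -
  let ?S = "space M \<times> (UNIV::'b set)"
  let ?G = "{a \<times> b | a b. a \<in> sets M \<and> b \<in> sets (borel :: 'b measure)}"
  have eq: "sets (M \<Otimes>\<^sub>M (borel :: 'b measure)) = sigma_sets ?S ?G"
    by (simp add: sets_pair_measure)
  have "B \<in> sigma_sets ?S ?G" using B by (simp add: eq)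
  then have "inner_closed M U B \<and> inner_closed M U (?S - B) \<and> B \<in> sets (M \<Otimes>\<^sub>M (borel :: 'b measure))"
  proof induction
    case (Basic a)
    then obtain A V where a: "a = A \<times> V" "A \<in> sets M" "V \<in> sets borel" by auto
    \<comment> \<open>The complement of a rectangle is a union of two rectangles, the second
      repeated from index 1 on so as to fit a countable union.\<close>
    let ?F = "\<lambda>n::nat. if n = 0 then (space M - A) \<times> UNIV else A \<times> (UNIV - V)"
    have "?S - a = (\<Union>n. ?F n)" using a sets.sets_into_space[OF a(2)]
      by (auto split: if_splits)
    moreover have "inner_closed M U (\<Union>n. ?F n)"
    proof (rule inner_closed_UN[OF U])
      fix n
      have "inner_closed M U ((space M - A) \<times> UNIV)" "inner_closed M U (A \<times> (UNIV - V))"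
        by (rule inner_closed_rect[OF U]; use a in auto)+
      then show "inner_closed M U (?F n)" by simp
    qed (use a in auto)
    ultimately show ?case using inner_closed_rect[OF U] a by auto
  next
    case Empty
    have "inner_closed M U ({} \<times> {})" "inner_closed M U (space M \<times> UNIV)"
      by (rule inner_closed_rect[OF U]; simp)+
    then show ?case by simp
  next
    case (Compl a)
    then have "a \<subseteq> ?S" using sets.sets_into_space[of a "M \<Otimes>\<^sub>M (borel :: 'b measure)"]
      by (simp add: space_pair_measure)
    then have "?S - (?S - a) = a" by auto
    moreover have "?S \<in> sets (M \<Otimes>\<^sub>M (borel :: 'b measure))" by auto
    ultimately show ?case using Compl by (auto simp del: Times_Diff_distrib1)
  next
    case (Union a)
    have "?S - (\<Union>n. a n) = (\<Inter>n. ?S - a n)" by auto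
    moreover have "?S - a n \<in> sets (M \<Otimes>\<^sub>M (borel :: 'b measure))" for n using Union by auto
    ultimately show ?case
      using inner_closed_UN[OF U, of M a] inner_closed_INT[OF U(2), of M "\<lambda>n. ?S - a n"] Union by auto
  qed
  then show ?thesis by simp
qed

text \<open>The selected point is the essential infimum of the section: the infimum of the levels
  below which the section has positive measure. It is a limit of points of the section, hence
  belongs to it by closedness, and \<open>s x < t\<close> is decided by rational levels.\<close>

lemma closed_selection:
  fixes M :: "'x measure" and U :: "real measure"
  assumes U: "finite_measure U" "sets U = sets borel"
    and C: "C \<in> sets (M \<Otimes>\<^sub>M borel)" "\<And>x. x \<in> space M \<Longrightarrow> closed (Pair x -` C)"
    and bd: "\<And>x u. (x, u) \<in> C \<Longrightarrow> 0 \<le> u \<and> u \<le> 1"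
  shows "\<exists>s\<in>borel_measurable M. \<forall>x\<in>space M. emeasure U (Pair x -` C) > 0 \<longrightarrow> (x, s x) \<in> C"
proof -
  interpret finite_measure U by fact
  define P where "P x q \<longleftrightarrow> emeasure U (Pair x -` C \<inter> {..q}) > 0" for x and q :: real
  have sm: "Pair x -` C \<inter> {..q} \<in> sets U" for x q using borel_section[OF C(1)] U by auto
  have Pmeas[measurable]: "Measurable.pred M (\<lambda>x. P x q)" for q
  proof -
    have "C \<inter> space M \<times> {..q} \<in> sets (M \<Otimes>\<^sub>M U)"
      using C(1) U by (auto cong: sets_pair_measure_cong)
    then have [measurable]: "(\<lambda>x. emeasure U (Pair x -` (C \<inter> space M \<times> {..q}))) \<in> borel_measurable M"
      by (rule measurable_emeasure_Pair)
    have "Measurable.pred M (\<lambda>x. emeasure U (Pair x -` (C \<inter> space M \<times> {..q})) > 0)" by measurable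
    then show ?thesis
      by (rule subst[rotated, where P="\<lambda>x. x"], intro measurable_cong)
         (auto simp: P_def intro!: arg_cong[where f="\<lambda>x. 0 < emeasure U x"])
  qed
  have Pmono: "P x q \<Longrightarrow> q \<le> q' \<Longrightarrow> P x q'" for x q q'
    unfolding P_def by (erule less_le_trans) (rule emeasure_mono, use sm in auto)
  have Plow: "P x q \<Longrightarrow> 0 \<le> q" for x q
  proof (rule ccontr)
    assume P: "P x q" and "\<not> 0 \<le> q"
    then have "Pair x -` C \<inter> {..q} = {}" using bd by force
    with P show False by (simp add: P_def)
  qed
  have P1: "emeasure U (Pair x -` C) > 0 \<Longrightarrow> P x 1" for x
  proof -
    have "Pair x -` C \<inter> {..1} = Pair x -` C" using bd by auto
    then show "emeasure U (Pair x -` C) > 0 \<Longrightarrow> P x 1" by (simp add: P_def)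
  qed
  define s where "s x = (if P x 1 then Inf {q. P x q} else 0)" for x
  have bb: "bdd_below {q. P x q}" for x using Plow by (auto intro!: bdd_belowI)
  have less: "s x < t \<longleftrightarrow> (\<exists>q\<in>\<rat>. q < t \<and> P x q)" if "P x 1" for x t
  proof
    assume "s x < t"
    then have "Inf {q. P x q} < t" using that by (simp add: s_def)
    moreover have "{q. P x q} \<noteq> {}" using that by blast
    ultimately obtain q where q: "P x q" "q < t" using cInf_less_iff[OF _ bb, of x t] by blast
    then obtain q' where "q' \<in> \<rat>" "q < q'" "q' < t" using Rats_dense_in_real by blast
    with q show "\<exists>q\<in>\<rat>. q < t \<and> P x q" using Pmono[of x q q'] by auto
  next
    assume "\<exists>q\<in>\<rat>. q < t \<and> P x q"
    then obtain q where "q < t" "P x q" by auto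
    moreover have "Inf {q. P x q} \<le> q" using \<open>P x q\<close> bb by (intro cInf_lower) auto
    ultimately show "s x < t" using that by (simp add: s_def)
  qed
  have "s \<in> borel_measurable M"
  proof (rule borel_measurableI_less)
    fix t
    have "{x\<in>space M. s x < t} = {x\<in>space M. if P x 1 then (\<exists>q\<in>\<rat>. q < t \<and> P x q) else 0 < t}"
      using less by (auto simp: s_def)
    also have "\<dots> \<in> sets M"
      using countable_rat by measurable
    finally show "{x\<in>space M. s x < t} \<in> sets M" .
  qed
  moreover have "(x, s x) \<in> C" if x: "x \<in> space M" "emeasure U (Pair x -` C) > 0" for x
  proof -
    note p1 = P1[OF x(2)]
    have "s x \<in> closure (Pair x -` C)"
      unfolding closure_approachable
    proof (intro allI impI)
      fix e :: real assume e: "e > 0"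
      have "s x < s x + e" using e by simp
      then obtain q where q: "q < s x + e" "P x q" using less[OF p1] by blast
      have nP: "\<not> P x (s x - e)"
      proof
        assume "P x (s x - e)"
        then have "Inf {q. P x q} \<le> s x - e" using bb by (intro cInf_lower) auto
        then show False using p1 e by (simp add: s_def)
      qed
      \<comment> \<open>The part of the section up to \<open>q\<close> has positive measure and the
        part up to \<open>s x - e\<close> has none, so a point lies in between.\<close>
      have "\<exists>u. u \<in> Pair x -` C \<inter> {..q} \<and> u > s x - e"
      proof (rule ccontr)
        assume "\<not> ?thesis"
        then have "Pair x -` C \<inter> {..q} \<subseteq> Pair x -` C \<inter> {..s x - e}" by force
        then have "emeasure U (Pair x -` C \<inter> {..q}) \<le> emeasure U (Pair x -` C \<inter> {..s x - e})"
          using sm by (rule emeasure_mono)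
        then show False using q nP unfolding P_def by (simp add: less_le_trans)
      qed
      then show "\<exists>y\<in>Pair x -` C. dist y (s x) < e"
        using q by (auto simp: dist_real_def abs_less_iff intro!: bexI)
    qed
    then show ?thesis using C(2)[OF x(1)] by (simp add: closure_closed)
  qed
  ultimately show ?thesis by auto
qed

text \<open>A measurable selection theorem in the spirit of Blackwell and Ryll-Nardzewski: sections of positive
  measure replace any topological assumption on the parameter space.\<close>
lemma positive_section_selection:
  fixes M :: "'x measure" and U :: "real measure"
  assumes U: "finite_measure U" "sets U = sets borel"
    and B: "B \<in> sets (M \<Otimes>\<^sub>M borel)"
    and bd: "\<And>x u. (x, u) \<in> B \<Longrightarrow> 0 \<le> u \<and> u \<le> 1"
  shows "\<exists>s\<in>borel_measurable M. \<forall>x\<in>space M. emeasure U (Pair x -` B) > 0 \<longrightarrow> (x, s x) \<in> B"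
proof -
  interpret finite_measure U by fact
  define Q where "Q n C s \<longleftrightarrow> C \<in> sets (M \<Otimes>\<^sub>M borel) \<and> C \<subseteq> B \<and>
     (\<forall>x\<in>space M. emeasure U (Pair x -` (B - C)) \<le> ennreal (1 / real (Suc n))) \<and>
     s \<in> borel_measurable M \<and> (\<forall>x\<in>space M. emeasure U (Pair x -` C) > 0 \<longrightarrow> (x, s x) \<in> C)"
    for n C and s :: "'x \<Rightarrow> real"
  have "\<exists>C s. Q n C s" for n
  proof -
    have "inner_closed M U B" by (rule inner_closed_sets[OF U B])
    then obtain C where C: "C \<in> sets (M \<Otimes>\<^sub>M borel)" "C \<subseteq> B"
      "\<And>x. x\<in>space M \<Longrightarrow> closed (Pair x -` C)"
      "\<And>x. x\<in>space M \<Longrightarrow> emeasure U (Pair x -` (B - C)) \<le> ennreal (1 / real (Suc n))"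
      unfolding inner_closed_def Bex_def by (auto dest!: spec[of _ "1 / real (Suc n)"])
    have "\<exists>s\<in>borel_measurable M. \<forall>x\<in>space M. emeasure U (Pair x -` C) > 0 \<longrightarrow> (x, s x) \<in> C"
      by (rule closed_selection[OF U C(1) C(3)]) (use C(2) bd in auto)
    with C show ?thesis unfolding Q_def by blast
  qed
  then obtain C s where CS: "\<And>n. Q n (C n) (s n)" by metis
  have Q1: "C n \<in> sets (M \<Otimes>\<^sub>M borel)" and Q2: "C n \<subseteq> B"
    and Q3: "x\<in>space M \<Longrightarrow> emeasure U (Pair x -` (B - C n)) \<le> ennreal (1 / real (Suc n))"
    and Q4: "s n \<in> borel_measurable M"
    and Q5: "x\<in>space M \<Longrightarrow> emeasure U (Pair x -` C n) > 0 \<Longrightarrow> (x, s n x) \<in> C n" for n x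
    using CS[of n] unfolding Q_def by auto
  have Cs: "Pair x -` C n \<in> sets U" for x n unfolding U(2) by (rule borel_section[OF Q1])
  have [measurable]: "(\<lambda>x. emeasure U (Pair x -` C n)) \<in> borel_measurable M" for n
    using measurable_emeasure_Pair[of "C n" M] Q1 U by (simp cong: sets_pair_measure_cong)
  note Q4[measurable]
  \<comment> \<open>\<open>C n\<close> misses at most \<open>1/(n+1)\<close> of a section of
    \<open>B\<close>, so a section of positive measure meets some \<open>C n\<close> in positive
    measure; the first such \<open>n\<close> is used.\<close>
  define N where "N x = (LEAST n. emeasure U (Pair x -` C n) > 0)" for x
  have [measurable]: "N \<in> measurable M (count_space UNIV)" unfolding N_def by measurable
  define t where "t x = s (N x) x" for x
  have "t \<in> borel_measurable M" unfolding t_def by measurable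
  moreover have "(x, t x) \<in> B" if x: "x \<in> space M" and pos: "emeasure U (Pair x -` B) > 0" for x
  proof -
    have "\<exists>n. emeasure U (Pair x -` C n) > 0"
    proof (rule ccontr)
      assume "\<not> ?thesis"
      then have z: "emeasure U (Pair x -` C n) = 0" for n by (simp add: zero_less_iff_neq_zero)
      have le: "emeasure U (Pair x -` B) \<le> ennreal (1 / real (Suc n))" for n
      proof -
        have "Pair x -` B = Pair x -` C n \<union> Pair x -` (B - C n)" using Q2 by blast
        moreover have "Pair x -` (B - C n) \<in> sets U" unfolding U(2) by (intro borel_section[of _ M] sets.Diff B Q1)
        ultimately have "emeasure U (Pair x -` B) \<le> emeasure U (Pair x -` C n) + emeasure U (Pair x -` (B - C n))"
          using Cs by (simp add: emeasure_subadditive)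
        also have "\<dots> \<le> ennreal (1 / real (Suc n))" using z Q3[OF x, of n] by simp
        finally show ?thesis .
      qed
      have "(\<lambda>n. ennreal (1 / real (Suc n))) \<longlonglongrightarrow> ennreal 0"
        by (intro tendsto_ennrealI LIMSEQ_Suc lim_1_over_n)
      then have "emeasure U (Pair x -` B) \<le> 0"
        using le by (intro LIMSEQ_le_const[where X="\<lambda>n. ennreal (1 / real (Suc n))"]) auto
      with pos show False by simp
    qed
    then have "emeasure U (Pair x -` C (N x)) > 0" unfolding N_def by (rule LeastI_ex)
    then show ?thesis using Q5[OF x, of "N x"] Q2 unfolding t_def by blast
  qed
  ultimately show ?thesis by auto
qed


section \<open>Measurable Caratheodory theorem\<close>

text \<open>The set \<open>D\<close> lies in the support of \<open>Y\<close> and meets every open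
  set of positive probability. Separation puts the mean into the closure \<open>C\<close> of the
  hull. A mean outside the hull would be on the relative boundary of \<open>C\<close>; then
  \<open>Y\<close> stays almost surely in a supporting hyperplane, hence so do \<open>D\<close> and
  \<open>C\<close>, against the strict inequality on the relative interior.\<close>

lemma (in prob_space) expectation_in_convex_hull:
  fixes Y :: "'a \<Rightarrow> 'e::euclidean_space"
  assumes Y: "integrable M Y"
    and meets: "\<And>U. open U \<Longrightarrow> emeasure M {\<omega>\<in>space M. Y \<omega> \<in> U} > 0 \<Longrightarrow> U \<inter> D \<noteq> {}"
    and supp: "\<And>d U. d \<in> D \<Longrightarrow> open U \<Longrightarrow> d \<in> U \<Longrightarrow> emeasure M {\<omega>\<in>space M. Y \<omega> \<in> U} > 0"
  shows "(LINT \<omega>|M. Y \<omega>) \<in> convex hull D"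
proof (rule ccontr)
  let ?m = "LINT \<omega>|M. Y \<omega>"
  assume notin: "?m \<notin> convex hull D"
  have [measurable]: "Y \<in> borel_measurable M" using Y by auto
  define C where "C = closure (convex hull D)"
  have C: "convex C" "closed C" "D \<subseteq> C"
    unfolding C_def by (simp_all add: convex_closure order_trans[OF hull_subset closure_subset])
  have intY: "integrable M (\<lambda>\<omega>. a \<bullet> Y \<omega>)" "(LINT \<omega>|M. a \<bullet> Y \<omega>) = a \<bullet> ?m" for a
    using Y by auto
  have YC: "AE \<omega> in M. Y \<omega> \<in> C"
  proof -
    have "\<not> emeasure M {\<omega>\<in>space M. Y \<omega> \<in> - C} > 0"
    proof
      assume "emeasure M {\<omega>\<in>space M. Y \<omega> \<in> - C} > 0"
      then have "- C \<inter> D \<noteq> {}" using C(2) by (intro meets) auto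
      with C(3) show False by blast
    qed
    then have "emeasure M {\<omega>\<in>space M. \<not> Y \<omega> \<in> C} = 0" by (simp add: zero_less_iff_neq_zero)
    moreover have "{\<omega>\<in>space M. \<not> Y \<omega> \<in> C} \<in> sets M" using borel_closed[OF C(2)] by measurable
    ultimately show ?thesis by (subst AE_iff_measurable[OF _ refl]) auto
  qed
  have mC: "?m \<in> C"
  proof (rule ccontr)
    assume "?m \<notin> C"
    then obtain a b where ab: "a \<bullet> ?m < b" "\<forall>y\<in>C. a \<bullet> y > b"
      using separating_hyperplane_closed_point[OF C(1,2)] by blast
    have "(LINT \<omega>|M. b) \<le> (LINT \<omega>|M. a \<bullet> Y \<omega>)"
      using YC ab(2) by (intro integral_mono_AE intY) (auto intro: less_imp_le)
    then show False using ab(1) intY by (simp add: prob_space)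
  qed
  \<comment> \<open>A convex set and its closure have the same relative interior, so missing the
    hull, although not its closure, is enough to obtain a supporting hyperplane.\<close>
  have ri: "rel_interior C = rel_interior (convex hull D)"
    unfolding C_def by (intro convex_rel_interior_closure convex_convex_hull)
  then have "?m \<notin> rel_interior C" using notin rel_interior_subset by blast
  then obtain a where a: "\<And>y. y \<in> C \<Longrightarrow> a \<bullet> ?m \<le> a \<bullet> y" "\<And>y. y \<in> rel_interior C \<Longrightarrow> a \<bullet> ?m < a \<bullet> y"
    using supporting_hyperplane_rel_boundary[OF C(1) mC] by metis
  have int0: "integrable M (\<lambda>\<omega>. a \<bullet> Y \<omega> - a \<bullet> ?m)" using intY by auto
  have nn: "AE \<omega> in M. 0 \<le> a \<bullet> Y \<omega> - a \<bullet> ?m" using YC a(1) by auto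
  have "(LINT \<omega>|M. a \<bullet> Y \<omega> - a \<bullet> ?m) = 0"
    using intY by (subst Bochner_Integration.integral_diff) (auto simp: prob_space)
  then have eq: "AE \<omega> in M. a \<bullet> Y \<omega> - a \<bullet> ?m = 0"
    using integral_nonneg_eq_0_iff_AE[OF int0 nn] by simp
  let ?U = "{y. a \<bullet> y \<noteq> a \<bullet> ?m}"
  have openU: "open ?U" by (intro open_Collect_neq continuous_intros)
  have "emeasure M {\<omega>\<in>space M. Y \<omega> \<in> ?U} = 0"
    using eq by (subst (asm) AE_iff_measurable[OF _ refl]) auto
  then have D: "D \<subseteq> {y. a \<bullet> y = a \<bullet> ?m}" using supp[OF _ openU] by auto
  have "convex hull D \<subseteq> {y. a \<bullet> y = a \<bullet> ?m}"
    by (rule hull_minimal[where S=convex, OF D convex_hyperplane])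
  then have "C \<subseteq> {y. a \<bullet> y = a \<bullet> ?m}"
    unfolding C_def by (rule closure_minimal[OF _ closed_hyperplane])
  moreover have "rel_interior C \<noteq> {}" using mC C(1) rel_interior_eq_empty by blast
  ultimately show False using a(2) rel_interior_subset by fastforce
qed

text \<open>The quantifier over an uncountable \<open>K\<close> is reduced to a countable dense
  subset with tolerance \<open>1/(n+1)\<close>: continuity gives one direction, the attained minimum
  the other.\<close>

lemma measurable_compact_exists:
  fixes K :: "'b::euclidean_space set" and F :: "'x \<Rightarrow> 'b \<Rightarrow> real"
  assumes K: "compact K" and cont: "\<And>x. x \<in> space M \<Longrightarrow> continuous_on K (F x)"
    and meas[measurable]: "\<And>b. b \<in> K \<Longrightarrow> (\<lambda>x. F x b) \<in> borel_measurable M"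
  shows "{x\<in>space M. \<exists>b\<in>K. F x b \<le> 0} \<in> sets M"
proof -
  obtain D where D: "countable D" "D \<subseteq> K" "K \<subseteq> closure D"
    using separable[of K] by metis
  have "{x\<in>space M. \<exists>b\<in>K. F x b \<le> 0} = {x\<in>space M. \<forall>n::nat. \<exists>b\<in>D. F x b < 1 / real (Suc n)}"
  proof (intro Collect_cong conj_cong refl iffI allI; (elim bexE)?)
    fix x b and n :: nat assume x: "x \<in> space M" and b: "b \<in> K" "F x b \<le> 0"
    have "0 < 1 / real (Suc n)" by simp
    then obtain d where d: "d > 0" "\<And>b'. b' \<in> K \<Longrightarrow> dist b' b < d \<Longrightarrow> dist (F x b') (F x b) < 1 / real (Suc n)"
      using cont[OF x] b(1) unfolding continuous_on_iff by blast
    obtain b' where b': "b' \<in> D" "dist b' b < d"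
      using D(3) b(1) d(1) closure_approachable[of b D] by auto
    then have "dist (F x b') (F x b) < 1 / real (Suc n)" using d(2) D(2) by auto
    then have "F x b' < 1 / real (Suc n)" using b(2) by (auto simp: dist_real_def)
    then show "\<exists>b\<in>D. F x b < 1 / real (Suc n)" using b'(1) by auto
  next
    fix x assume x: "x \<in> space M" and all: "\<forall>n::nat. \<exists>b\<in>D. F x b < 1 / real (Suc n)"
    then have "K \<noteq> {}" using D by blast
    from continuous_attains_inf[OF K this cont[OF x]]
    obtain b where b: "b \<in> K" "\<And>y. y \<in> K \<Longrightarrow> F x b \<le> F x y" by blast
    have "F x b \<le> 0"
    proof (rule ccontr)
      assume "\<not> F x b \<le> 0"
      then obtain n where "1 / real (Suc n) < F x b" using nat_approx_posE[of "F x b"] by auto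
      moreover obtain b' where "b' \<in> D" "F x b' < 1 / real (Suc n)" using all by blast
      ultimately show False using b(2)[of b'] D(2) by auto
    qed
    with b(1) show "\<exists>b\<in>K. F x b \<le> 0" by auto
  qed
  also have "\<dots> \<in> sets M"
  proof -
    have "{x\<in>space M. \<exists>b\<in>D. F x b < 1 / real (Suc n)} \<in> sets M" for n
    proof -
      have "{x\<in>space M. F x b < 1 / real (Suc n)} \<in> sets M" if "b \<in> D" for b
      proof -
        have [measurable]: "(\<lambda>x. F x b) \<in> borel_measurable M" using that D(2) by (intro meas) auto
        show ?thesis by measurable
      qed
      then have "(\<Union>b\<in>D. {x\<in>space M. F x b < 1 / real (Suc n)}) \<in> sets M"
        by (intro sets.countable_UN' D(1)) auto
      also have "(\<Union>b\<in>D. {x\<in>space M. F x b < 1 / real (Suc n)}) = {x\<in>space M. \<exists>b\<in>D. F x b < 1 / real (Suc n)}"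
        by auto
      finally show ?thesis .
    qed
    then show ?thesis by (intro sets.sets_Collect_countable_All) auto
  qed
  finally show ?thesis .
qed

section \<open>Convex combinations with measurable weights\<close>

definition prob_simplex :: "(real ^ 'k::finite) set" where
  "prob_simplex = {b. (\<forall>k. 0 \<le> b $ k) \<and> (\<Sum>k\<in>UNIV. b $ k) = 1}"

lemma compact_prob_simplex: "compact (prob_simplex :: (real ^ 'k::finite) set)"
proof -
  have "(prob_simplex :: (real ^ 'k) set) \<subseteq> cbox 0 (\<chi> i. 1)"
  proof
    fix b :: "real ^ 'k" assume b: "b \<in> prob_simplex"
    then have "b $ k \<le> (\<Sum>k\<in>UNIV. b $ k)" for k
      by (intro member_le_sum) (auto simp: prob_simplex_def)
    with b show "b \<in> cbox 0 (\<chi> i. 1)" by (auto simp: prob_simplex_def mem_box_cart)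
  qed
  then have "bounded (prob_simplex :: (real ^ 'k) set)" by (rule bounded_subset[rotated]) simp
  moreover have "closed (prob_simplex :: (real ^ 'k) set)"
    unfolding prob_simplex_def
    by (intro closed_Collect_conj closed_Collect_all closed_Collect_le closed_Collect_eq continuous_intros)
  ultimately show ?thesis by (simp add: compact_eq_bounded_closed)
qed

lemma convex_prob_simplex: "convex (prob_simplex :: (real ^ 'k::finite) set)"
  unfolding prob_simplex_def convex_def
  by (auto simp: sum.distrib sum_distrib_left[symmetric])

text \<open>Indexing by a finite type allows repeated points, so membership is always tested with
  weight vectors of the same length, ranging over one compact set.\<close>

lemma convex_hull_range_iff:
  fixes v :: "'k::finite \<Rightarrow> 'e::real_vector"
  shows "h \<in> convex hull (range v) \<longleftrightarrow> (\<exists>b\<in>prob_simplex. (\<Sum>k\<in>UNIV. b $ k *\<^sub>R v k) = h)"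
proof
  assume "h \<in> convex hull (range v)"
  moreover have "convex hull (range v) \<subseteq> (\<lambda>b. \<Sum>k\<in>UNIV. b $ k *\<^sub>R v k) ` prob_simplex"
  proof (rule hull_minimal)
    have "linear (\<lambda>b. \<Sum>k\<in>UNIV. b $ k *\<^sub>R v k)"
      by (intro linearI) (simp_all add: scaleR_add_left sum.distrib scaleR_sum_right)
    then show "convex ((\<lambda>b. \<Sum>k\<in>UNIV. b $ k *\<^sub>R v k) ` prob_simplex)"
      by (rule convex_linear_image[OF _ convex_prob_simplex])
    show "range v \<subseteq> (\<lambda>b. \<Sum>k\<in>UNIV. b $ k *\<^sub>R v k) ` prob_simplex"
    proof clarify
      fix k
      have "v k = (\<Sum>i\<in>UNIV. (\<chi> i. if i = k then 1 else 0) $ i *\<^sub>R v i)"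
        by (simp add: if_distrib[where f="\<lambda>c. c *\<^sub>R _"] cong: if_cong)
      moreover have "(\<chi> i. if i = k then 1 else 0) \<in> prob_simplex" by (simp add: prob_simplex_def)
      ultimately show "v k \<in> (\<lambda>b. \<Sum>k\<in>UNIV. b $ k *\<^sub>R v k) ` prob_simplex" by (rule image_eqI)
    qed
  qed
  ultimately show "\<exists>b\<in>prob_simplex. (\<Sum>k\<in>UNIV. b $ k *\<^sub>R v k) = h" by auto
next
  assume "\<exists>b\<in>prob_simplex. (\<Sum>k\<in>UNIV. b $ k *\<^sub>R v k) = h"
  then obtain b where b: "b \<in> prob_simplex" "(\<Sum>k\<in>UNIV. b $ k *\<^sub>R v k) = h" by auto
  then have "(\<Sum>k\<in>UNIV. b $ k *\<^sub>R v k) \<in> convex hull (range v)"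
    by (intro convex_sum) (auto simp: prob_simplex_def intro: hull_inc)
  with b(2) show "h \<in> convex hull (range v)" by simp
qed

lemma sets_in_convex_hull_range:
  fixes v :: "'k::finite \<Rightarrow> 'x \<Rightarrow> 'e::euclidean_space"
  assumes [measurable]: "\<And>k. v k \<in> borel_measurable M" "h \<in> borel_measurable M"
  shows "{x\<in>space M. h x \<in> convex hull (range (\<lambda>k. v k x))} \<in> sets M"
proof -
  have "{x\<in>space M. \<exists>b\<in>prob_simplex. norm ((\<Sum>k\<in>UNIV. b $ k *\<^sub>R v k x) - h x) \<le> 0} \<in> sets M"
    by (rule measurable_compact_exists[OF compact_prob_simplex]) (auto intro!: continuous_intros)
  then show ?thesis by (simp add: convex_hull_range_iff)
qed

text \<open>Among all admissible weights the ones of minimal norm are chosen: they are unique, which makes them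
  depend measurably on the parameter.\<close>
lemma measurable_barycentric_weights:
  fixes v :: "'k::finite \<Rightarrow> 'x \<Rightarrow> 'e::euclidean_space"
  assumes v[measurable]: "\<And>k. v k \<in> borel_measurable M" "h \<in> borel_measurable M"
    and hull: "\<And>x. x \<in> space M \<Longrightarrow> h x \<in> convex hull (range (\<lambda>k. v k x))"
  shows "\<exists>b. (\<forall>k. (\<lambda>x. b x $ k) \<in> borel_measurable M) \<and>
    (\<forall>x\<in>space M. b x \<in> prob_simplex \<and> (\<Sum>k\<in>UNIV. b x $ k *\<^sub>R v k x) = h x)"
proof -
  let ?K = "prob_simplex :: (real ^ 'k) set"
  define f where "f x b = norm ((\<Sum>k\<in>UNIV. b $ k *\<^sub>R v k x) - h x)" for x and b :: "real ^ 'k"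
  define S where "S x = {b\<in>?K. f x b \<le> 0}" for x
  have contf: "continuous_on ?K (f x)" for x unfolding f_def by (intro continuous_intros)
  have [measurable]: "(\<lambda>x. f x b) \<in> borel_measurable M" for b unfolding f_def by measurable
  have S_alt: "S x = ?K \<inter> {b. (\<Sum>k\<in>UNIV. b $ k *\<^sub>R v k x) = h x}" for x
    by (auto simp: S_def f_def)
  have S: "closed (S x)" "convex (S x)" for x
  proof -
    show "closed (S x)" unfolding S_alt
      by (intro closed_Int compact_imp_closed compact_prob_simplex closed_Collect_eq continuous_intros)
    have "convex {b. (\<Sum>k\<in>UNIV. b $ k *\<^sub>R v k x) = h x}"
    proof (rule convexI, clarsimp)
      fix b c :: "real ^ 'k" and s t :: real
      assume "(\<Sum>k\<in>UNIV. b $ k *\<^sub>R v k x) = h x" "(\<Sum>k\<in>UNIV. c $ k *\<^sub>R v k x) = h x" "s + t = 1"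
      moreover have "(\<Sum>k\<in>UNIV. (s * b $ k + t * c $ k) *\<^sub>R v k x)
         = s *\<^sub>R (\<Sum>k\<in>UNIV. b $ k *\<^sub>R v k x) + t *\<^sub>R (\<Sum>k\<in>UNIV. c $ k *\<^sub>R v k x)"
        by (simp add: scaleR_add_left sum.distrib scaleR_sum_right)
      ultimately show "(\<Sum>k\<in>UNIV. (s * b $ k + t * c $ k) *\<^sub>R v k x) = h x"
        by (simp add: scaleR_add_left[symmetric])
    qed
    then show "convex (S x)" unfolding S_alt by (intro convex_Int convex_prob_simplex)
  qed
  have ne: "S x \<noteq> {}" if "x \<in> space M" for x
    using hull[OF that] unfolding S_alt convex_hull_range_iff by auto
  define b where "b x = closest_point (S x) 0" for x
  have bS: "b x \<in> S x" if "x \<in> space M" for x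
    unfolding b_def using S(1) ne[OF that] by (rule closest_point_in_set)
  have bmin: "norm (b x) \<le> norm c" if "c \<in> S x" for x c
    using closest_point_le[OF S(1) that, of 0] by (simp add: b_def)
  have buniq: "c = b x" if "c \<in> S x" "norm c \<le> norm (b x)" for x c
    unfolding b_def using that bmin by (intro closest_point_unique S) (auto intro: order_trans)
  have m[measurable]: "(\<lambda>x. norm (b x)) \<in> borel_measurable M"
  proof (rule borel_measurableI_le)
    fix c
    have "{x\<in>space M. norm (b x) \<le> c} = {x\<in>space M. \<exists>d\<in>?K. max (f x d) (norm d - c) \<le> 0}"
      using bS bmin unfolding S_def by (fastforce intro: order_trans)
    also have "\<dots> \<in> sets M"
      by (rule measurable_compact_exists[OF compact_prob_simplex]) (auto intro!: continuous_intros contf)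
    finally show "{x\<in>space M. norm (b x) \<le> c} \<in> sets M" .
  qed
  have "(\<lambda>x. b x $ k) \<in> borel_measurable M" for k
  proof (rule borel_measurableI_le)
    fix c
    \<comment> \<open>A solution whose norm does not exceed the minimal norm is \<open>b x\<close>
      itself, so a bound on one coordinate of \<open>b x\<close> becomes an existence statement over
      the simplex. It involves \<open>norm (b x)\<close>, whose measurability was therefore settled
      beforehand.\<close>
    have "{x\<in>space M. b x $ k \<le> c} = {x\<in>space M. \<exists>d\<in>?K. max (f x d) (max (norm d - norm (b x)) (d $ k - c)) \<le> 0}"
    proof (intro Collect_cong conj_cong refl)
      fix x assume x: "x \<in> space M"
      show "b x $ k \<le> c \<longleftrightarrow> (\<exists>d\<in>?K. max (f x d) (max (norm d - norm (b x)) (d $ k - c)) \<le> 0)"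
      proof
        assume "b x $ k \<le> c"
        then show "\<exists>d\<in>?K. max (f x d) (max (norm d - norm (b x)) (d $ k - c)) \<le> 0"
          using bS[OF x] unfolding S_def by (intro bexI[of _ "b x"]) auto
      next
        assume "\<exists>d\<in>?K. max (f x d) (max (norm d - norm (b x)) (d $ k - c)) \<le> 0"
        then obtain d where "d \<in> S x" "norm d \<le> norm (b x)" "d $ k \<le> c" unfolding S_def by auto
        with buniq show "b x $ k \<le> c" by metis
      qed
    qed
    also have "\<dots> \<in> sets M"
      by (rule measurable_compact_exists[OF compact_prob_simplex]) (auto intro!: continuous_intros contf)
    finally show "{x\<in>space M. b x $ k \<le> c} \<in> sets M" .
  qed
  with bS show ?thesis unfolding S_alt by blast
qed

text \<open>The type \<open>'d option\<close> has \<open>d + 1\<close> elements, and there are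
  countably many index families from it into \<open>nat\<close>. Caratheodory's theorem provides a
  suitable one at each \<open>x\<close>; taking the first in the enumeration \<open>s\<close> is a
  measurable choice because hull membership is a measurable condition.\<close>

lemma measurable_caratheodory:
  fixes y :: "nat \<Rightarrow> 'x \<Rightarrow> real ^ 'd"
  assumes y[measurable]: "\<And>i. y i \<in> borel_measurable M" "h \<in> borel_measurable M"
    and hull: "\<And>x. x \<in> space M \<Longrightarrow> h x \<in> convex hull (range (\<lambda>i. y i x))"
  shows "\<exists>\<beta> j. (\<forall>i. \<beta> i \<in> borel_measurable M \<and> j i \<in> measurable M (count_space UNIV)) \<and>
    (\<forall>x\<in>space M. (\<forall>i. 0 \<le> \<beta> i x) \<and> (\<Sum>i<CARD('d)+1. \<beta> i x) = 1 \<and>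
      (\<Sum>i<CARD('d)+1. \<beta> i x *\<^sub>R y (j i x) x) = h x)"
proof -
  define s :: "nat \<Rightarrow> 'd option \<Rightarrow> nat" where "s n = from_nat n" for n
  let ?P = "\<lambda>n x. h x \<in> convex hull (range (\<lambda>k. y (s n k) x))"
  have [measurable]: "Measurable.pred M (?P n)" for n
    unfolding pred_def by (rule sets_in_convex_hull_range) measurable
  have ex: "\<exists>n. ?P n x" if x: "x \<in> space M" for x
  proof -
    obtain S where S: "finite S" "S \<subseteq> range (\<lambda>i. y i x)" "card S \<le> DIM(real^'d) + 1" "h x \<in> convex hull S"
      using hull[OF x] unfolding caratheodory[of "range (\<lambda>i. y i x)"] by auto
    then have "S \<noteq> {}" by auto
    have "card S \<le> card (UNIV :: 'd option set)" using S(3) by simp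
    then obtain e :: "_ \<Rightarrow> 'd option" where e: "inj_on e S"
      using card_le_inj[OF S(1) finite_class.finite_UNIV[where 'a="'d option"]] by blast
    have "\<forall>z\<in>S. \<exists>i. z = y i x" using S(2) by auto
    then obtain g where g: "\<And>z. z \<in> S \<Longrightarrow> z = y (g z) x" by metis
    obtain z0 where z0: "z0 \<in> S" using \<open>S \<noteq> {}\<close> by auto
    \<comment> \<open>Slots beyond the size of the Caratheodory set are filled with a repeated
      point.\<close>
    define t where "t k = (if k \<in> e ` S then g (the_inv_into S e k) else g z0)" for k
    have "S \<subseteq> range (\<lambda>k. y (t k) x)"
    proof
      fix z assume z: "z \<in> S"
      then have "y (t (e z)) x = z" using g[OF z] by (simp add: t_def the_inv_into_f_f[OF e])
      then show "z \<in> range (\<lambda>k. y (t k) x)" by (metis rangeI)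
    qed
    then have "h x \<in> convex hull (range (\<lambda>k. y (t k) x))" using S(4) hull_mono by blast
    then show ?thesis by (intro exI[of _ "to_nat t"]) (simp add: s_def)
  qed
  define N where "N x = (LEAST n. ?P n x)" for x
  have N[measurable]: "N \<in> measurable M (count_space UNIV)" unfolding N_def by measurable
  have PN: "?P (N x) x" if "x \<in> space M" for x
    unfolding N_def using ex[OF that] by (rule LeastI_ex)
  define v where "v k x = y (s (N x) k) x" for k x
  have [measurable]: "v k \<in> borel_measurable M" for k
    unfolding v_def by measurable
  obtain b where b: "\<And>k. (\<lambda>x. b x $ k) \<in> borel_measurable M"
    "\<And>x. x \<in> space M \<Longrightarrow> b x \<in> prob_simplex" "\<And>x. x \<in> space M \<Longrightarrow> (\<Sum>k\<in>UNIV. b x $ k *\<^sub>R v k x) = h x"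
    using measurable_barycentric_weights[of v M h] PN unfolding v_def[symmetric] by (auto simp: v_def)
  obtain e :: "nat \<Rightarrow> 'd option" where e: "bij_betw e {..<CARD('d)+1} UNIV"
    using ex_bij_betw_nat_finite[of "UNIV :: 'd option set"] by (auto simp: atLeast0LessThan)
  have re: "(\<Sum>i<CARD('d)+1. g (e i)) = (\<Sum>k\<in>UNIV. g k)" for g :: "'d option \<Rightarrow> 'z::comm_monoid_add"
    using sum.reindex_bij_betw[OF e, of g] .
  show ?thesis
  proof (intro exI[of _ "\<lambda>i x. if x \<in> space M then b x $ e i else 0"] exI[of _ "\<lambda>i x. s (N x) (e i)"] conjI allI ballI)
    show "(\<lambda>x. if x \<in> space M then b x $ e i else 0) \<in> borel_measurable M" for i
      using b(1)[of "e i"] by (subst measurable_cong[of M _ "\<lambda>x. b x $ e i"]) auto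
    show "(\<lambda>x. s (N x) (e i)) \<in> measurable M (count_space UNIV)" for i by measurable
    fix x assume x: "x \<in> space M"
    note simplex = b(2)[OF x, unfolded prob_simplex_def mem_Collect_eq]
    show "0 \<le> (if x \<in> space M then b x $ e i else 0)" for i using simplex by auto
    show "(\<Sum>i<CARD('d)+1. (if x \<in> space M then b x $ e i else 0)) = 1"
      using re[of "\<lambda>k. b x $ k"] simplex x by simp
    show "(\<Sum>i<CARD('d)+1. (if x \<in> space M then b x $ e i else 0) *\<^sub>R y (s (N x) (e i)) x) = h x"
      using re[of "\<lambda>k. b x $ k *\<^sub>R v k x"] b(3)[OF x] x by (simp add: v_def)
  qed
qed

text \<open>For each basic open set \<open>V k\<close> hit by \<open>G (x, u)\<close> with positive
  probability, a noise value is selected whose \<open>G\<close>-value lies in \<open>V k\<close> and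
  in the support of the law of \<open>G (x, u)\<close>. The countable set of these values satisfies
  both conditions of \<open>expectation_in_convex_hull\<close>. The set \<open>E\<close> carries an
  almost sure side condition through the selection.\<close>

lemma measurable_caratheodory_selection:
  fixes G :: "'x \<times> real \<Rightarrow> real ^ 'd"
  assumes G[measurable]: "G \<in> borel_measurable (MX \<Otimes>\<^sub>M borel)" and h[measurable]: "h \<in> borel_measurable MX"
    and E[measurable]: "E \<in> sets (MX \<Otimes>\<^sub>M borel)" and X0[measurable]: "X0 \<in> sets MX"
    and AE_E: "\<And>x. x \<in> X0 \<Longrightarrow> AE u in unif01. (x, u) \<in> E"
    and int: "\<And>x. x \<in> X0 \<Longrightarrow> integrable unif01 (\<lambda>u. G (x, u))"
    and mean: "\<And>x. x \<in> X0 \<Longrightarrow> (LINT u|unif01. G (x, u)) = h x"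
  shows "\<exists>\<beta> s. (\<forall>i. \<beta> i \<in> borel_measurable MX \<and> s i \<in> borel_measurable MX) \<and>
    (\<forall>x\<in>space MX. (\<forall>i. 0 \<le> \<beta> i x) \<and> (\<Sum>i<CARD('d)+1. \<beta> i x) = 1) \<and>
    (\<forall>x\<in>X0. (\<forall>i. (x, s i x) \<in> E) \<and> (\<Sum>i<CARD('d)+1. \<beta> i x *\<^sub>R G (x, s i x)) = h x)"
proof -
  interpret U: prob_space unif01 by (rule prob_space_unif01)
  obtain \<B> :: "(real ^ 'd) set set" where \<B>: "countable \<B>" "topological_basis \<B>"
    using ex_countable_basis by blast
  have "\<B> \<noteq> {}" using \<B>(2) topological_basisE[of \<B> UNIV 0] by auto
  define V where "V = from_nat_into \<B>"
  have V_range: "range V = \<B>" unfolding V_def by (rule range_from_nat_into[OF \<open>\<B> \<noteq> {}\<close> \<B>(1)])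
  have V_open: "open (V k)" for k using V_range topological_basis_open[OF \<B>(2)] by blast
  have V_ex: "\<exists>k. y \<in> V k \<and> V k \<subseteq> W" if "open W" "y \<in> W" for y W
    using topological_basisE[OF \<B>(2) that] V_range by (metis rangeE)
  have [measurable]: "V k \<in> sets borel" for k using V_open by auto
  \<comment> \<open>The restriction to the unit interval, which has full measure, supplies the
    bounds required by the selection theorem.\<close>
  define R where "R = {(x, u). (x, u) \<in> E \<and> x \<in> X0 \<and> 0 \<le> u \<and> u \<le> 1}"
  have R_alt: "R = E \<inter> (X0 \<times> {0..1})" by (auto simp: R_def)
  have R[measurable]: "R \<in> sets (MX \<Otimes>\<^sub>M borel)" unfolding R_alt by measurable
  define B where "B k = {z\<in>R. G z \<in> V k}" for k
  have B[measurable]: "B k \<in> sets (MX \<Otimes>\<^sub>M borel)" for k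
  proof -
    have "B k = R \<inter> {z\<in>space (MX \<Otimes>\<^sub>M borel). G z \<in> V k}"
      using sets.sets_into_space[OF R] by (auto simp: B_def)
    also have "\<dots> \<in> sets (MX \<Otimes>\<^sub>M borel)" by measurable
    finally show ?thesis .
  qed
  define pos where "pos k x \<longleftrightarrow> emeasure unif01 (Pair x -` B k) > 0" for k x
  have pos[measurable]: "Measurable.pred MX (pos k)" for k
  proof -
    have "(\<lambda>x. emeasure unif01 (Pair x -` B k)) \<in> borel_measurable MX"
      by (rule U.measurable_emeasure_Pair) (use B in \<open>simp cong: sets_pair_measure_cong\<close>)
    then show ?thesis unfolding pos_def by measurable
  qed
  \<comment> \<open>These are the points whose \<open>G\<close>-value lies in the support of its
    law: every basic neighbourhood of it has positive probability. For \<open>x\<close> in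
    \<open>X0\<close> the exceptional noise values form a countable union of null sets.\<close>
  define Z where "Z = {z\<in>R. \<forall>j. G z \<in> V j \<longrightarrow> pos j (fst z)}"
  have Z[measurable]: "Z \<in> sets (MX \<Otimes>\<^sub>M borel)"
  proof -
    have "Z = R \<inter> {z\<in>space (MX \<Otimes>\<^sub>M borel). \<forall>j. G z \<in> V j \<longrightarrow> pos j (fst z)}"
      using sets.sets_into_space[OF R] by (auto simp: Z_def)
    also have "\<dots> \<in> sets (MX \<Otimes>\<^sub>M borel)" by measurable
    finally show ?thesis .
  qed
  have sec[measurable]: "Pair x -` C \<in> sets borel" if "C \<in> sets (MX \<Otimes>\<^sub>M borel)" for x and C :: "('x \<times> real) set"
    using that by (rule sets_Pair1)
  have X0_space: "x \<in> space MX" if "x \<in> X0" for x using sets.sets_into_space[OF X0] that by auto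
  have AE01: "AE u in unif01. 0 \<le> u \<and> u \<le> 1"
    by (rule AE_uniform_measureI) auto
  have AE_R: "AE u in unif01. (x, u) \<in> R" if "x \<in> X0" for x
    using AE_E[OF that] AE01 that by (auto simp: R_def)
  have AE_Z: "AE u in unif01. (x, u) \<in> Z" if x: "x \<in> X0" for x
  proof -
    have "AE u in unif01. \<forall>j. G (x, u) \<in> V j \<longrightarrow> pos j x"
      unfolding AE_all_countable
    proof
      fix j
      show "AE u in unif01. G (x, u) \<in> V j \<longrightarrow> pos j x"
      proof (cases "pos j x")
        case False
        then have "emeasure unif01 (Pair x -` B j) = 0" by (simp add: pos_def zero_less_iff_neq_zero)
        then have "AE u in unif01. u \<notin> Pair x -` B j" using sec[OF B]
          by (intro AE_not_in) (auto simp: null_sets_def)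
        with AE_R[OF x] show ?thesis by eventually_elim (auto simp: B_def)
      qed auto
    qed
    with AE_R[OF x] show ?thesis by eventually_elim (auto simp: Z_def)
  qed
  have pos_iff: "emeasure unif01 {u\<in>space unif01. G (x, u) \<in> V k} = emeasure unif01 (Pair x -` B k)" if x: "x \<in> X0" for x k
  proof (rule emeasure_eq_AE)
    have [measurable]: "(\<lambda>u. G (x, u)) \<in> borel_measurable borel"
      using measurable_compose[OF measurable_Pair1'[OF X0_space[OF x]] G] .
    show "AE u in unif01. u \<in> {u\<in>space unif01. G (x, u) \<in> V k} \<longleftrightarrow> u \<in> Pair x -` B k"
      using AE_R[OF x] by eventually_elim (auto simp: B_def)
    show "{u\<in>space unif01. G (x, u) \<in> V k} \<in> sets unif01" by measurable
    show "Pair x -` B k \<in> sets unif01" using sec[OF B] by simp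
  qed
  have posZ: "emeasure unif01 (Pair x -` (B k \<inter> Z)) = emeasure unif01 (Pair x -` B k)" if x: "x \<in> X0" for x k
  proof (rule emeasure_eq_AE)
    show "AE u in unif01. u \<in> Pair x -` (B k \<inter> Z) \<longleftrightarrow> u \<in> Pair x -` B k"
      using AE_Z[OF x] by eventually_elim auto
  qed (use sec[OF sets.Int[OF B Z]] sec[OF B] in auto)
  have fU: "finite_measure unif01" by (rule U.finite_measure_axioms)
  have "\<exists>s\<in>borel_measurable MX. \<forall>x\<in>space MX. emeasure unif01 (Pair x -` (B k \<inter> Z)) > 0 \<longrightarrow> (x, s x) \<in> B k \<inter> Z" for k
    by (rule positive_section_selection[OF fU _ sets.Int[OF B Z]]) (auto simp: B_def R_def)
  then obtain sB where sB[measurable]: "\<And>k. sB k \<in> borel_measurable MX"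
    and sB': "\<And>k x. x \<in> space MX \<Longrightarrow> emeasure unif01 (Pair x -` (B k \<inter> Z)) > 0 \<Longrightarrow> (x, sB k x) \<in> B k \<inter> Z"
    by metis
  have "\<exists>s\<in>borel_measurable MX. \<forall>x\<in>space MX. emeasure unif01 (Pair x -` Z) > 0 \<longrightarrow> (x, s x) \<in> Z"
    by (rule positive_section_selection[OF fU _ Z]) (auto simp: Z_def R_def)
  then obtain sZ where sZ[measurable]: "sZ \<in> borel_measurable MX"
    and sZ': "\<And>x. x \<in> space MX \<Longrightarrow> emeasure unif01 (Pair x -` Z) > 0 \<Longrightarrow> (x, sZ x) \<in> Z"
    by metis
  \<comment> \<open>If \<open>V k\<close> has probability zero, a point selected from
    \<open>Z\<close> stands in, so that all values stay in the support.\<close>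
  define v where "v k x = (if pos k x then sB k x else sZ x)" for k x
  have [measurable]: "v k \<in> borel_measurable MX" for k unfolding v_def by measurable
  have vZ: "(x, v k x) \<in> Z" and vB: "pos k x \<Longrightarrow> (x, v k x) \<in> B k" if x: "x \<in> X0" for k x
  proof -
    have "emeasure unif01 (Pair x -` Z) = emeasure unif01 (space unif01)"
      by (rule emeasure_eq_AE) (use AE_Z[OF x] sec[OF Z] in auto)
    then have "(x, sZ x) \<in> Z" using sZ'[OF X0_space[OF x]] U.emeasure_space_1 by simp
    moreover have "pos k x \<Longrightarrow> (x, sB k x) \<in> B k \<inter> Z"
      using sB'[OF X0_space[OF x]] posZ[OF x] by (simp add: pos_def)
    ultimately show "(x, v k x) \<in> Z" "pos k x \<Longrightarrow> (x, v k x) \<in> B k" by (auto simp: v_def)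
  qed
  \<comment> \<open>Setting everything to 0 off \<open>X0\<close> makes the hull condition hold on
    the whole space, as \<open>measurable_caratheodory\<close> demands.\<close>
  define y where "y k x = (if x \<in> X0 then G (x, v k x) else 0)" for k x
  define h' where "h' x = (if x \<in> X0 then h x else 0)" for x
  have [measurable]: "y k \<in> borel_measurable MX" "h' \<in> borel_measurable MX" for k
    unfolding y_def h'_def by measurable
  have hull: "h' x \<in> convex hull (range (\<lambda>k. y k x))" if "x \<in> space MX" for x
  proof (cases "x \<in> X0")
    case False
    then show ?thesis by (auto simp: h'_def y_def intro!: hull_inc)
  next
    case x: True
    have Gx[measurable]: "(\<lambda>u. G (x, u)) \<in> borel_measurable borel"
      using measurable_compose[OF measurable_Pair1'[OF X0_space[OF x]] G] .
    have "(LINT u|unif01. G (x, u)) \<in> convex hull (range (\<lambda>k. G (x, v k x)))"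
    proof (rule U.expectation_in_convex_hull[OF int[OF x]])
      fix W :: "(real ^ 'd) set" assume W: "open W" and "emeasure unif01 {u\<in>space unif01. G (x, u) \<in> W} > 0"
      have "\<exists>j. V j \<subseteq> W \<and> pos j x"
      proof (rule ccontr)
        assume no: "\<not> ?thesis"
        have "AE u in unif01. \<forall>j. V j \<subseteq> W \<longrightarrow> G (x, u) \<notin> V j"
          unfolding AE_all_countable
        proof
          fix j show "AE u in unif01. V j \<subseteq> W \<longrightarrow> G (x, u) \<notin> V j"
          proof (cases "V j \<subseteq> W")
            case True
            then have "emeasure unif01 {u\<in>space unif01. G (x, u) \<in> V j} = 0"
              using no pos_iff[OF x] by (auto simp: pos_def zero_less_iff_neq_zero)
            moreover have "{u\<in>space unif01. G (x, u) \<in> V j} \<in> sets unif01" by measurable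
            ultimately have "AE u in unif01. G (x, u) \<notin> V j"
              by (subst AE_iff_measurable[where N="{u\<in>space unif01. G (x, u) \<in> V j}"]) auto
            then show ?thesis by auto
          qed auto
        qed
        then have "AE u in unif01. G (x, u) \<notin> W"
          by eventually_elim (use V_ex[OF W] in blast)
        then have "emeasure unif01 {u\<in>space unif01. G (x, u) \<in> W} = 0"
          by (rule emeasure_eq_0_AE)
        with \<open>_ > 0\<close> show False by simp
      qed
      then obtain j where "V j \<subseteq> W" "pos j x" by auto
      with vB[OF x, of j] show "W \<inter> range (\<lambda>k. G (x, v k x)) \<noteq> {}" by (auto simp: B_def)
    next
      fix d W assume "d \<in> range (\<lambda>k. G (x, v k x))" and W: "open W" "d \<in> W"
      then obtain k where d: "d = G (x, v k x)" by auto
      obtain j where j: "d \<in> V j" "V j \<subseteq> W" using V_ex[OF W] by auto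
      then have "pos j x" using vZ[OF x, of k] by (auto simp: Z_def d)
      then have "0 < emeasure unif01 {u\<in>space unif01. G (x, u) \<in> V j}" using pos_iff[OF x] by (simp add: pos_def)
      also have "\<dots> \<le> emeasure unif01 {u\<in>space unif01. G (x, u) \<in> W}"
      proof (rule emeasure_mono)
        have [measurable]: "W \<in> sets borel" using W(1) by auto
        show "{u\<in>space unif01. G (x, u) \<in> W} \<in> sets unif01" by measurable
      qed (use j in auto)
      finally show "0 < emeasure unif01 {u\<in>space unif01. G (x, u) \<in> W}" .
    qed
    then show ?thesis using x by (simp add: h'_def y_def mean)
  qed
  have "\<exists>\<beta> j. (\<forall>i. \<beta> i \<in> borel_measurable MX \<and> j i \<in> measurable MX (count_space UNIV)) \<and>
    (\<forall>x\<in>space MX. (\<forall>i. 0 \<le> \<beta> i x) \<and> (\<Sum>i<CARD('d)+1. \<beta> i x) = 1 \<and>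
      (\<Sum>i<CARD('d)+1. \<beta> i x *\<^sub>R y (j i x) x) = h' x)"
    by (rule measurable_caratheodory) (measurable, rule hull)
  then obtain \<beta> j where \<beta>j: "\<forall>i. \<beta> i \<in> borel_measurable MX \<and> j i \<in> measurable MX (count_space UNIV)"
    and b: "\<forall>x\<in>space MX. (\<forall>i. 0 \<le> \<beta> i x) \<and> (\<Sum>i<CARD('d)+1. \<beta> i x) = 1 \<and>
      (\<Sum>i<CARD('d)+1. \<beta> i x *\<^sub>R y (j i x) x) = h' x"
    by blast
  have \<beta>: "\<beta> i \<in> borel_measurable MX" and j[measurable]: "j i \<in> measurable MX (count_space UNIV)" for i
    using \<beta>j by auto
  show ?thesis
  proof (rule exI[of _ \<beta>], rule exI[of _ "\<lambda>i x. v (j i x) x"], intro conjI allI ballI)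
    show "(\<lambda>x. v (j i x) x) \<in> borel_measurable MX" for i by measurable
    fix x assume x: "x \<in> X0"
    show "(x, v (j i x) x) \<in> E" for i using vZ[OF x, of "j i x"] by (auto simp: Z_def R_def)
    show "(\<Sum>i<CARD('d)+1. \<beta> i x *\<^sub>R G (x, v (j i x) x)) = h x"
      using bspec[OF b X0_space[OF x]] x by (simp add: y_def h'_def)
  qed (use \<beta> b in auto)
qed


section \<open>State and action laws of a policy\<close>

locale mdp =
  fixes MX :: "'x measure" and MA :: "'a measure" and Q :: "'x \<times> 'a \<Rightarrow> 'x measure" and \<eta> :: "'x measure"
  assumes Q: "Q \<in> measurable (MX \<Otimes>\<^sub>M MA) (prob_algebra MX)"
    and \<eta>: "\<eta> \<in> space (prob_algebra MX)"
begin

definition kernels :: "(nat \<Rightarrow> (nat \<Rightarrow> 'x \<times> 'a) \<times> 'x \<Rightarrow> 'a measure) \<Rightarrow> bool" where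
  "kernels \<pi> \<longleftrightarrow> (\<forall>n. \<pi> n \<in> measurable (Hist MX MA n) (prob_algebra MA))"

definition next_state :: "nat \<Rightarrow> (nat \<Rightarrow> 'x \<times> 'a) \<Rightarrow> 'x measure" where
  "next_state n \<omega> = (if n = 0 then \<eta> else Q (\<omega> (n - 1)))"

text \<open>The law of \<open>X_n\<close>: the history law contains \<open>n\<close> complete pairs,
  so the draw of the next state is still missing from it.\<close>

definition state_law where
  "state_law \<pi> n = fdd MX MA Q \<eta> \<pi> n \<bind> next_state n"

definition pair_law where
  "pair_law \<pi> n = distr (fdd MX MA Q \<eta> \<pi> (Suc n)) (MX \<Otimes>\<^sub>M MA) (\<lambda>\<omega>. \<omega> n)"

abbreviation "SA \<equiv> MX \<Otimes>\<^sub>M MA"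
abbreviation "hist_law \<equiv> fdd MX MA Q \<eta>"
abbreviation "path_law \<equiv> strat MX MA Q \<eta>"

abbreviation "OM n \<equiv> PiM {..<n} (\<lambda>_. SA)"

lemma OM: "Omega_n MX MA n = OM n" by (simp add: Omega_n_def XA_def)

lemma next_state_meas[measurable]: "next_state n \<in> measurable (OM n) (prob_algebra MX)"
proof (cases n)
  case 0 then show ?thesis unfolding next_state_def using \<eta> by simp
next
  case (Suc m)
  have "(\<lambda>\<omega>. \<omega> m) \<in> measurable (OM n) SA"
    using Suc by (intro measurable_component_singleton) auto
  from measurable_compose[OF this Q] show ?thesis unfolding next_state_def[abs_def] using Suc by simp
qed

lemma fun_upd_meas[measurable]:
  "(\<lambda>(\<omega>, z). fun_upd \<omega> n z) \<in> measurable (OM n \<Otimes>\<^sub>M SA) (OM (Suc n))"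
  unfolding lessThan_Suc
  by (rule measurable_cong_simp[THEN iffD1, OF refl refl _ measurable_add_dim]) (auto simp: split_beta)

lemma kernelsD: "kernels \<pi> \<Longrightarrow> \<pi> n \<in> measurable (OM n \<Otimes>\<^sub>M MX) (prob_algebra MA)"
  by (simp add: kernels_def Hist_def OM)

text \<open>The output map \<open>f\<close> is left open because two are used:
  \<open>fun_upd\<close>, which extends the history, and the projection to the new pair, which gives
  the kernels of the Ionescu-Tulcea construction.\<close>

lemma step_meas:
  assumes \<pi>: "kernels \<pi>"
    and f[measurable]: "(\<lambda>(\<omega>, z). f \<omega> z) \<in> measurable (OM n \<Otimes>\<^sub>M SA) N"
  shows "(\<lambda>(\<omega>, x). \<pi> n (\<omega>, x) \<bind> (\<lambda>a. return N (f \<omega> (x, a)))) \<in> measurable (OM n \<Otimes>\<^sub>M MX) (prob_algebra N)"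
    and "(\<lambda>\<omega>. next_state n \<omega> \<bind> (\<lambda>x. \<pi> n (\<omega>, x) \<bind> (\<lambda>a. return N (f \<omega> (x, a)))))
      \<in> measurable (OM n) (prob_algebra N)"
proof -
  note [measurable] = kernelsD[OF \<pi>]
  have "(\<lambda>p. (fst (fst p), (snd (fst p), snd p))) \<in> measurable ((OM n \<Otimes>\<^sub>M MX) \<Otimes>\<^sub>M MA) (OM n \<Otimes>\<^sub>M SA)"
    by measurable
  from measurable_compose[OF this f]
  have [measurable]: "(\<lambda>(h, a). f (fst h) (snd h, a)) \<in> measurable ((OM n \<Otimes>\<^sub>M MX) \<Otimes>\<^sub>M MA) N"
    by (simp add: split_beta')
  show *: "(\<lambda>(\<omega>, x). \<pi> n (\<omega>, x) \<bind> (\<lambda>a. return N (f \<omega> (x, a)))) \<in> measurable (OM n \<Otimes>\<^sub>M MX) (prob_algebra N)"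
  proof -
    have "(\<lambda>h. \<pi> n h \<bind> (\<lambda>a. return N (f (fst h) (snd h, a)))) \<in> measurable (OM n \<Otimes>\<^sub>M MX) (prob_algebra N)"
      by (rule measurable_bind_prob_space2[where N=MA]) measurable
    then show ?thesis by (simp add: split_beta')
  qed
  show "(\<lambda>\<omega>. next_state n \<omega> \<bind> (\<lambda>x. \<pi> n (\<omega>, x) \<bind> (\<lambda>a. return N (f \<omega> (x, a)))))
      \<in> measurable (OM n) (prob_algebra N)"
    by (rule measurable_bind_prob_space2[OF next_state_meas *])
qed

lemma fdd_Suc:
  "hist_law \<pi> (Suc n) = hist_law \<pi> n \<bind> (\<lambda>\<omega>. next_state n \<omega> \<bind>
     (\<lambda>x. \<pi> n (\<omega>, x) \<bind> (\<lambda>a. return (OM (Suc n)) (fun_upd \<omega> n (x, a)))))"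
  by (simp add: next_state_def OM del: fun_upd_apply)

lemma fdd_prob:
  assumes "kernels \<pi>"
  shows "hist_law \<pi> n \<in> space (prob_algebra (OM n))"
proof (induction n)
  case 0
  show ?case by (auto simp: OM space_prob_algebra space_PiM intro!: prob_space_return)
next
  case (Suc n)
  have "hist_law \<pi> (Suc n) \<in> space (prob_algebra (OM (Suc n)))"
    unfolding fdd_Suc
    using measurable_bind_prob_space[OF measurable_const[OF Suc] step_meas(2)[OF assms fun_upd_meas],
      of "count_space UNIV", THEN measurable_space] by simp
  then show ?case .
qed

lemma fdd_sets[measurable_cong]: "kernels \<pi> \<Longrightarrow> sets (hist_law \<pi> n) = sets (OM n)"
  using fdd_prob by (auto simp: space_prob_algebra)

lemma fdd_prob_space: "kernels \<pi> \<Longrightarrow> prob_space (hist_law \<pi> n)"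
  using fdd_prob by (auto simp: space_prob_algebra)

lemma next_state_sub: "kernels \<pi> \<Longrightarrow> next_state n \<in> measurable (hist_law \<pi> n) (subprob_algebra MX)"
  using measurable_prob_algebraD[OF next_state_meas] fdd_sets[of \<pi> n] by (simp cong: measurable_cong_sets)

lemma nn_integral_fdd_Suc:
  assumes \<pi>: "kernels \<pi>" and F[measurable]: "F \<in> borel_measurable (OM (Suc n))"
  shows "(\<integral>\<^sup>+\<omega>. F \<omega> \<partial>hist_law \<pi> (Suc n)) =
    (\<integral>\<^sup>+\<omega>. \<integral>\<^sup>+x. \<integral>\<^sup>+a. F (fun_upd \<omega> n (x, a)) \<partial>\<pi> n (\<omega>, x) \<partial>next_state n \<omega> \<partial>hist_law \<pi> n)"
proof -
  let ?R = "\<lambda>\<omega> x. \<pi> n (\<omega>, x) \<bind> (\<lambda>a. return (OM (Suc n)) (fun_upd \<omega> n (x, a)))"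
  note m = step_meas[OF \<pi> fun_upd_meas]
  note [measurable_cong] = fdd_sets[OF \<pi>]
  have spO: "space (hist_law \<pi> n) = space (OM n)" by (rule sets_eq_imp_space_eq) (rule fdd_sets[OF \<pi>])
  have "(\<integral>\<^sup>+\<omega>. F \<omega> \<partial>hist_law \<pi> (Suc n)) =
    (\<integral>\<^sup>+\<omega>. \<integral>\<^sup>+\<omega>'. F \<omega>' \<partial>(next_state n \<omega> \<bind> ?R \<omega>) \<partial>hist_law \<pi> n)"
    unfolding fdd_Suc
    by (rule nn_integral_bind[OF F]) (use measurable_prob_algebraD[OF m(2)] in measurable)
  also have "\<dots> = (\<integral>\<^sup>+\<omega>. \<integral>\<^sup>+x. \<integral>\<^sup>+a. F (fun_upd \<omega> n (x, a)) \<partial>\<pi> n (\<omega>, x) \<partial>next_state n \<omega> \<partial>hist_law \<pi> n)"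
  proof (rule nn_integral_cong)
    fix \<omega> assume "\<omega> \<in> space (hist_law \<pi> n)"
    then have w: "\<omega> \<in> space (OM n)" by (simp add: spO)
    have ns: "sets (next_state n \<omega>) = sets MX"
      using measurable_space[OF next_state_meas w] by (simp add: space_prob_algebra)
    have R: "?R \<omega> \<in> measurable (next_state n \<omega>) (subprob_algebra (OM (Suc n)))"
      using measurable_prob_algebraD[OF measurable_compose[OF measurable_Pair1'[OF w] m(1)]] ns
      by (simp cong: measurable_cong_sets)
    have "(\<integral>\<^sup>+\<omega>'. F \<omega>' \<partial>(next_state n \<omega> \<bind> ?R \<omega>)) = (\<integral>\<^sup>+x. \<integral>\<^sup>+\<omega>'. F \<omega>' \<partial>?R \<omega> x \<partial>next_state n \<omega>)"
      by (rule nn_integral_bind[OF F R])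
    also have "\<dots> = (\<integral>\<^sup>+x. \<integral>\<^sup>+a. F (fun_upd \<omega> n (x, a)) \<partial>\<pi> n (\<omega>, x) \<partial>next_state n \<omega>)"
    proof (rule nn_integral_cong)
      fix x assume "x \<in> space (next_state n \<omega>)"
      then have x: "x \<in> space MX" using sets_eq_imp_space_eq[OF ns] by simp
      have wx: "(\<omega>, x) \<in> space (OM n \<Otimes>\<^sub>M MX)" using w x by (simp add: space_pair_measure)
      have pi: "sets (\<pi> n (\<omega>, x)) = sets MA"
        using measurable_space[OF kernelsD[OF \<pi>] wx] by (simp add: space_prob_algebra)
      have "(\<lambda>a. (\<omega>, (x, a))) \<in> measurable MA (OM n \<Otimes>\<^sub>M SA)"
        using w x by measurable
      from measurable_compose[OF this fun_upd_meas]
      have u: "(\<lambda>a. fun_upd \<omega> n (x, a)) \<in> measurable (\<pi> n (\<omega>, x)) (OM (Suc n))"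
        by (simp cong: measurable_cong_sets add: pi)
      have "(\<integral>\<^sup>+\<omega>'. F \<omega>' \<partial>?R \<omega> x) = (\<integral>\<^sup>+a. \<integral>\<^sup>+\<omega>'. F \<omega>' \<partial>return (OM (Suc n)) (fun_upd \<omega> n (x, a)) \<partial>\<pi> n (\<omega>, x))"
        by (rule nn_integral_bind[OF F]) (rule measurable_compose[OF u return_measurable])
      also have "\<dots> = (\<integral>\<^sup>+a. F (fun_upd \<omega> n (x, a)) \<partial>\<pi> n (\<omega>, x))"
        using measurable_space[OF u] by (intro nn_integral_cong nn_integral_return F) auto
      finally show "(\<integral>\<^sup>+\<omega>'. F \<omega>' \<partial>?R \<omega> x) = (\<integral>\<^sup>+a. F (fun_upd \<omega> n (x, a)) \<partial>\<pi> n (\<omega>, x))" .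
    qed
    finally show "(\<integral>\<^sup>+\<omega>'. F \<omega>' \<partial>(next_state n \<omega> \<bind> ?R \<omega>)) =
      (\<integral>\<^sup>+x. \<integral>\<^sup>+a. F (fun_upd \<omega> n (x, a)) \<partial>\<pi> n (\<omega>, x) \<partial>next_state n \<omega>)" .
  qed
  finally show ?thesis .
qed

lemma state_law_prob: "kernels \<pi> \<Longrightarrow> state_law \<pi> n \<in> space (prob_algebra MX)"
  unfolding state_law_def
  using measurable_bind_prob_space[OF measurable_const[OF fdd_prob] next_state_meas,
      of \<pi> n "count_space UNIV", THEN measurable_space] by simp

lemma state_law_sets[measurable_cong]: "kernels \<pi> \<Longrightarrow> sets (state_law \<pi> n) = sets MX"
  using state_law_prob by (auto simp: space_prob_algebra)

lemma nn_integral_state_law: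
  assumes "kernels \<pi>" "f \<in> borel_measurable MX"
  shows "(\<integral>\<^sup>+x. f x \<partial>state_law \<pi> n) = (\<integral>\<^sup>+\<omega>. \<integral>\<^sup>+x. f x \<partial>next_state n \<omega> \<partial>hist_law \<pi> n)"
  unfolding state_law_def by (rule nn_integral_bind[OF assms(2) next_state_sub[OF assms(1)]])

lemma component_meas: "kernels \<pi> \<Longrightarrow> (\<lambda>\<omega>. \<omega> n) \<in> measurable (hist_law \<pi> (Suc n)) SA"
  by (subst measurable_cong_sets[OF fdd_sets refl]) (auto intro: measurable_component_singleton)

lemma pair_law_sets[simp, measurable_cong]: "sets (pair_law \<pi> n) = sets SA"
  by (simp add: pair_law_def)

lemma nn_integral_pair_law:
  assumes \<pi>: "kernels \<pi>" and F[measurable]: "F \<in> borel_measurable SA"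
  shows "(\<integral>\<^sup>+z. F z \<partial>pair_law \<pi> n) =
    (\<integral>\<^sup>+\<omega>. \<integral>\<^sup>+x. \<integral>\<^sup>+a. F (x, a) \<partial>\<pi> n (\<omega>, x) \<partial>next_state n \<omega> \<partial>hist_law \<pi> n)"
proof -
  have [measurable]: "(\<lambda>\<omega>. \<omega> n) \<in> measurable (OM (Suc n)) SA"
    by (intro measurable_component_singleton) auto
  have "(\<integral>\<^sup>+z. F z \<partial>pair_law \<pi> n) = (\<integral>\<^sup>+\<omega>. F (\<omega> n) \<partial>hist_law \<pi> (Suc n))"
    unfolding pair_law_def by (rule nn_integral_distr[OF component_meas[OF \<pi>]]) simp
  also have "\<dots> = (\<integral>\<^sup>+\<omega>. \<integral>\<^sup>+x. \<integral>\<^sup>+a. F (x, a) \<partial>\<pi> n (\<omega>, x) \<partial>next_state n \<omega> \<partial>hist_law \<pi> n)"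
    by (subst nn_integral_fdd_Suc[OF \<pi>]) simp_all
  finally show ?thesis .
qed

lemma nn_integral_pair_law_state:
  assumes \<pi>: "kernels \<pi>" and f[measurable]: "f \<in> borel_measurable MX"
  shows "(\<integral>\<^sup>+z. f (fst z) \<partial>pair_law \<pi> n) = (\<integral>\<^sup>+x. f x \<partial>state_law \<pi> n)"
proof -
  have spO: "space (hist_law \<pi> n) = space (OM n)" by (rule sets_eq_imp_space_eq) (rule fdd_sets[OF \<pi>])
  have "(\<integral>\<^sup>+a. f x \<partial>\<pi> n (\<omega>, x)) = f x" if "\<omega> \<in> space (OM n)" "x \<in> space (next_state n \<omega>)" for \<omega> x
  proof -
    have "x \<in> space MX" using that measurable_space[OF next_state_meas that(1)]
      by (auto simp: space_prob_algebra dest: sets_eq_imp_space_eq)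
    then have "prob_space (\<pi> n (\<omega>, x))"
      using measurable_space[OF kernelsD[OF \<pi>], of "(\<omega>, x)" n] that(1)
      by (simp add: space_prob_algebra space_pair_measure)
    then show ?thesis by (simp add: prob_space.emeasure_space_1)
  qed
  then show ?thesis
    unfolding nn_integral_state_law[OF \<pi> f]
    by (subst nn_integral_pair_law[OF \<pi>]) (auto simp: spO intro!: nn_integral_cong)
qed

lemma nn_integral_state_law_0:
  assumes "kernels \<pi>" "f \<in> borel_measurable MX"
  shows "(\<integral>\<^sup>+x. f x \<partial>state_law \<pi> 0) = (\<integral>\<^sup>+x. f x \<partial>\<eta>)"
  unfolding nn_integral_state_law[OF assms]
  using prob_space.emeasure_space_1[OF fdd_prob_space[OF assms(1), of 0]]
  by (simp add: next_state_def del: fdd.simps)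

lemma nn_integral_state_law_Suc:
  assumes \<pi>: "kernels \<pi>" and f[measurable]: "f \<in> borel_measurable MX"
  shows "(\<integral>\<^sup>+x. f x \<partial>state_law \<pi> (Suc n)) = (\<integral>\<^sup>+z. \<integral>\<^sup>+y. f y \<partial>Q z \<partial>pair_law \<pi> n)"
proof -
  have "(\<lambda>z. \<integral>\<^sup>+y. f y \<partial>Q z) \<in> borel_measurable SA"
    using measurable_compose[OF measurable_prob_algebraD[OF Q] nn_integral_measurable_subprob_algebra[OF f]] .
  then show ?thesis
    unfolding nn_integral_state_law[OF assms] pair_law_def
    by (subst nn_integral_distr[OF component_meas[OF \<pi>]]) (auto simp: next_state_def)
qed

text \<open>The assumption concerns the decision at the single time \<open>n\<close>, so the formula
  also covers policies that become stationary after an arbitrary start.\<close>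

lemma nn_integral_pair_law_markov:
  assumes \<pi>: "kernels \<pi>" and F[measurable]: "F \<in> borel_measurable SA"
    and \<kappa>: "\<kappa> \<in> measurable MX (prob_algebra MA)" "\<And>h. \<pi> n h = \<kappa> (snd h)"
  shows "(\<integral>\<^sup>+z. F z \<partial>pair_law \<pi> n) = (\<integral>\<^sup>+x. \<integral>\<^sup>+a. F (x, a) \<partial>\<kappa> x \<partial>state_law \<pi> n)"
proof -
  have "(\<lambda>x. \<integral>\<^sup>+a. F (x, a) \<partial>\<kappa> x) \<in> borel_measurable MX"
    using measurable_prob_algebraD[OF \<kappa>(1)] by (rule nn_integral_measurable_subprob_algebra2[rotated]) simp
  then show ?thesis
    unfolding nn_integral_pair_law[OF \<pi> F] \<kappa>(2) snd_conv by (simp add: nn_integral_state_law[OF \<pi>])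
qed

lemma fdd_cong: "(\<And>k. k < n \<Longrightarrow> \<pi> k = \<sigma> k) \<Longrightarrow> hist_law \<pi> n = hist_law \<sigma> n"
  by (induction n) auto

text \<open>The state at time \<open>n\<close> is drawn before the action at time \<open>n\<close>;
  hence the bound \<open>k < n\<close>. A switch of policy at time \<open>n\<close> thus leaves the
  state law at \<open>n\<close> unchanged.\<close>

lemma state_law_cong: "(\<And>k. k < n \<Longrightarrow> \<pi> k = \<sigma> k) \<Longrightarrow> state_law \<pi> n = state_law \<sigma> n"
  unfolding state_law_def by (simp add: fdd_cong[of n \<pi> \<sigma>])

section \<open>Laws on infinite paths\<close>

abbreviation "OI \<equiv> PiM UNIV (\<lambda>_::nat. SA)"

text \<open>A finite-dimensional cylinder is already seen by a sufficiently long prefix, and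
  cylinders determine the measure. Together with \<open>strat_exists\<close> this makes the definite
  description in \<open>strat\<close> denote.\<close>

lemma strat_unique:
  assumes P: "P \<in> space (prob_algebra OI)" "\<And>n. distr P (OM n) (\<lambda>\<omega>. restrict \<omega> {..<n}) = hist_law \<pi> n"
    and P': "P' \<in> space (prob_algebra OI)" "\<And>n. distr P' (OM n) (\<lambda>\<omega>. restrict \<omega> {..<n}) = hist_law \<pi> n"
  shows "P = P'"
proof (rule measure_eqI_PiM_infinite)
  have s: "sets P = sets OI" "sets P' = sets OI" "prob_space P" "prob_space P'"
    using P(1) P'(1) by (auto simp: space_prob_algebra)
  show "sets P = sets OI" "sets P' = sets OI" by fact+
  show "finite_measure P" using s(3) by (simp add: prob_space_def)
  fix A and J :: "nat set" assume J: "finite J" "\<And>i. i \<in> J \<Longrightarrow> A i \<in> sets SA"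
  obtain n where n: "J \<subseteq> {..<n}" using finite_nat_iff_bounded J(1) by auto
  define X where "X = prod_emb {..<n} (\<lambda>_. SA) J (Pi\<^sub>E J A)"
  have X: "X \<in> sets (OM n)" unfolding X_def using n J by (intro sets_PiM_I) auto
  have "prod_emb UNIV (\<lambda>_. SA) J (Pi\<^sub>E J A) = prod_emb UNIV (\<lambda>_. SA) {..<n} X"
    unfolding X_def using n by (subst prod_emb_trans) auto
  also have "\<dots> = (\<lambda>\<omega>. restrict \<omega> {..<n}) -` X \<inter> space OI"
    by (simp add: prod_emb_def space_PiM)
  finally have eq: "prod_emb UNIV (\<lambda>_. SA) J (Pi\<^sub>E J A) = (\<lambda>\<omega>. restrict \<omega> {..<n}) -` X \<inter> space OI" .
  have "emeasure R (prod_emb UNIV (\<lambda>_. SA) J (Pi\<^sub>E J A)) = emeasure (distr R (OM n) (\<lambda>\<omega>. restrict \<omega> {..<n})) X"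
    if R: "sets R = sets OI" for R
  proof -
    have "(\<lambda>\<omega>. restrict \<omega> {..<n}) \<in> measurable R (OM n)"
      unfolding measurable_cong_sets[OF R refl] by (rule measurable_restrict_subset) simp
    then show ?thesis using X by (simp add: emeasure_distr eq sets_eq_imp_space_eq[OF R])
  qed
  then show "emeasure P (prod_emb UNIV (\<lambda>_. SA) J (Pi\<^sub>E J A)) = emeasure P' (prod_emb UNIV (\<lambda>_. SA) J (Pi\<^sub>E J A))"
    using s P(2) P'(2) by simp
qed

lemma strat_exists:
  assumes \<pi>: "kernels \<pi>"
  shows "\<exists>P. P \<in> space (prob_algebra OI) \<and> (\<forall>n. distr P (OM n) (\<lambda>\<omega>. restrict \<omega> {..<n}) = hist_law \<pi> n)"
proof -
  \<comment> \<open>\<open>K n\<close> returns only the new pair, while \<open>fdd\<close> returns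
    the extended history at once; \<open>eP\<close> below reconciles the two.\<close>
  define K where "K n \<omega> = next_state n \<omega> \<bind> (\<lambda>x. \<pi> n (\<omega>, x) \<bind> (\<lambda>a. return SA (x, a)))" for n \<omega>
  have K: "K n \<in> measurable (OM n) (prob_algebra SA)" for n
    unfolding K_def[abs_def] by (rule step_meas(2)[OF \<pi>, of "\<lambda>\<omega> z. z"]) simp
  interpret IT: Ionescu_Tulcea K "\<lambda>_. SA"
  proof (rule Ionescu_Tulcea.intro)
    show "K i \<in> measurable (PiM {0..<i} (\<lambda>_. SA)) (subprob_algebra SA)" for i
      using measurable_prob_algebraD[OF K] by (simp add: lessThan_atLeast0)
    fix i :: nat and x assume "x \<in> space (PiM {0..<i} (\<lambda>_. SA))"
    then show "prob_space (K i x)"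
      using measurable_space[OF K, of x i] by (simp add: lessThan_atLeast0 space_prob_algebra)
  qed
  have eP: "IT.eP n \<omega> = next_state n \<omega> \<bind> (\<lambda>x. \<pi> n (\<omega>, x) \<bind> (\<lambda>a. return (OM (Suc n)) (fun_upd \<omega> n (x, a))))"
    if w: "\<omega> \<in> space (OM n)" for n \<omega>
  proof -
    have u: "fun_upd \<omega> n \<in> measurable SA (OM (Suc n))"
      using measurable_compose[OF measurable_Pair1'[OF w] fun_upd_meas] by simp
    have ns: "sets (next_state n \<omega>) = sets MX" "prob_space (next_state n \<omega>)"
      using measurable_space[OF next_state_meas w] by (auto simp: space_prob_algebra)
    have m: "(\<lambda>x. \<pi> n (\<omega>, x) \<bind> (\<lambda>a. return SA (x, a))) \<in> measurable (next_state n \<omega>) (subprob_algebra SA)"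
      using measurable_prob_algebraD[OF measurable_compose[OF measurable_Pair1'[OF w] step_meas(1)[OF \<pi>, of "\<lambda>\<omega> z. z"]]] ns
      by (simp cong: measurable_cong_sets)
    have "IT.eP n \<omega> = distr (K n \<omega>) (OM (Suc n)) (fun_upd \<omega> n)"
      unfolding IT.eP_def by (simp add: lessThan_atLeast0)
    also have "\<dots> = next_state n \<omega> \<bind> (\<lambda>x. distr (\<pi> n (\<omega>, x) \<bind> (\<lambda>a. return SA (x, a))) (OM (Suc n)) (fun_upd \<omega> n))"
      unfolding K_def by (rule distr_bind[OF m prob_space.not_empty[OF ns(2)] u])
    also have "\<dots> = next_state n \<omega> \<bind> (\<lambda>x. \<pi> n (\<omega>, x) \<bind> (\<lambda>a. return (OM (Suc n)) (fun_upd \<omega> n (x, a))))"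
    proof (rule bind_cong[OF refl])
      fix x assume "x \<in> space (next_state n \<omega>)"
      then have x: "x \<in> space MX" using sets_eq_imp_space_eq[OF ns(1)] by simp
      then have pi: "sets (\<pi> n (\<omega>, x)) = sets MA" "prob_space (\<pi> n (\<omega>, x))"
        using measurable_space[OF kernelsD[OF \<pi>], of "(\<omega>, x)" n] w by (auto simp add: space_prob_algebra space_pair_measure)
      have r: "(\<lambda>a. return SA (x, a)) \<in> measurable (\<pi> n (\<omega>, x)) (subprob_algebra SA)"
        unfolding measurable_cong_sets[OF pi(1) refl]
        by (rule measurable_compose[OF measurable_Pair1'[OF x] return_measurable])
      show "distr (\<pi> n (\<omega>, x) \<bind> (\<lambda>a. return SA (x, a))) (OM (Suc n)) (fun_upd \<omega> n) =
        \<pi> n (\<omega>, x) \<bind> (\<lambda>a. return (OM (Suc n)) (fun_upd \<omega> n (x, a)))"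
        unfolding distr_bind[OF r prob_space.not_empty[OF pi(2)] u]
        using x sets_eq_imp_space_eq[OF pi(1)]
        by (intro bind_cong refl distr_return[OF u]) (auto simp: space_pair_measure)
    qed
    finally show ?thesis .
  qed
  have C: "IT.C 0 n (\<lambda>_. undefined) = hist_law \<pi> n" for n
  proof (induction n)
    case 0 show ?case by (simp add: OM)
  next
    case (Suc n)
    have sp: "space (hist_law \<pi> n) = space (OM n)" by (rule sets_eq_imp_space_eq) (rule fdd_sets[OF \<pi>])
    have "IT.C 0 (Suc n) (\<lambda>_. undefined) = hist_law \<pi> n \<bind> IT.eP n" by (simp add: Suc)
    also have "\<dots> = hist_law \<pi> (Suc n)"
      unfolding fdd_Suc by (rule bind_cong[OF refl]) (simp add: eP sp)
    finally show ?case .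
  qed
  have sl: "sets IT.PF.lim = sets OI" by simp
  have lim: "distr IT.PF.lim (OM n) (\<lambda>\<omega>. restrict \<omega> {..<n}) = hist_law \<pi> n" for n
  proof -
    have "distr IT.PF.lim (OM n) (\<lambda>\<omega>. restrict \<omega> {..<n}) = IT.CI {..<n}"
      by (rule IT.distr_lim) simp
    also have "\<dots> = hist_law \<pi> n"
    proof (rule measure_eqI)
      show "sets (IT.CI {..<n}) = sets (hist_law \<pi> n)" using fdd_sets[OF \<pi>] by (simp add: IT.CI_def)
      fix X assume "X \<in> sets (IT.CI {..<n})"
      then have X: "X \<in> sets (OM n)" by (simp add: IT.CI_def)
      then have "prod_emb {0..<n} (\<lambda>_. SA) {..<n} X = X"
        using sets.sets_into_space[OF X] by (simp add: lessThan_atLeast0 prod_emb_id space_PiM)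
      then show "emeasure (IT.CI {..<n}) X = emeasure (hist_law \<pi> n) X"
        using IT.emeasure_CI[of "{..<n}" n X] X by (simp add: C lessThan_atLeast0)
    qed
    finally show ?thesis .
  qed
  \<comment> \<open>Total mass is read off from the prefix of length 0, whose law is a probability
    measure.\<close>
  have "prob_space IT.PF.lim"
  proof -
    have "(\<lambda>\<omega>. restrict \<omega> {..<0::nat}) \<in> measurable IT.PF.lim (OM 0)"
      unfolding measurable_cong_sets[OF sl refl] by (rule measurable_restrict_subset) simp
    moreover have "prob_space (distr IT.PF.lim (OM 0) (\<lambda>\<omega>. restrict \<omega> {..<0}))"
      unfolding lim by (rule fdd_prob_space[OF \<pi>])
    ultimately show ?thesis by (rule prob_space_distrD)
  qed
  then show ?thesis using lim sl by (intro exI[of _ IT.PF.lim]) (simp add: space_prob_algebra)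
qed

lemma strat_spec:
  assumes \<pi>: "kernels \<pi>"
  shows "path_law \<pi> \<in> space (prob_algebra OI)"
    "distr (path_law \<pi>) (OM n) (\<lambda>\<omega>. restrict \<omega> {..<n}) = hist_law \<pi> n"
proof -
  have "path_law \<pi> \<in> space (prob_algebra OI) \<and>
     (\<forall>n. distr (path_law \<pi>) (OM n) (\<lambda>\<omega>. restrict \<omega> {..<n}) = hist_law \<pi> n)"
    unfolding strat_def Omega_def XA_def OM
    by (rule theI') (use strat_exists[OF \<pi>] strat_unique in blast)
  then show "path_law \<pi> \<in> space (prob_algebra OI)"
    "distr (path_law \<pi>) (OM n) (\<lambda>\<omega>. restrict \<omega> {..<n}) = hist_law \<pi> n" by auto
qed

lemma strat_sets[measurable_cong]: "kernels \<pi> \<Longrightarrow> sets (path_law \<pi>) = sets OI"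
  using strat_spec(1) by (auto simp: space_prob_algebra)

lemma strat_prob_space: "kernels \<pi> \<Longrightarrow> prob_space (path_law \<pi>)"
  using strat_spec(1) by (auto simp: space_prob_algebra)

lemma nn_integral_strat_fdd:
  assumes \<pi>: "kernels \<pi>" and F: "F \<in> borel_measurable (OM n)"
  shows "(\<integral>\<^sup>+\<omega>. F (restrict \<omega> {..<n}) \<partial>path_law \<pi>) = (\<integral>\<^sup>+\<omega>. F \<omega> \<partial>hist_law \<pi> n)"
  unfolding strat_spec(2)[OF \<pi>, symmetric]
proof (rule nn_integral_distr[symmetric])
  show "(\<lambda>\<omega>. restrict \<omega> {..<n}) \<in> measurable (path_law \<pi>) (OM n)"
    unfolding measurable_cong_sets[OF strat_sets[OF \<pi>] refl] by (rule measurable_restrict_subset) simp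
qed (simp add: F)

lemma nn_integral_strat_pair_law:
  assumes \<pi>: "kernels \<pi>" and F[measurable]: "F \<in> borel_measurable SA"
  shows "(\<integral>\<^sup>+\<omega>. F (\<omega> n) \<partial>path_law \<pi>) = (\<integral>\<^sup>+z. F z \<partial>pair_law \<pi> n)"
proof -
  have [measurable]: "(\<lambda>\<omega>. \<omega> n) \<in> measurable (OM (Suc n)) SA"
    by (intro measurable_component_singleton) auto
  have "(\<integral>\<^sup>+\<omega>. F (\<omega> n) \<partial>path_law \<pi>) = (\<integral>\<^sup>+\<omega>. F (restrict \<omega> {..<Suc n} n) \<partial>path_law \<pi>)"
    by simp
  also have "\<dots> = (\<integral>\<^sup>+\<omega>. F (\<omega> n) \<partial>hist_law \<pi> (Suc n))"
    by (rule nn_integral_strat_fdd[OF \<pi>, of "\<lambda>\<omega>. F (\<omega> n)"]) measurable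
  also have "\<dots> = (\<integral>\<^sup>+z. F z \<partial>pair_law \<pi> n)"
    unfolding pair_law_def by (rule nn_integral_distr[symmetric, OF component_meas[OF \<pi>]]) simp
  finally show ?thesis .
qed

end


section \<open>Absorption and occupation measures\<close>

lemma less_T_Delta_iff: "enat t < T_Delta \<Delta> \<omega> \<longleftrightarrow> (\<forall>s\<le>t. fst (\<omega> s) \<notin> \<Delta>)"
proof (cases "\<exists>n. fst (\<omega> n) \<in> \<Delta>")
  case True
  define L where "L = (LEAST n. fst (\<omega> n) \<in> \<Delta>)"
  have T: "T_Delta \<Delta> \<omega> = enat L" using True by (simp add: T_Delta_def L_def)
  have L: "fst (\<omega> L) \<in> \<Delta>" unfolding L_def using True by (rule LeastI_ex)
  have min: "fst (\<omega> s) \<notin> \<Delta>" if "s < L" for s using that not_less_Least unfolding L_def by blast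
  show ?thesis unfolding T enat_ord_simps
  proof
    assume "t < L"
    then show "\<forall>s\<le>t. fst (\<omega> s) \<notin> \<Delta>" using min by simp
  next
    assume "\<forall>s\<le>t. fst (\<omega> s) \<notin> \<Delta>"
    then show "t < L" using L not_less by blast
  qed
next
  case False
  then show ?thesis by (simp add: T_Delta_def)
qed

lemma ennreal_of_enat_eq_suminf: "ennreal_of_enat N = (\<Sum>t. indicator {t. enat t < N} t)"
proof (cases N)
  case (enat n)
  have "(\<Sum>t. indicator {t. enat t < N} t :: ennreal) = (\<Sum>t<n. indicator {t. enat t < N} t)"
    by (rule suminf_finite) (auto simp: enat)
  also have "\<dots> = (\<Sum>t<n. 1)" by (intro sum.cong) (auto simp: enat)
  finally show ?thesis by (simp add: enat)
next
  case infinity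
  have "(\<Sum>t. indicator {t. enat t < N} t :: ennreal) = (SUP n::nat. \<Sum>t<n. 1)"
    unfolding infinity suminf_eq_SUP by (simp add: indicator_def[abs_def])
  also have "\<dots> = top" by (simp add: ennreal_SUP_of_nat_eq_top)
  finally show ?thesis by (simp add: infinity)
qed

locale absorbing_mdp = mdp MX MA Q \<eta>
  for MX :: "'x measure" and MA :: "'a measure" and Q \<eta> +
  fixes \<Delta> :: "'x set"
  assumes \<Delta>: "\<Delta> \<in> sets MX"
    and Q_\<Delta>: "\<And>x a. x \<in> \<Delta> \<Longrightarrow> a \<in> space MA \<Longrightarrow> emeasure (Q (x, a)) \<Delta> = 1"
begin

declare \<Delta>[measurable]

abbreviation "Dc \<equiv> space MX - \<Delta>"
abbreviation "occ_measure \<equiv> occ MX MA Q \<eta> \<Delta>"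

lemma Q_sets: "z \<in> space SA \<Longrightarrow> sets (Q z) = sets MX"
  and Q_prob: "z \<in> space SA \<Longrightarrow> prob_space (Q z)"
  using measurable_space[OF Q] by (auto simp: space_prob_algebra)

lemma nn_integral_Q_meas:
  assumes "f \<in> borel_measurable MX"
  shows "(\<lambda>z. \<integral>\<^sup>+y. f y \<partial>Q z) \<in> borel_measurable SA"
  using measurable_compose[OF measurable_prob_algebraD[OF Q] nn_integral_measurable_subprob_algebra[OF assms]] .

text \<open>Stated for arbitrary \<open>f\<close>, so that it applies directly to the inner integral
  over actions in \<open>AE_absorbed\<close>.\<close>

lemma nn_integral_Q_\<Delta>:
  assumes z: "z \<in> space SA" "fst z \<in> \<Delta>" and f: "\<And>x. x \<in> \<Delta> \<Longrightarrow> f x = 0"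
  shows "(\<integral>\<^sup>+y. f y \<partial>Q z) = 0"
proof -
  interpret prob_space "Q z" by (rule Q_prob[OF z(1)])
  have "emeasure (Q z) \<Delta> = 1" using z Q_\<Delta>[of "fst z" "snd z"] by (auto simp: space_pair_measure)
  then have "AE y in Q z. y \<in> \<Delta>"
    by (intro AE_prob_1) (simp add: measure_def)
  then have "(\<integral>\<^sup>+y. f y \<partial>Q z) = (\<integral>\<^sup>+y. 0 \<partial>Q z)"
    by (intro nn_integral_cong_AE) (auto simp: f)
  then show ?thesis by simp
qed

lemma AE_absorbed:
  assumes \<pi>: "kernels \<pi>"
  shows "AE \<omega> in path_law \<pi>. \<forall>t. fst (\<omega> t) \<in> \<Delta> \<longrightarrow> fst (\<omega> (Suc t)) \<in> \<Delta>"
  unfolding AE_all_countable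
proof
  fix t
  let ?P = "path_law \<pi>"
  note [measurable_cong] = strat_sets[OF \<pi>] fdd_sets[OF \<pi>]
  have [measurable]: "(\<lambda>\<omega>. \<omega> t) \<in> measurable (OM (Suc (Suc t))) SA"
    "(\<lambda>\<omega>. \<omega> (Suc t)) \<in> measurable (OM (Suc (Suc t))) SA"
    "(\<lambda>\<omega>. \<omega> t) \<in> measurable (OM (Suc t)) SA"
    "(\<lambda>\<omega>. \<omega> s) \<in> measurable OI SA" for s
    by (intro measurable_component_singleton; simp)+
  define F :: "(nat \<Rightarrow> 'x \<times> 'a) \<Rightarrow> ennreal" where "F \<omega> = indicator \<Delta> (fst (\<omega> t)) * indicator Dc (fst (\<omega> (Suc t)))" for \<omega>
  have F[measurable]: "F \<in> borel_measurable (OM (Suc (Suc t)))" unfolding F_def by measurable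
  have "(\<integral>\<^sup>+\<omega>. F \<omega> \<partial>?P) = (\<integral>\<^sup>+\<omega>. F (restrict \<omega> {..<Suc (Suc t)}) \<partial>?P)"
    by (simp add: F_def)
  also have "\<dots> = (\<integral>\<^sup>+\<omega>. F \<omega> \<partial>hist_law \<pi> (Suc (Suc t)))"
    by (rule nn_integral_strat_fdd[OF \<pi> F])
  also have "\<dots> = (\<integral>\<^sup>+\<omega>. \<integral>\<^sup>+x. \<integral>\<^sup>+a. F (fun_upd \<omega> (Suc t) (x, a)) \<partial>\<pi> (Suc t) (\<omega>, x) \<partial>next_state (Suc t) \<omega> \<partial>hist_law \<pi> (Suc t))"
    unfolding nn_integral_fdd_Suc[where n="Suc t", OF \<pi> F] ..
  also have "\<dots> = (\<integral>\<^sup>+\<omega>. 0 \<partial>hist_law \<pi> (Suc t))"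
  proof (rule nn_integral_cong)
    fix \<omega> assume "\<omega> \<in> space (hist_law \<pi> (Suc t))"
    then have w: "\<omega> t \<in> space SA" using measurable_space[OF component_meas[OF \<pi>]] by blast
    show "(\<integral>\<^sup>+x. \<integral>\<^sup>+a. F (fun_upd \<omega> (Suc t) (x, a)) \<partial>\<pi> (Suc t) (\<omega>, x) \<partial>next_state (Suc t) \<omega>) = 0"
    proof (cases "fst (\<omega> t) \<in> \<Delta>")
      case True
      show ?thesis
        using nn_integral_Q_\<Delta>[OF w True, of "\<lambda>x. \<integral>\<^sup>+a. F (fun_upd \<omega> (Suc t) (x, a)) \<partial>\<pi> (Suc t) (\<omega>, x)"]
        by (simp add: F_def next_state_def)
    qed (simp add: F_def)
  qed
  finally have "(\<integral>\<^sup>+\<omega>. F \<omega> \<partial>?P) = 0" by simp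
  moreover have "F \<in> borel_measurable ?P" unfolding F_def by measurable
  ultimately have "AE \<omega> in ?P. F \<omega> = 0" by (simp add: nn_integral_0_iff_AE)
  moreover have "AE \<omega> in ?P. \<omega> (Suc t) \<in> space SA"
    by (rule AE_I2) (auto simp: sets_eq_imp_space_eq[OF strat_sets[OF \<pi>]] space_PiM)
  ultimately show "AE \<omega> in ?P. fst (\<omega> t) \<in> \<Delta> \<longrightarrow> fst (\<omega> (Suc t)) \<in> \<Delta>"
    by eventually_elim (auto simp: F_def space_pair_measure indicator_def split: if_splits)
qed

text \<open>The event \<open>t < T\<close> concerns the whole path up to \<open>t\<close>;
  absorption reduces it to the state at time \<open>t\<close>, and thereby reduces absorption times
  and occupation measures to laws at single times.\<close>

lemma AE_less_T:
  assumes \<pi>: "kernels \<pi>"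
  shows "AE \<omega> in path_law \<pi>. \<forall>t. enat t < T_Delta \<Delta> \<omega> \<longleftrightarrow> fst (\<omega> t) \<in> Dc"
proof -
  have "AE \<omega> in path_law \<pi>. \<forall>t. \<omega> t \<in> space SA"
    by (rule AE_I2) (auto simp: sets_eq_imp_space_eq[OF strat_sets[OF \<pi>]] space_PiM)
  with AE_absorbed[OF \<pi>] show ?thesis
  proof eventually_elim
    case (elim \<omega>)
    have mono: "fst (\<omega> s) \<in> \<Delta> \<Longrightarrow> fst (\<omega> (s + k)) \<in> \<Delta>" for s k
      by (induction k) (use elim(1) in auto)
    have "fst (\<omega> s) \<in> \<Delta> \<Longrightarrow> s \<le> t \<Longrightarrow> fst (\<omega> t) \<in> \<Delta>" for s t
      using mono[of s "t - s"] by simp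
    moreover have "fst (\<omega> t) \<in> space MX" for t using elim(2) by (auto simp: space_pair_measure mem_Times_iff)
    ultimately show ?case by (auto simp: less_T_Delta_iff)
  qed
qed

text \<open>The probability of not being absorbed by time \<open>t\<close>, written through the
  state law so that it can be moved between policies with the same law;
  \<open>emeasure_less_T\<close> gives the link to \<open>T_Delta\<close>.\<close>

definition alive where "alive \<pi> t = (\<integral>\<^sup>+x. indicator Dc x \<partial>state_law \<pi> t)"

lemma pred_less_T[measurable]: "Measurable.pred OI (\<lambda>\<omega>. enat t < T_Delta \<Delta> \<omega>)"
proof -
  have [measurable]: "(\<lambda>\<omega>. \<omega> s) \<in> measurable OI SA" for s
    by (intro measurable_component_singleton) simp
  show ?thesis unfolding less_T_Delta_iff by measurable
qed

lemma nn_integral_less_T: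
  assumes \<pi>: "kernels \<pi>" and F[measurable]: "F \<in> borel_measurable SA"
  shows "(\<integral>\<^sup>+\<omega>. indicator {\<omega>. enat t < T_Delta \<Delta> \<omega>} \<omega> * F (\<omega> t) \<partial>path_law \<pi>)
    = (\<integral>\<^sup>+z. indicator Dc (fst z) * F z \<partial>pair_law \<pi> t)"
proof -
  have "(\<integral>\<^sup>+\<omega>. indicator {\<omega>. enat t < T_Delta \<Delta> \<omega>} \<omega> * F (\<omega> t) \<partial>path_law \<pi>)
    = (\<integral>\<^sup>+\<omega>. indicator Dc (fst (\<omega> t)) * F (\<omega> t) \<partial>path_law \<pi>)"
  proof (rule nn_integral_cong_AE)
    show "AE \<omega> in path_law \<pi>. indicator {\<omega>. enat t < T_Delta \<Delta> \<omega>} \<omega> * F (\<omega> t) =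
        indicator Dc (fst (\<omega> t)) * F (\<omega> t)"
      using AE_less_T[OF \<pi>] by eventually_elim (simp add: indicator_def)
  qed
  also have "\<dots> = (\<integral>\<^sup>+z. indicator Dc (fst z) * F z \<partial>pair_law \<pi> t)"
    by (rule nn_integral_strat_pair_law[OF \<pi>]) measurable
  finally show ?thesis .
qed

lemma emeasure_less_T:
  assumes \<pi>: "kernels \<pi>"
  shows "emeasure (path_law \<pi>) {\<omega>\<in>space (Omega MX MA). enat t < T_Delta \<Delta> \<omega>} = alive \<pi> t"
proof -
  note [measurable_cong] = strat_sets[OF \<pi>]
  have sp: "space (Omega MX MA) = space (path_law \<pi>)"
    by (simp add: Omega_def XA_def sets_eq_imp_space_eq[OF strat_sets[OF \<pi>]])
  have m: "{\<omega>\<in>space (Omega MX MA). enat t < T_Delta \<Delta> \<omega>} \<in> sets (path_law \<pi>)"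
    unfolding sp by measurable
  have "emeasure (path_law \<pi>) {\<omega>\<in>space (Omega MX MA). enat t < T_Delta \<Delta> \<omega>}
    = (\<integral>\<^sup>+\<omega>. indicator {\<omega>. enat t < T_Delta \<Delta> \<omega>} \<omega> * 1 \<partial>path_law \<pi>)"
    unfolding nn_integral_indicator[OF m, symmetric]
    by (intro nn_integral_cong) (auto simp: sp indicator_def)
  also have "\<dots> = (\<integral>\<^sup>+z. indicator Dc (fst z) \<partial>pair_law \<pi> t)"
    using nn_integral_less_T[OF \<pi>, of "\<lambda>_. 1" t] by simp
  also have "\<dots> = alive \<pi> t"
    unfolding alive_def by (rule nn_integral_pair_law_state[OF \<pi>]) measurable
  finally show ?thesis .
qed

lemma nn_integral_T:
  assumes \<pi>: "kernels \<pi>"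
  shows "(\<integral>\<^sup>+\<omega>. ennreal_of_enat (T_Delta \<Delta> \<omega>) \<partial>path_law \<pi>) = (\<Sum>t. alive \<pi> t)"
proof -
  note [measurable_cong] = strat_sets[OF \<pi>]
  have "(\<integral>\<^sup>+\<omega>. ennreal_of_enat (T_Delta \<Delta> \<omega>) \<partial>path_law \<pi>)
    = (\<integral>\<^sup>+\<omega>. (\<Sum>t. indicator {\<omega>\<in>space (Omega MX MA). enat t < T_Delta \<Delta> \<omega>} \<omega>) \<partial>path_law \<pi>)"
    unfolding ennreal_of_enat_eq_suminf
    by (intro nn_integral_cong suminf_cong)
       (auto simp: indicator_def Omega_def XA_def sets_eq_imp_space_eq[OF strat_sets[OF \<pi>]])
  also have "\<dots> = (\<Sum>t. \<integral>\<^sup>+\<omega>. indicator {\<omega>\<in>space (Omega MX MA). enat t < T_Delta \<Delta> \<omega>} \<omega> \<partial>path_law \<pi>)"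
    by (rule nn_integral_suminf) (simp add: Omega_def XA_def)
  also have "\<dots> = (\<Sum>t. alive \<pi> t)"
    unfolding emeasure_less_T[OF \<pi>, symmetric]
    by (intro suminf_cong nn_integral_indicator) (simp add: Omega_def XA_def)
  finally show ?thesis .
qed

lemma occ_sets[simp, measurable_cong]: "sets (occ_measure \<pi>) = sets SA"
  unfolding occ_def by (simp add: XA_def sets.space_closed)

text \<open>The set function in \<open>occ\<close> is shown to be a measure by exhibiting it as one:
  the image under \<open>(t, \<omega>) \<mapsto> \<omega> t\<close> of counting measure times path
  law, with the indicator of \<open>t < T\<close> as density. The formula is then Fubini for this
  product.\<close>

lemma nn_integral_occ:
  assumes \<pi>: "kernels \<pi>" and F[measurable]: "F \<in> borel_measurable SA"
  shows "(\<integral>\<^sup>+z. F z \<partial>occ_measure \<pi>) = (\<Sum>t. \<integral>\<^sup>+z. indicator Dc (fst z) * F z \<partial>pair_law \<pi> t)"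
proof -
  let ?P = "path_law \<pi>"
  let ?C = "count_space (UNIV :: nat set)"
  interpret P: prob_space ?P by (rule strat_prob_space[OF \<pi>])
  note [measurable_cong] = strat_sets[OF \<pi>]
  have [measurable]: "(\<lambda>\<omega>. \<omega> s) \<in> measurable OI SA" for s
    by (intro measurable_component_singleton) simp
  define L where "L p = (indicator {\<omega>. enat (fst p) < T_Delta \<Delta> \<omega>} (snd p) :: ennreal)" for p :: "nat \<times> (nat \<Rightarrow> 'x \<times> 'a)"
  have L[measurable]: "L \<in> borel_measurable (?C \<Otimes>\<^sub>M ?P)"
    unfolding L_def by (rule measurable_pair_measure_countable1) (simp_all, measurable)
  have ev[measurable]: "(\<lambda>p. snd p (fst p)) \<in> measurable (?C \<Otimes>\<^sub>M ?P) SA"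
    by (rule measurable_pair_measure_countable1) (simp_all, measurable)
  define N where "N = distr (density (?C \<Otimes>\<^sub>M ?P) L) SA (\<lambda>p. snd p (fst p))"
  have N: "(\<integral>\<^sup>+z. F z \<partial>N) = (\<integral>\<^sup>+\<omega>. (\<Sum>t. indicator {\<omega>. enat t < T_Delta \<Delta> \<omega>} \<omega> * F (\<omega> t)) \<partial>?P)"
    "(\<integral>\<^sup>+z. F z \<partial>N) = (\<Sum>t. \<integral>\<^sup>+z. indicator Dc (fst z) * F z \<partial>pair_law \<pi> t)"
    if F[measurable]: "F \<in> borel_measurable SA" for F
  proof -
    have "(\<integral>\<^sup>+z. F z \<partial>N) = (\<integral>\<^sup>+p. L p * F (snd p (fst p)) \<partial>(?C \<Otimes>\<^sub>M ?P))"
      unfolding N_def by (subst nn_integral_distr, simp, simp, subst nn_integral_density) auto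
    also have "\<dots> = (\<integral>\<^sup>+t. \<integral>\<^sup>+\<omega>. L (t, \<omega>) * F (\<omega> t) \<partial>?P \<partial>?C)"
      by (subst P.nn_integral_fst[symmetric]) simp_all
    also have "\<dots> = (\<Sum>t. \<integral>\<^sup>+\<omega>. indicator {\<omega>. enat t < T_Delta \<Delta> \<omega>} \<omega> * F (\<omega> t) \<partial>?P)"
      by (simp add: nn_integral_count_space_nat L_def)
    finally have eq: "(\<integral>\<^sup>+z. F z \<partial>N) = (\<Sum>t. \<integral>\<^sup>+\<omega>. indicator {\<omega>. enat t < T_Delta \<Delta> \<omega>} \<omega> * F (\<omega> t) \<partial>?P)" .
    then show "(\<integral>\<^sup>+z. F z \<partial>N) = (\<integral>\<^sup>+\<omega>. (\<Sum>t. indicator {\<omega>. enat t < T_Delta \<Delta> \<omega>} \<omega> * F (\<omega> t)) \<partial>?P)"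
      by (subst nn_integral_suminf) simp_all
    show "(\<integral>\<^sup>+z. F z \<partial>N) = (\<Sum>t. \<integral>\<^sup>+z. indicator Dc (fst z) * F z \<partial>pair_law \<pi> t)"
      unfolding eq by (intro suminf_cong nn_integral_less_T[OF \<pi> F])
  qed
  have sN: "sets N = sets SA" "space N = space SA" by (simp_all add: N_def)
  have "occ_measure \<pi> = measure_of (space N) (sets N) (emeasure N)"
    unfolding occ_def XA_def sN
  proof (rule measure_of_eq)
    fix \<Gamma> assume "\<Gamma> \<in> sigma_sets (space SA) (sets SA)"
    then have \<Gamma>: "\<Gamma> \<in> sets SA" by (simp add: sets.sigma_sets_eq)
    have "emeasure N \<Gamma> = (\<integral>\<^sup>+z. indicator \<Gamma> z \<partial>N)" using \<Gamma> by (simp add: sN)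
    also have "\<dots> = (\<integral>\<^sup>+\<omega>. (\<Sum>t. indicator {\<omega>. enat t < T_Delta \<Delta> \<omega>} \<omega> * indicator \<Gamma> (\<omega> t)) \<partial>?P)"
      using \<Gamma> by (intro N(1) borel_measurable_indicator)
    finally show "(\<integral>\<^sup>+\<omega>. (\<Sum>t. indicator {\<omega>. enat t < T_Delta \<Delta> \<omega>} \<omega> * indicator \<Gamma> (\<omega> t)) \<partial>?P) = emeasure N \<Gamma>" ..
  qed (rule sets.space_closed)
  also have "\<dots> = N" by (rule measure_of_of_measure)
  finally show ?thesis using N(2)[OF F] by simp
qed

end


section \<open>Value functions of stationary kernels\<close>

lemma ennreal_suminf_split_head:
  fixes f :: "nat \<Rightarrow> ennreal"
  shows "(\<Sum>k. f k) = f 0 + (\<Sum>k. f (Suc k))"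
  using sums_unique[OF sums_Suc[OF summable_sums[OF summableI, of "\<lambda>k. f (Suc k)"]]] by (simp add: add.commute)

lemma enn2real_sums:
  fixes f :: "nat \<Rightarrow> ennreal"
  assumes "(\<Sum>n. f n) < \<infinity>"
  shows "(\<lambda>n. enn2real (f n)) sums enn2real (\<Sum>n. f n)"
proof -
  have e: "ennreal (enn2real (f n)) = f n" for n
    using ennreal_suminf_lessD[OF assms, of n] by (simp add: less_top)
  have "(\<lambda>n. ennreal (enn2real (f n))) sums ennreal (enn2real (\<Sum>n. f n))"
    unfolding e using assms summable_sums[OF summableI, of f] by (simp add: less_top)
  then show ?thesis by (subst (asm) sums_ennreal) auto
qed

lemma ennreal_suminf_tendsto_0:
  fixes f :: "nat \<Rightarrow> ennreal"
  assumes "(\<Sum>n. f n) < \<infinity>"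
  shows "f \<longlonglongrightarrow> 0"
proof -
  have e: "ennreal (enn2real (f n)) = f n" for n
    using ennreal_suminf_lessD[OF assms, of n] by (simp add: less_top)
  have "(\<lambda>n. enn2real (f n)) \<longlonglongrightarrow> 0"
    by (rule summable_LIMSEQ_zero[OF sums_summable[OF enn2real_sums[OF assms]]])
  from tendsto_ennrealI[OF this] show ?thesis by (simp add: e)
qed

context absorbing_mdp
begin

text \<open>The one-step transition operator of the chain driven by \<open>\<kappa>\<close>; its
  \<open>k\<close>-th iterate at \<open>x\<close> is the mean of \<open>f\<close> at the
  \<open>k\<close>-th state of the chain started in \<open>x\<close>.\<close>

definition Top where "Top \<kappa> f x = (\<integral>\<^sup>+a. \<integral>\<^sup>+y. f y \<partial>Q (x, a) \<partial>\<kappa> x)"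

text \<open>The potential of \<open>f\<close>: its expected total along the chain, possibly
  infinite. Iterates of \<open>Top\<close> replace a family of path laws indexed by the starting
  state. For \<open>indicator Dc\<close> it is the expected absorption time.\<close>

definition Val where "Val \<kappa> f x = (\<Sum>k. (Top \<kappa> ^^ k) f x)"

lemma kernel_integral_meas:
  assumes \<kappa>: "\<kappa> \<in> measurable MX (prob_algebra MA)" and F: "F \<in> borel_measurable SA"
  shows "(\<lambda>x. \<integral>\<^sup>+a. F (x, a) \<partial>\<kappa> x) \<in> borel_measurable MX"
  using measurable_prob_algebraD[OF \<kappa>] by (rule nn_integral_measurable_subprob_algebra2[rotated]) (simp add: F)

lemma Top_meas:
  assumes "\<kappa> \<in> measurable MX (prob_algebra MA)" "f \<in> borel_measurable MX"
  shows "Top \<kappa> f \<in> borel_measurable MX"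
  unfolding Top_def by (rule kernel_integral_meas[OF assms(1) nn_integral_Q_meas[OF assms(2)]])

lemma Top_iter_meas:
  assumes "\<kappa> \<in> measurable MX (prob_algebra MA)" "f \<in> borel_measurable MX"
  shows "(Top \<kappa> ^^ k) f \<in> borel_measurable MX"
  by (induction k) (auto intro: Top_meas assms)

lemma Val_meas:
  assumes "\<kappa> \<in> measurable MX (prob_algebra MA)" "f \<in> borel_measurable MX"
  shows "Val \<kappa> f \<in> borel_measurable MX"
  unfolding Val_def using Top_iter_meas[OF assms] by measurable

context
  fixes \<kappa> assumes \<kappa>: "\<kappa> \<in> measurable MX (prob_algebra MA)"
begin

lemma kernel_space: "x \<in> space MX \<Longrightarrow> space (\<kappa> x) = space MA" "x \<in> space MX \<Longrightarrow> sets (\<kappa> x) = sets MA"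
  "x \<in> space MX \<Longrightarrow> prob_space (\<kappa> x)"
  using measurable_space[OF \<kappa>] by (auto simp: space_prob_algebra dest: sets_eq_imp_space_eq)

lemma Q_section_meas:
  assumes x: "x \<in> space MX" and f: "f \<in> borel_measurable MX"
  shows "(\<lambda>a. \<integral>\<^sup>+y. f y \<partial>Q (x, a)) \<in> borel_measurable (\<kappa> x)"
  unfolding measurable_cong_sets[OF kernel_space(2)[OF x] refl]
  by (rule measurable_compose[OF measurable_Pair1'[OF x] nn_integral_Q_meas[OF f]])

lemma Top_mono:
  assumes le: "\<And>y. y \<in> space MX \<Longrightarrow> f y \<le> g y" and x: "x \<in> space MX"
  shows "Top \<kappa> f x \<le> Top \<kappa> g x"
  unfolding Top_def using kernel_space(1)[OF x] x
  by (intro nn_integral_mono le) (auto simp: space_pair_measure sets_eq_imp_space_eq[OF Q_sets])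

lemma Top_cmult:
  assumes f: "f \<in> borel_measurable MX" and x: "x \<in> space MX"
  shows "Top \<kappa> (\<lambda>y. c * f y) x = c * Top \<kappa> f x"
proof -
  have "Top \<kappa> (\<lambda>y. c * f y) x = (\<integral>\<^sup>+a. c * (\<integral>\<^sup>+y. f y \<partial>Q (x, a)) \<partial>\<kappa> x)"
    unfolding Top_def
  proof (intro nn_integral_cong nn_integral_cmult)
    fix a assume "a \<in> space (\<kappa> x)"
    then have "sets (Q (x, a)) = sets MX" using x kernel_space(1)[OF x] by (intro Q_sets) (auto simp: space_pair_measure)
    then show "f \<in> borel_measurable (Q (x, a))" using f by (simp cong: measurable_cong_sets)
  qed
  also have "\<dots> = c * Top \<kappa> f x" unfolding Top_def by (rule nn_integral_cmult[OF Q_section_meas[OF x f]])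
  finally show ?thesis .
qed

lemma Top_suminf:
  assumes f: "\<And>k. f k \<in> borel_measurable MX" and x: "x \<in> space MX"
  shows "Top \<kappa> (\<lambda>y. \<Sum>k. f k y) x = (\<Sum>k. Top \<kappa> (f k) x)"
proof -
  have "Top \<kappa> (\<lambda>y. \<Sum>k. f k y) x = (\<integral>\<^sup>+a. (\<Sum>k. \<integral>\<^sup>+y. f k y \<partial>Q (x, a)) \<partial>\<kappa> x)"
    unfolding Top_def
  proof (intro nn_integral_cong nn_integral_suminf)
    fix a k assume "a \<in> space (\<kappa> x)"
    then have "sets (Q (x, a)) = sets MX" using x kernel_space(1)[OF x] by (intro Q_sets) (auto simp: space_pair_measure)
    then show "f k \<in> borel_measurable (Q (x, a))" using f by (simp cong: measurable_cong_sets)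
  qed
  also have "\<dots> = (\<Sum>k. Top \<kappa> (f k) x)" unfolding Top_def by (rule nn_integral_suminf[OF Q_section_meas[OF x f]])
  finally show ?thesis .
qed

lemma Top_vanishes:
  assumes f: "\<And>x. x \<in> \<Delta> \<Longrightarrow> f x = 0" and x: "x \<in> \<Delta>"
  shows "Top \<kappa> f x = 0"
proof -
  have xs: "x \<in> space MX" using sets.sets_into_space[OF \<Delta>] x by auto
  have "Top \<kappa> f x = (\<integral>\<^sup>+a. 0 \<partial>\<kappa> x)"
    unfolding Top_def using x xs kernel_space(1)[OF xs]
    by (intro nn_integral_cong nn_integral_Q_\<Delta> f) (auto simp: space_pair_measure)
  then show ?thesis by simp
qed

lemma Top_iter_vanishes:
  assumes f: "\<And>x. x \<in> \<Delta> \<Longrightarrow> f x = 0" and x: "x \<in> \<Delta>"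
  shows "(Top \<kappa> ^^ k) f x = 0"
  using x by (induction k arbitrary: x) (auto intro: f Top_vanishes)

lemma Top_iter_mono:
  assumes le: "\<And>y. y \<in> space MX \<Longrightarrow> f y \<le> g y" and x: "x \<in> space MX"
  shows "(Top \<kappa> ^^ k) f x \<le> (Top \<kappa> ^^ k) g x"
  using x by (induction k arbitrary: x) (auto intro: le Top_mono)

lemma Top_iter_cmult:
  assumes f: "f \<in> borel_measurable MX" and x: "x \<in> space MX"
  shows "(Top \<kappa> ^^ k) (\<lambda>y. c * f y) x = c * (Top \<kappa> ^^ k) f x"
  using x
proof (induction k arbitrary: x)
  case (Suc k)
  have "Top \<kappa> ((Top \<kappa> ^^ k) (\<lambda>y. c * f y)) x = Top \<kappa> (\<lambda>y. c * (Top \<kappa> ^^ k) f y) x"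
    using Suc by (intro antisym Top_mono) auto
  also have "\<dots> = c * Top \<kappa> ((Top \<kappa> ^^ k) f) x"
    by (rule Top_cmult[OF Top_iter_meas[OF \<kappa> f] Suc.prems])
  finally show ?case by simp
qed simp

lemma Top_iter_le_1:
  assumes "\<And>y. y \<in> space MX \<Longrightarrow> f y \<le> 1" and x: "x \<in> space MX"
  shows "(Top \<kappa> ^^ k) f x \<le> 1"
  using x
proof (induction k arbitrary: x)
  case (Suc k)
  have "Top \<kappa> ((Top \<kappa> ^^ k) f) x \<le> Top \<kappa> (\<lambda>_. 1) x"
    using Suc by (intro Top_mono) auto
  also have "\<dots> = (\<integral>\<^sup>+a. 1 \<partial>\<kappa> x)"
    unfolding Top_def
  proof (rule nn_integral_cong)
    fix a assume "a \<in> space (\<kappa> x)"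
    then have "prob_space (Q (x, a))" using Suc.prems kernel_space(1) by (intro Q_prob) (auto simp: space_pair_measure)
    then show "(\<integral>\<^sup>+y. 1 \<partial>Q (x, a)) = 1" by (simp add: prob_space.emeasure_space_1)
  qed
  also have "\<dots> = 1" using kernel_space(3)[OF Suc.prems] by (simp add: prob_space.emeasure_space_1)
  finally show ?case by simp
qed (auto intro: assms)

lemma Val_unfold:
  assumes f: "f \<in> borel_measurable MX" and x: "x \<in> space MX"
  shows "Val \<kappa> f x = f x + Top \<kappa> (Val \<kappa> f) x"
proof -
  have "Top \<kappa> (Val \<kappa> f) x = (\<Sum>k. (Top \<kappa> ^^ Suc k) f x)"
    using Top_suminf[OF Top_iter_meas[OF \<kappa> f] x] by (simp add: Val_def[abs_def])
  then show ?thesis unfolding Val_def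
    by (subst ennreal_suminf_split_head) simp
qed

text \<open>With \<open>g = indicator Dc\<close> this bounds the value of a reward that vanishes on
  \<Delta> and is at most \<open>c\<close> by \<open>c\<close> times the expected absorption
  time.\<close>

lemma Val_le_cmult:
  assumes le: "\<And>y. y \<in> space MX \<Longrightarrow> f y \<le> c * g y" and g: "g \<in> borel_measurable MX" and x: "x \<in> space MX"
  shows "Val \<kappa> f x \<le> c * Val \<kappa> g x"
proof -
  have "Val \<kappa> f x \<le> (\<Sum>k. c * (Top \<kappa> ^^ k) g x)"
    unfolding Val_def Top_iter_cmult[OF g x, symmetric]
    by (intro suminf_le Top_iter_mono le x) auto
  then show ?thesis by (simp add: Val_def)
qed

text \<open>The Markov property at time \<open>n\<close> in integrated form.\<close>

lemma nn_integral_state_law_iter: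
  assumes \<pi>: "kernels \<pi>" and stat: "\<And>m h. n \<le> m \<Longrightarrow> \<pi> m h = \<kappa> (snd h)" and f: "f \<in> borel_measurable MX"
  shows "(\<integral>\<^sup>+x. f x \<partial>state_law \<pi> (n + k)) = (\<integral>\<^sup>+x. (Top \<kappa> ^^ k) f x \<partial>state_law \<pi> n)"
  using f
proof (induction k arbitrary: f)
  case (Suc k)
  have "(\<integral>\<^sup>+x. f x \<partial>state_law \<pi> (n + Suc k)) = (\<integral>\<^sup>+z. \<integral>\<^sup>+y. f y \<partial>Q z \<partial>pair_law \<pi> (n + k))"
    using nn_integral_state_law_Suc[OF \<pi> Suc.prems] by simp
  also have "\<dots> = (\<integral>\<^sup>+x. Top \<kappa> f x \<partial>state_law \<pi> (n + k))"
    unfolding Top_def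
    by (rule nn_integral_pair_law_markov[OF \<pi> nn_integral_Q_meas[OF Suc.prems] \<kappa>]) (rule stat, simp)
  also have "\<dots> = (\<integral>\<^sup>+x. (Top \<kappa> ^^ k) (Top \<kappa> f) x \<partial>state_law \<pi> n)"
    by (rule Suc.IH[OF Top_meas[OF \<kappa> Suc.prems]])
  finally show ?case by (simp add: funpow_swap1)
qed simp

definition switch :: "(nat \<Rightarrow> (nat \<Rightarrow> 'x \<times> 'a) \<times> 'x \<Rightarrow> 'a measure) \<Rightarrow> nat \<Rightarrow> nat \<Rightarrow> (nat \<Rightarrow> 'x \<times> 'a) \<times> 'x \<Rightarrow> 'a measure"
  where "switch \<pi> n m = (if m < n then \<pi> m else (\<lambda>h. \<kappa> (snd h)))"

lemma kernels_switch: "kernels \<pi> \<Longrightarrow> kernels (switch \<pi> n)"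
  unfolding kernels_def switch_def Hist_def by (auto intro: measurable_compose[OF measurable_snd \<kappa>])

text \<open>The mean remaining time under \<open>\<kappa>\<close>, averaged over the state at time
  \<open>n\<close>, is the tail from \<open>n\<close> on of the survival probabilities of a single
  process, because the switch does not affect the law at time \<open>n\<close>. Tails of this form
  are what the uniform condition controls.\<close>

lemma nn_integral_Val_alive:
  assumes \<pi>: "kernels \<pi>"
  shows "(\<integral>\<^sup>+x. Val \<kappa> (indicator Dc) x \<partial>state_law \<pi> n) = (\<Sum>k. alive (switch \<pi> n) (n + k))"
proof -
  note [measurable_cong] = state_law_sets[OF \<pi>]
  have eq: "state_law (switch \<pi> n) n = state_law \<pi> n"
    by (rule state_law_cong) (simp add: switch_def)
  have f[measurable]: "indicator Dc \<in> borel_measurable MX" by measurable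
  have "(\<integral>\<^sup>+x. Val \<kappa> (indicator Dc) x \<partial>state_law \<pi> n) = (\<Sum>k. \<integral>\<^sup>+x. (Top \<kappa> ^^ k) (indicator Dc) x \<partial>state_law \<pi> n)"
    unfolding Val_def using Top_iter_meas[OF \<kappa> f] by (intro nn_integral_suminf) measurable
  also have "\<dots> = (\<Sum>k. alive (switch \<pi> n) (n + k))"
    unfolding alive_def eq[symmetric]
    by (intro suminf_cong nn_integral_state_law_iter[symmetric] kernels_switch \<pi> f) (simp add: switch_def)
  finally show ?thesis .
qed

end

text \<open>Since the state marginal of an occupation measure solves the characteristic equation, the only possible
  defect is a part that the kernel never absorbs; it vanishes because almost every state is absorbed in
  finite mean time.\<close>
lemma nn_integral_marginal_eq_Val:
  assumes \<kappa>: "\<kappa> \<in> measurable MX (prob_algebra MA)" and \<pi>: "kernels \<pi>"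
    and disint: "\<And>F. F \<in> borel_measurable SA \<Longrightarrow>
      (\<integral>\<^sup>+z. F z \<partial>occ_measure \<pi>) = (\<integral>\<^sup>+x. \<integral>\<^sup>+a. F (x, a) \<partial>\<kappa> x \<partial>distr (occ_measure \<pi>) MX fst)"
    and fin: "(\<Sum>t. alive \<pi> t) < \<infinity>"
    and Val_fin: "\<And>n. (\<integral>\<^sup>+x. Val \<kappa> (indicator Dc) x \<partial>state_law \<pi> n) < \<infinity>"
    and f[measurable]: "f \<in> borel_measurable MX" and f_le: "\<And>x. x \<in> space MX \<Longrightarrow> f x \<le> ennreal C * indicator Dc x"
  shows "(\<integral>\<^sup>+x. f x \<partial>distr (occ_measure \<pi>) MX fst) = (\<integral>\<^sup>+x. Val \<kappa> f x \<partial>\<eta>)"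
proof -
  let ?V = "distr (occ_measure \<pi>) MX fst"
  note [measurable_cong] = state_law_sets[OF \<pi>]
  have \<eta>s[measurable_cong]: "sets \<eta> = sets MX" using \<eta> by (simp add: space_prob_algebra)
  have Dcm[measurable]: "(indicator Dc :: 'x \<Rightarrow> ennreal) \<in> borel_measurable MX" by measurable
  have V: "(\<integral>\<^sup>+x. g x \<partial>?V) = (\<Sum>t. \<integral>\<^sup>+x. indicator Dc x * g x \<partial>state_law \<pi> t)"
    if [measurable]: "g \<in> borel_measurable MX" for g
  proof -
    have "(\<integral>\<^sup>+x. g x \<partial>?V) = (\<integral>\<^sup>+z. g (fst z) \<partial>occ_measure \<pi>)"
      by (rule nn_integral_distr) measurable
    also have "\<dots> = (\<Sum>t. \<integral>\<^sup>+z. indicator Dc (fst z) * g (fst z) \<partial>pair_law \<pi> t)"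
      by (rule nn_integral_occ[OF \<pi>]) measurable
    also have "\<dots> = (\<Sum>t. \<integral>\<^sup>+x. indicator Dc x * g x \<partial>state_law \<pi> t)"
      by (intro suminf_cong nn_integral_pair_law_state[OF \<pi>, of "\<lambda>x. indicator Dc x * g x"]) measurable
    finally show ?thesis .
  qed
  have V_van: "(\<integral>\<^sup>+x. g x \<partial>?V) = (\<Sum>t. \<integral>\<^sup>+x. g x \<partial>state_law \<pi> t)"
    if g: "g \<in> borel_measurable MX" "\<And>x. x \<in> \<Delta> \<Longrightarrow> g x = 0" for g
    unfolding V[OF g(1)] using g(2)
    by (intro suminf_cong nn_integral_cong)
       (auto simp: indicator_def sets_eq_imp_space_eq[OF state_law_sets[OF \<pi>]])
  \<comment> \<open>The characteristic equation of the marginal, tested with functions that vanish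
    on \<Delta>: a visit is either the initial state or follows a transition from an earlier
    visit.\<close>
  have char: "(\<integral>\<^sup>+x. g x \<partial>?V) = (\<integral>\<^sup>+x. g x \<partial>\<eta>) + (\<integral>\<^sup>+x. Top \<kappa> g x \<partial>?V)"
    if g[measurable]: "g \<in> borel_measurable MX" and g0: "\<And>x. x \<in> \<Delta> \<Longrightarrow> g x = 0" for g
  proof -
    have "(\<integral>\<^sup>+x. g x \<partial>?V) = (\<Sum>t. \<integral>\<^sup>+x. g x \<partial>state_law \<pi> t)" by (rule V_van[OF g g0])
    also have "\<dots> = (\<integral>\<^sup>+x. g x \<partial>\<eta>) + (\<Sum>t. \<integral>\<^sup>+x. g x \<partial>state_law \<pi> (Suc t))"
      by (subst ennreal_suminf_split_head) (simp add: nn_integral_state_law_0[OF \<pi> g])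
    also have "(\<Sum>t. \<integral>\<^sup>+x. g x \<partial>state_law \<pi> (Suc t)) = (\<Sum>t. \<integral>\<^sup>+z. indicator Dc (fst z) * (\<integral>\<^sup>+y. g y \<partial>Q z) \<partial>pair_law \<pi> t)"
    proof (intro suminf_cong)
      fix t
      have sp: "space (pair_law \<pi> t) = space SA" by (rule sets_eq_imp_space_eq) simp
      show "(\<integral>\<^sup>+x. g x \<partial>state_law \<pi> (Suc t)) = (\<integral>\<^sup>+z. indicator Dc (fst z) * (\<integral>\<^sup>+y. g y \<partial>Q z) \<partial>pair_law \<pi> t)"
        unfolding nn_integral_state_law_Suc[OF \<pi> g]
      proof (rule nn_integral_cong)
        fix z assume z: "z \<in> space (pair_law \<pi> t)"
        show "(\<integral>\<^sup>+y. g y \<partial>Q z) = indicator Dc (fst z) * (\<integral>\<^sup>+y. g y \<partial>Q z)"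
        proof (cases "fst z \<in> \<Delta>")
          case True then show ?thesis using nn_integral_Q_\<Delta>[of z g] z g0 sp by simp
        next
          case False then show ?thesis using z sp by (auto simp: space_pair_measure)
        qed
      qed
    qed
    also have "\<dots> = (\<integral>\<^sup>+z. \<integral>\<^sup>+y. g y \<partial>Q z \<partial>occ_measure \<pi>)"
      by (rule nn_integral_occ[symmetric, OF \<pi> nn_integral_Q_meas[OF g]])
    also have "\<dots> = (\<integral>\<^sup>+x. Top \<kappa> g x \<partial>?V)"
      unfolding Top_def by (rule disint[OF nn_integral_Q_meas[OF g]])
    finally show ?thesis .
  qed
  have f0: "f x = 0" if "x \<in> \<Delta>" for x
    using f_le[of x] that sets.sets_into_space[OF \<Delta>] by auto
  \<comment> \<open>Iteration leaves the integral of \<open>(Top \<kappa> ^^ n) f\<close> over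
    \<open>?V\<close> as remainder; the rest of the proof shows that it tends to 0.\<close>
  have iter: "(\<integral>\<^sup>+x. f x \<partial>?V) = (\<Sum>k<n. \<integral>\<^sup>+x. (Top \<kappa> ^^ k) f x \<partial>\<eta>) + (\<integral>\<^sup>+x. (Top \<kappa> ^^ n) f x \<partial>?V)" for n
  proof (induction n)
    case (Suc n)
    have "(\<integral>\<^sup>+x. (Top \<kappa> ^^ n) f x \<partial>?V) = (\<integral>\<^sup>+x. (Top \<kappa> ^^ n) f x \<partial>\<eta>) + (\<integral>\<^sup>+x. (Top \<kappa> ^^ Suc n) f x \<partial>?V)"
      using char[OF Top_iter_meas[OF \<kappa> f] Top_iter_vanishes[OF \<kappa> f0]] by simp
    with Suc show ?case by (simp add: add.assoc)
  qed simp
  have Vfin: "(\<integral>\<^sup>+x. 1 \<partial>?V) < \<infinity>"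
  proof -
    have "(\<integral>\<^sup>+x. 1 \<partial>?V) = (\<Sum>t. alive \<pi> t)" by (subst V) (simp_all add: alive_def[abs_def])
    then show ?thesis using fin by simp
  qed
  have w[measurable]: "Val \<kappa> (indicator Dc) \<in> borel_measurable MX" by (rule Val_meas[OF \<kappa> Dcm])
  \<comment> \<open>\<open>?V\<close> is a sum of state laws restricted to \<open>Dc\<close>, and
    each of them charges only states of finite expected absorption time.\<close>
  have "AE x in ?V. Val \<kappa> (indicator Dc) x < \<infinity>"
  proof -
    have "(\<integral>\<^sup>+x. indicator {x\<in>space MX. Val \<kappa> (indicator Dc) x = \<infinity>} x \<partial>?V) = (\<Sum>t. 0)"
    proof (subst V; (intro suminf_cong)?)
      fix t
      have "AE x in state_law \<pi> t. Val \<kappa> (indicator Dc) x \<noteq> \<infinity>"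
        by (rule nn_integral_PInf_AE) (use Val_fin[of t] in auto)
      then have "AE x in state_law \<pi> t. indicator Dc x * indicator {x\<in>space MX. Val \<kappa> (indicator Dc) x = \<infinity>} x = (0::ennreal)"
        by eventually_elim simp
      then show "(\<integral>\<^sup>+x. indicator Dc x * indicator {x\<in>space MX. Val \<kappa> (indicator Dc) x = \<infinity>} x \<partial>state_law \<pi> t) = 0"
        by (subst nn_integral_0_iff_AE) auto
    qed measurable
    moreover have "(\<Sum>t::nat. 0 :: ennreal) = 0" by simp
    ultimately have "(\<integral>\<^sup>+x. indicator {x\<in>space MX. Val \<kappa> (indicator Dc) x = \<infinity>} x \<partial>?V) = 0" by (rule trans)
    then have "AE x in ?V. indicator {x\<in>space MX. Val \<kappa> (indicator Dc) x = \<infinity>} x = (0::ennreal)"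
      by (rule nn_integral_0_iff_AE[THEN iffD1, rotated]) measurable
    moreover have "AE x in ?V. x \<in> space MX" by (rule AE_I2) simp
    ultimately show ?thesis by eventually_elim (auto simp: less_top indicator_def split: if_splits)
  qed
  then have tail: "AE x in ?V. (\<lambda>n. (Top \<kappa> ^^ n) f x) \<longlonglongrightarrow> 0"
  proof (rule AE_mp, intro AE_I2 impI)
    fix x assume "x \<in> space ?V" and wx: "Val \<kappa> (indicator Dc) x < \<infinity>"
    then have x: "x \<in> space MX" by simp
    have "Val \<kappa> f x \<le> ennreal C * Val \<kappa> (indicator Dc) x"
      by (rule Val_le_cmult[OF \<kappa> f_le Dcm x])
    also have "\<dots> < \<infinity>" using wx by (simp add: ennreal_mult_less_top)
    finally have "(\<Sum>n. (Top \<kappa> ^^ n) f x) < \<infinity>" by (simp add: Val_def)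
    then show "(\<lambda>n. (Top \<kappa> ^^ n) f x) \<longlonglongrightarrow> 0" by (rule ennreal_suminf_tendsto_0)
  qed
  \<comment> \<open>A constant can dominate because \<open>?V\<close> has finite mass, namely the
    expected absorption time of \<open>\<pi>\<close>.\<close>
  have "(\<lambda>n. \<integral>\<^sup>+x. (Top \<kappa> ^^ n) f x \<partial>?V) \<longlonglongrightarrow> (\<integral>\<^sup>+x. 0 \<partial>?V)"
  proof (rule nn_integral_dominated_convergence[where w="\<lambda>_. ennreal C"])
    show "(Top \<kappa> ^^ n) f \<in> borel_measurable ?V" for n using Top_iter_meas[OF \<kappa> f] by simp
    show "(\<integral>\<^sup>+x. ennreal C \<partial>?V) < \<infinity>" using Vfin by (simp add: ennreal_mult_less_top)
    show "AE x in ?V. (Top \<kappa> ^^ n) f x \<le> ennreal C" for n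
    proof (rule AE_I2)
      fix x assume "x \<in> space ?V"
      then have x: "x \<in> space MX" by simp
      have "(Top \<kappa> ^^ n) f x \<le> (Top \<kappa> ^^ n) (\<lambda>x. ennreal C * indicator Dc x) x"
        by (rule Top_iter_mono[OF \<kappa> f_le x])
      also have "\<dots> = ennreal C * (Top \<kappa> ^^ n) (indicator Dc) x" by (rule Top_iter_cmult[OF \<kappa> Dcm x])
      also have "\<dots> \<le> ennreal C * 1"
        by (intro mult_left_mono Top_iter_le_1[OF \<kappa> _ x]) (auto simp: indicator_def)
      finally show "(Top \<kappa> ^^ n) f x \<le> ennreal C" by simp
    qed
  qed (use tail in auto)
  moreover have "(\<lambda>n. \<Sum>k<n. \<integral>\<^sup>+x. (Top \<kappa> ^^ k) f x \<partial>\<eta>) \<longlonglongrightarrow> (\<Sum>k. \<integral>\<^sup>+x. (Top \<kappa> ^^ k) f x \<partial>\<eta>)"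
    by (rule summable_LIMSEQ) simp
  ultimately have "(\<lambda>n. (\<Sum>k<n. \<integral>\<^sup>+x. (Top \<kappa> ^^ k) f x \<partial>\<eta>) + (\<integral>\<^sup>+x. (Top \<kappa> ^^ n) f x \<partial>?V))
    \<longlonglongrightarrow> (\<Sum>k. \<integral>\<^sup>+x. (Top \<kappa> ^^ k) f x \<partial>\<eta>) + 0"
    by (intro tendsto_add) simp_all
  then have "(\<lambda>n::nat. \<integral>\<^sup>+x. f x \<partial>?V) \<longlonglongrightarrow> (\<Sum>k. \<integral>\<^sup>+x. (Top \<kappa> ^^ k) f x \<partial>\<eta>)"
    unfolding iter[symmetric] by simp
  then have "(\<integral>\<^sup>+x. f x \<partial>?V) = (\<Sum>k. \<integral>\<^sup>+x. (Top \<kappa> ^^ k) f x \<partial>\<eta>)"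
    by (rule LIMSEQ_unique[OF tendsto_const])
  also have "\<dots> = (\<integral>\<^sup>+x. Val \<kappa> f x \<partial>\<eta>)"
    unfolding Val_def using Top_iter_meas[OF \<kappa> f] \<eta>s
    by (intro nn_integral_suminf[symmetric]) (simp cong: measurable_cong_sets)
  finally show ?thesis .
qed

text \<open>Telescoping along \<open>\<gamma>\<close>: the hypothesis \<open>eq\<close> is the evaluation equation of the signed value
  \<open>Hp - Hm\<close> with all negative terms moved to the other side.\<close>
lemma verification:
  assumes \<gamma>: "\<gamma> \<in> measurable MX (prob_algebra MA)" and \<pi>: "kernels \<pi>" and stat: "\<And>n h. \<pi> n h = \<gamma> (snd h)"
    and [measurable]: "Hp \<in> borel_measurable MX" "Hm \<in> borel_measurable MX"
    and cp[measurable]: "cp \<in> borel_measurable SA" and cm[measurable]: "cm \<in> borel_measurable SA"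
    and w[measurable]: "w \<in> borel_measurable MX"
    and w_fin: "\<And>n. (\<integral>\<^sup>+x. w x \<partial>state_law \<pi> n) < \<infinity>" and w_lim: "(\<lambda>n. \<integral>\<^sup>+x. w x \<partial>state_law \<pi> n) \<longlonglongrightarrow> 0"
    and H_le: "\<And>x. x \<in> space MX \<Longrightarrow> Hp x \<le> ennreal C * w x" "\<And>x. x \<in> space MX \<Longrightarrow> Hm x \<le> ennreal C * w x"
    and c_le: "\<And>z. z \<in> space SA \<Longrightarrow> cp z \<le> ennreal C * indicator Dc (fst z)"
      "\<And>z. z \<in> space SA \<Longrightarrow> cm z \<le> ennreal C * indicator Dc (fst z)"
    and fin: "(\<Sum>t. alive \<pi> t) < \<infinity>"
    and eq: "\<And>x. x \<in> space MX \<Longrightarrow> w x < \<infinity> \<Longrightarrow>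
      Hp x + (\<integral>\<^sup>+a. cm (x, a) + (\<integral>\<^sup>+y. Hm y \<partial>Q (x, a)) \<partial>\<gamma> x) =
      Hm x + (\<integral>\<^sup>+a. cp (x, a) + (\<integral>\<^sup>+y. Hp y \<partial>Q (x, a)) \<partial>\<gamma> x)"
  shows "enn2real (\<integral>\<^sup>+x. Hp x \<partial>\<eta>) - enn2real (\<integral>\<^sup>+x. Hm x \<partial>\<eta>) =
    enn2real (\<integral>\<^sup>+z. cp z \<partial>occ_measure \<pi>) - enn2real (\<integral>\<^sup>+z. cm z \<partial>occ_measure \<pi>)"
proof -
  note [measurable_cong] = state_law_sets[OF \<pi>]
  have sp: "space (state_law \<pi> n) = space MX" for n by (rule sets_eq_imp_space_eq[OF state_law_sets[OF \<pi>]])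
  have spp: "space (pair_law \<pi> n) = space SA" for n by (rule sets_eq_imp_space_eq) simp
  \<comment> \<open>\<open>p\<close> and \<open>q\<close> average the two parts of the value
    function at time \<open>n\<close>; \<open>a\<close> and \<open>b\<close> average the two parts
    of the reward collected then.\<close>
  define p where "p n = (\<integral>\<^sup>+x. Hp x \<partial>state_law \<pi> n)" for n
  define q where "q n = (\<integral>\<^sup>+x. Hm x \<partial>state_law \<pi> n)" for n
  define a where "a n = (\<integral>\<^sup>+z. cp z \<partial>pair_law \<pi> n)" for n
  define b where "b n = (\<integral>\<^sup>+z. cm z \<partial>pair_law \<pi> n)" for n
  have g: "(\<integral>\<^sup>+x. \<integral>\<^sup>+a. c (x, a) + (\<integral>\<^sup>+y. H y \<partial>Q (x, a)) \<partial>\<gamma> x \<partial>state_law \<pi> n)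
      = (\<integral>\<^sup>+z. c z \<partial>pair_law \<pi> n) + (\<integral>\<^sup>+x. H x \<partial>state_law \<pi> (Suc n))"
    if [measurable]: "c \<in> borel_measurable SA" "H \<in> borel_measurable MX" for c H n
  proof -
    note [measurable] = nn_integral_Q_meas[OF that(2)]
    have "(\<integral>\<^sup>+x. \<integral>\<^sup>+a. c (x, a) + (\<integral>\<^sup>+y. H y \<partial>Q (x, a)) \<partial>\<gamma> x \<partial>state_law \<pi> n)
      = (\<integral>\<^sup>+z. c z + (\<integral>\<^sup>+y. H y \<partial>Q z) \<partial>pair_law \<pi> n)"
      by (rule nn_integral_pair_law_markov[symmetric, OF \<pi> _ \<gamma> stat, of "\<lambda>z. c z + (\<integral>\<^sup>+y. H y \<partial>Q z)"]) measurable
    also have "\<dots> = (\<integral>\<^sup>+z. c z \<partial>pair_law \<pi> n) + (\<integral>\<^sup>+z. \<integral>\<^sup>+y. H y \<partial>Q z \<partial>pair_law \<pi> n)"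
      by (rule nn_integral_add) measurable
    finally show ?thesis by (simp add: nn_integral_state_law_Suc[OF \<pi> that(2)])
  qed
  \<comment> \<open>The evaluation equation is available only where \<open>w\<close> is finite,
    which is almost everywhere for the state law at time \<open>n\<close>.\<close>
  have step: "p n + (b n + q (Suc n)) = q n + (a n + p (Suc n))" for n
  proof -
    let ?gm = "\<lambda>x. \<integral>\<^sup>+a. cm (x, a) + (\<integral>\<^sup>+y. Hm y \<partial>Q (x, a)) \<partial>\<gamma> x"
    let ?gp = "\<lambda>x. \<integral>\<^sup>+a. cp (x, a) + (\<integral>\<^sup>+y. Hp y \<partial>Q (x, a)) \<partial>\<gamma> x"
    have gm: "(\<lambda>z. cm z + (\<integral>\<^sup>+y. Hm y \<partial>Q z)) \<in> borel_measurable SA"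
      "(\<lambda>z. cp z + (\<integral>\<^sup>+y. Hp y \<partial>Q z)) \<in> borel_measurable SA"
      by (intro borel_measurable_add nn_integral_Q_meas; measurable)+
    note [measurable] = kernel_integral_meas[OF \<gamma> gm(1)] kernel_integral_meas[OF \<gamma> gm(2)]
    have "AE x in state_law \<pi> n. w x \<noteq> \<infinity>"
      by (rule nn_integral_PInf_AE) (use w_fin[of n] in auto)
    then have "AE x in state_law \<pi> n. Hp x + ?gm x = Hm x + ?gp x"
      by (rule AE_mp, intro AE_I2) (auto simp: sp less_top intro!: eq)
    then have "(\<integral>\<^sup>+x. Hp x + ?gm x \<partial>state_law \<pi> n) = (\<integral>\<^sup>+x. Hm x + ?gp x \<partial>state_law \<pi> n)"
      by (rule nn_integral_cong_AE)
    then have "(\<integral>\<^sup>+x. Hp x \<partial>state_law \<pi> n) + (\<integral>\<^sup>+x. ?gm x \<partial>state_law \<pi> n)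
        = (\<integral>\<^sup>+x. Hm x \<partial>state_law \<pi> n) + (\<integral>\<^sup>+x. ?gp x \<partial>state_law \<pi> n)"
      by (subst (asm) (1 2) nn_integral_add) auto
    then show ?thesis by (simp add: g p_def q_def a_def b_def)
  qed
  have H_bd: "(\<integral>\<^sup>+x. H x \<partial>state_law \<pi> n) \<le> ennreal C * (\<integral>\<^sup>+x. w x \<partial>state_law \<pi> n)"
    if "\<And>x. x \<in> space MX \<Longrightarrow> H x \<le> ennreal C * w x" for H n
  proof -
    have "(\<integral>\<^sup>+x. H x \<partial>state_law \<pi> n) \<le> (\<integral>\<^sup>+x. ennreal C * w x \<partial>state_law \<pi> n)"
      using that by (intro nn_integral_mono) (simp add: sp)
    then show ?thesis by (subst (asm) nn_integral_cmult) auto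
  qed
  have Cw: "ennreal C * (\<integral>\<^sup>+x. w x \<partial>state_law \<pi> n) < \<infinity>" for n
    using w_fin[of n] by (simp add: ennreal_mult_less_top)
  have pq_fin: "p n < \<infinity>" "q n < \<infinity>" for n
    unfolding p_def q_def using H_bd[OF H_le(1), of n] H_bd[OF H_le(2), of n] Cw[of n] by (auto intro: le_less_trans)
  have Cw_lim: "(\<lambda>n. ennreal C * (\<integral>\<^sup>+x. w x \<partial>state_law \<pi> n)) \<longlonglongrightarrow> 0"
    using ennreal_tendsto_cmult[OF _ w_lim, of "ennreal C"] by simp
  have lim0: "p \<longlonglongrightarrow> 0" "q \<longlonglongrightarrow> 0"
    unfolding p_def q_def
    by (rule tendsto_sandwich[OF _ _ tendsto_const Cw_lim]; auto intro!: always_eventually H_bd H_le)+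
  have c_bd: "(\<integral>\<^sup>+z. c z \<partial>pair_law \<pi> n) \<le> ennreal C * alive \<pi> n"
    if c: "\<And>z. z \<in> space SA \<Longrightarrow> c z \<le> ennreal C * indicator Dc (fst z)" for c n
  proof -
    have "(\<integral>\<^sup>+z. c z \<partial>pair_law \<pi> n) \<le> (\<integral>\<^sup>+z. ennreal C * indicator Dc (fst z) \<partial>pair_law \<pi> n)"
      using c by (intro nn_integral_mono) (simp add: spp)
    also have "\<dots> = (\<integral>\<^sup>+x. ennreal C * indicator Dc x \<partial>state_law \<pi> n)"
      by (rule nn_integral_pair_law_state[OF \<pi>, of "\<lambda>x. ennreal C * indicator Dc x"]) measurable
    also have "\<dots> = ennreal C * alive \<pi> n"
      unfolding alive_def by (rule nn_integral_cmult) measurable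
    finally show ?thesis .
  qed
  have sum_fin: "(\<Sum>n. \<integral>\<^sup>+z. c z \<partial>pair_law \<pi> n) < \<infinity>"
    if c: "\<And>z. z \<in> space SA \<Longrightarrow> c z \<le> ennreal C * indicator Dc (fst z)" for c
  proof -
    have "(\<Sum>n. \<integral>\<^sup>+z. c z \<partial>pair_law \<pi> n) \<le> (\<Sum>n. ennreal C * alive \<pi> n)"
      by (intro suminf_le c_bd c) auto
    also have "\<dots> < \<infinity>" using fin by (simp add: ennreal_mult_less_top)
    finally show ?thesis .
  qed
  have ab_fin: "(\<Sum>n. a n) < \<infinity>" "(\<Sum>n. b n) < \<infinity>"
    unfolding a_def b_def using sum_fin[OF c_le(1)] sum_fin[OF c_le(2)] by auto
  have ab_n: "a n < \<infinity>" "b n < \<infinity>" for n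
    using ab_fin ennreal_suminf_lessD[of a \<infinity> n] ennreal_suminf_lessD[of b \<infinity> n] by auto
  \<comment> \<open>All four sequences being finite, the step equation passes to the reals and
    telescopes; the limit of \<open>w\<close> removes the boundary term.\<close>
  define P where "P n = enn2real (p n) - enn2real (q n)" for n
  have step': "P n - P (Suc n) = enn2real (a n) - enn2real (b n)" for n
  proof -
    have "enn2real (p n + (b n + q (Suc n))) = enn2real (q n + (a n + p (Suc n)))" using step by simp
    then show ?thesis
      using pq_fin ab_n unfolding P_def by (simp add: enn2real_plus)
  qed
  have "P \<longlonglongrightarrow> 0 - 0"
    unfolding P_def by (intro tendsto_diff tendsto_enn2real) (simp_all add: lim0)
  then have "(\<lambda>n. P n - P (Suc n)) sums (P 0 - 0)"
    by (intro telescope_sums') simp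
  moreover have "(\<lambda>n. P n - P (Suc n)) sums (enn2real (\<Sum>n. a n) - enn2real (\<Sum>n. b n))"
    unfolding step' by (intro sums_diff enn2real_sums ab_fin)
  ultimately have "P 0 = enn2real (\<Sum>n. a n) - enn2real (\<Sum>n. b n)"
    using sums_unique2 by fastforce
  moreover have "(\<integral>\<^sup>+z. c z \<partial>occ_measure \<pi>) = (\<Sum>n. \<integral>\<^sup>+z. c z \<partial>pair_law \<pi> n)"
    if c: "c \<in> borel_measurable SA" "\<And>z. z \<in> space SA \<Longrightarrow> c z \<le> ennreal C * indicator Dc (fst z)" for c
    unfolding nn_integral_occ[OF \<pi> c(1)]
  proof (intro suminf_cong nn_integral_cong)
    fix n z assume "z \<in> space (pair_law \<pi> n)"
    then have "z \<in> space SA" by (simp add: spp)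
    then show "indicator Dc (fst z) * c z = c z" using c(2)[of z] by (auto simp: indicator_def split: if_splits)
  qed
  ultimately show ?thesis
    using c_le by (simp add: P_def p_def q_def a_def b_def nn_integral_state_law_0[OF \<pi>])
qed

end


section \<open>Chattering kernels and the main theorem\<close>

lemma nn_integral_finite_diff:
  assumes [measurable]: "p \<in> borel_measurable M" "q \<in> borel_measurable M"
    and p: "(\<integral>\<^sup>+x. p x \<partial>M) < \<infinity>" and q: "(\<integral>\<^sup>+x. q x \<partial>M) < \<infinity>"
  shows "integrable M (\<lambda>x. enn2real (p x) - enn2real (q x))"
    "(LINT x|M. enn2real (p x) - enn2real (q x)) = enn2real (\<integral>\<^sup>+x. p x \<partial>M) - enn2real (\<integral>\<^sup>+x. q x \<partial>M)"
proof -
  have *: "integrable M (\<lambda>x. enn2real (f x)) \<and> (LINT x|M. enn2real (f x)) = enn2real (\<integral>\<^sup>+x. f x \<partial>M)"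
    if [measurable]: "f \<in> borel_measurable M" and f: "(\<integral>\<^sup>+x. f x \<partial>M) < \<infinity>" for f
  proof -
    have "AE x in M. f x \<noteq> \<infinity>" by (rule nn_integral_PInf_AE) (use f in auto)
    then have eq: "(\<integral>\<^sup>+x. ennreal (enn2real (f x)) \<partial>M) = (\<integral>\<^sup>+x. f x \<partial>M)"
      by (intro nn_integral_cong_AE) (auto simp: less_top)
    have "integrable M (\<lambda>x. enn2real (f x))"
      by (rule integrableI_nonneg) (use f eq in auto)
    moreover have "(LINT x|M. enn2real (f x)) = enn2real (\<integral>\<^sup>+x. f x \<partial>M)"
      unfolding eq[symmetric] by (rule integral_eq_nn_integral) auto
    ultimately show ?thesis by simp
  qed
  show "integrable M (\<lambda>x. enn2real (p x) - enn2real (q x))"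
    "(LINT x|M. enn2real (p x) - enn2real (q x)) = enn2real (\<integral>\<^sup>+x. p x \<partial>M) - enn2real (\<integral>\<^sup>+x. q x \<partial>M)"
    using *[of p] *[of q] p q by auto
qed

text \<open>Turns a vector into a finite sum of scalar multiples of fixed vectors, which reduces
  measurability and integration to the scalar case.\<close>

lemma vec_lambda_eq_sum_axis: "(\<chi> i. f i) = (\<Sum>i\<in>UNIV. f i *\<^sub>R axis i (1::real))"
  by (simp add: vec_eq_iff axis_def if_distrib[where f="\<lambda>c. _ * c"] cong: if_cong)

lemma borel_measurable_vec_lambda:
  fixes f :: "'d::finite \<Rightarrow> 'x \<Rightarrow> real"
  assumes [measurable]: "\<And>i. f i \<in> borel_measurable M"
  shows "(\<lambda>x. \<chi> i. f i x) \<in> borel_measurable M"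
  unfolding vec_lambda_eq_sum_axis by measurable

lemma integral_vec_lambda:
  fixes f :: "'d::finite \<Rightarrow> 'x \<Rightarrow> real"
  assumes "\<And>i. integrable M (f i)"
  shows "integrable M (\<lambda>x. \<chi> i. f i x)" "(LINT x|M. (\<chi> i. f i x)) = (\<chi> i. LINT x|M. f i x)"
  unfolding vec_lambda_eq_sum_axis using assms
  by (auto intro!: Bochner_Integration.integrable_sum simp: Bochner_Integration.integral_sum)

text \<open>A \<open>measure_of\<close> term has the intended values only if they form a measure;
  here they do, as the law of \<open>\<phi> i x\<close> when index \<open>i\<close> carries mass
  \<open>\<beta> i x\<close>.\<close>

lemma chat_kernel_eq_distr:
  assumes \<phi>: "\<And>i. i < p \<Longrightarrow> \<phi> i x \<in> space MA"
  shows "chat_kernel MA p \<beta> \<phi> x = distr (density (count_space {..<p}) (\<lambda>i. ennreal (\<beta> i x))) MA (\<lambda>i. \<phi> i x)"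
proof -
  let ?N = "distr (density (count_space {..<p}) (\<lambda>i. ennreal (\<beta> i x))) MA (\<lambda>i. \<phi> i x)"
  have m: "(\<lambda>i. \<phi> i x) \<in> measurable (density (count_space {..<p}) (\<lambda>i. ennreal (\<beta> i x))) MA"
    using \<phi> by auto
  have "chat_kernel MA p \<beta> \<phi> x = measure_of (space ?N) (sets ?N) (emeasure ?N)"
    unfolding chat_kernel_def space_distr sets_distr
  proof (rule measure_of_eq[OF sets.space_closed])
    fix B assume "B \<in> sigma_sets (space MA) (sets MA)"
    then have B: "B \<in> sets MA" by (simp add: sets.sigma_sets_eq)
    have "emeasure ?N B = (\<integral>\<^sup>+z. indicator B z \<partial>?N)" using B by simp
    also have "\<dots> = (\<integral>\<^sup>+i. ennreal (\<beta> i x) * indicator B (\<phi> i x) \<partial>count_space {..<p})"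
      using B by (subst nn_integral_distr[OF m], simp) (simp add: nn_integral_density)
    also have "\<dots> = (\<Sum>i<p. ennreal (\<beta> i x) * indicator B (\<phi> i x))"
      by (simp add: nn_integral_count_space_finite)
    finally show "(\<Sum>i<p. ennreal (\<beta> i x) * indicator B (\<phi> i x)) = emeasure ?N B" ..
  qed
  then show ?thesis by (simp only: measure_of_of_measure)
qed

lemma nn_integral_chat_kernel:
  assumes \<phi>: "\<And>i. i < p \<Longrightarrow> \<phi> i x \<in> space MA" and F: "F \<in> borel_measurable MA"
  shows "(\<integral>\<^sup>+a. F a \<partial>chat_kernel MA p \<beta> \<phi> x) = (\<Sum>i<p. ennreal (\<beta> i x) * F (\<phi> i x))"
proof -
  have m: "(\<lambda>i. \<phi> i x) \<in> measurable (density (count_space {..<p}) (\<lambda>i. ennreal (\<beta> i x))) MA"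
    using \<phi> by auto
  have eq: "chat_kernel MA p \<beta> \<phi> x = distr (density (count_space {..<p}) (\<lambda>i. ennreal (\<beta> i x))) MA (\<lambda>i. \<phi> i x)"
    by (rule chat_kernel_eq_distr) (rule \<phi>)
  show ?thesis unfolding eq
    by (subst nn_integral_distr[OF m], simp add: F) (simp add: nn_integral_density nn_integral_count_space_finite)
qed

lemma chat_kernel_measurable:
  assumes \<phi>: "\<And>i. i < p \<Longrightarrow> \<phi> i \<in> measurable MX MA" and \<beta>: "\<And>i. i < p \<Longrightarrow> \<beta> i \<in> borel_measurable MX"
    and nn: "\<And>x i. x \<in> space MX \<Longrightarrow> i < p \<Longrightarrow> 0 \<le> \<beta> i x" and sum1: "\<And>x. x \<in> space MX \<Longrightarrow> (\<Sum>i<p. \<beta> i x) = 1"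
  shows "chat_kernel MA p \<beta> \<phi> \<in> measurable MX (prob_algebra MA)"
proof -
  have sp: "\<phi> i x \<in> space MA" if "i < p" "x \<in> space MX" for i x using measurable_space[OF \<phi>] that by auto
  have s: "sets (chat_kernel MA p \<beta> \<phi> x) = sets MA" for x
    unfolding chat_kernel_def by (simp add: sets.space_closed)
  have e: "emeasure (chat_kernel MA p \<beta> \<phi> x) B = (\<Sum>i<p. ennreal (\<beta> i x) * indicator B (\<phi> i x))"
    if x: "x \<in> space MX" and B: "B \<in> sets MA" for x B
  proof -
    have "emeasure (chat_kernel MA p \<beta> \<phi> x) B = (\<integral>\<^sup>+a. indicator B a \<partial>chat_kernel MA p \<beta> \<phi> x)"
      using B by (simp add: s)
    also have "\<dots> = (\<Sum>i<p. ennreal (\<beta> i x) * indicator B (\<phi> i x))"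
      using x B by (intro nn_integral_chat_kernel sp) auto
    finally show ?thesis .
  qed
  have pr: "prob_space (chat_kernel MA p \<beta> \<phi> x)" if x: "x \<in> space MX" for x
  proof
    have "emeasure (chat_kernel MA p \<beta> \<phi> x) (space MA) = (\<Sum>i<p. ennreal (\<beta> i x))"
      unfolding e[OF x sets.top] using sp x by (intro sum.cong) auto
    also have "\<dots> = 1" using nn[OF x] by (subst sum_ennreal) (auto simp: sum1[OF x])
    finally show "emeasure (chat_kernel MA p \<beta> \<phi> x) (space (chat_kernel MA p \<beta> \<phi> x)) = 1"
      by (simp add: sets_eq_imp_space_eq[OF s])
  qed
  show ?thesis
  proof (rule measurable_prob_algebraI[OF pr measurable_subprob_algebra])
    fix B assume B: "B \<in> sets MA"
    have "(\<lambda>x. \<Sum>i<p. ennreal (\<beta> i x) * indicator B (\<phi> i x)) \<in> borel_measurable MX"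
    proof (rule borel_measurable_sum)
      fix i assume "i \<in> {..<p}"
      then have [measurable]: "\<phi> i \<in> measurable MX MA" "\<beta> i \<in> borel_measurable MX" using \<phi> \<beta> by auto
      show "(\<lambda>x. ennreal (\<beta> i x) * indicator B (\<phi> i x)) \<in> borel_measurable MX" using B by measurable
    qed
    then show "(\<lambda>x. emeasure (chat_kernel MA p \<beta> \<phi> x) B) \<in> borel_measurable MX"
      by (subst measurable_cong[OF e]) (use B in auto)
  qed (simp_all add: s pr prob_space_imp_subprob_space)
qed

lemma noise_kernel:
  assumes S[measurable]: "S \<in> measurable (MX \<Otimes>\<^sub>M borel) MA"
  shows "(\<lambda>x. distr unif01 MA (\<lambda>u. S (x, u))) \<in> measurable MX (prob_algebra MA)"
    and "x \<in> space MX \<Longrightarrow> F \<in> borel_measurable MA \<Longrightarrow>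
      (\<integral>\<^sup>+a. F a \<partial>distr unif01 MA (\<lambda>u. S (x, u))) = (\<integral>\<^sup>+u. F (S (x, u)) \<partial>unif01)"
proof -
  show "(\<lambda>x. distr unif01 MA (\<lambda>u. S (x, u))) \<in> measurable MX (prob_algebra MA)"
  proof (rule measurable_distr_prob_space2[where M=borel])
    show "(\<lambda>x. unif01) \<in> measurable MX (prob_algebra borel)"
      by (rule measurable_const) (simp add: space_prob_algebra prob_space_unif01)
  qed (simp add: split_beta')
  assume x: "x \<in> space MX" and F: "F \<in> borel_measurable MA"
  have "(\<lambda>u. S (x, u)) \<in> measurable borel MA" by (rule measurable_compose[OF measurable_Pair1'[OF x] S])
  then have "(\<lambda>u. S (x, u)) \<in> measurable unif01 MA" by (simp cong: measurable_cong_sets)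
  then show "(\<integral>\<^sup>+a. F a \<partial>distr unif01 MA (\<lambda>u. S (x, u))) = (\<integral>\<^sup>+u. F (S (x, u)) \<partial>unif01)"
    by (rule nn_integral_distr) (simp add: F)
qed

lemma suminf_shift_le:
  fixes f :: "nat \<Rightarrow> ennreal"
  shows "(\<Sum>k. f (n + k)) \<le> (\<Sum>k. f k)"
proof (rule suminf_le_const[OF summableI])
  fix m
  have "(\<Sum>k<m. f (n + k)) = sum f ((+) n ` {..<m})" by (simp add: sum.reindex)
  also have "\<dots> \<le> (\<Sum>k. f k)" by (rule sum_le_suminf) auto
  finally show "(\<Sum>k<m. f (n + k)) \<le> (\<Sum>k. f k)" .
qed

section \<open>Occupation measures of admissible policies\<close>

context absorbing_mdp
begin

lemma is_policy_kernels: "is_policy MX MA Aadm \<pi> \<Longrightarrow> kernels \<pi>"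
  by (simp add: is_policy_def kernels_def)

text \<open>Each decision is almost surely admissible, so every pair law is null outside
  \<open>K\<close>. This allows a disintegration to be altered at inadmissible actions without
  changing integrals.\<close>

lemma occ_inadmissible:
  assumes pol: "is_policy MX MA Aadm \<pi>" and A: "\<And>x. x \<in> space MX \<Longrightarrow> Aadm x \<in> sets MA"
    and K: "K \<in> sets SA" "\<And>x a. x \<in> space MX \<Longrightarrow> a \<in> Aadm x \<Longrightarrow> (x, a) \<in> K"
  shows "(\<integral>\<^sup>+z. indicator (space SA - K) z \<partial>occ_measure \<pi>) = 0"
proof -
  note \<pi> = is_policy_kernels[OF pol]
  let ?F = "indicator (space SA - K) :: _ \<Rightarrow> ennreal"
  have F: "?F \<in> borel_measurable SA" using K(1) by (intro borel_measurable_indicator) auto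
  have "(\<integral>\<^sup>+z. ?F z \<partial>pair_law \<pi> t) = 0" for t
  proof -
    have "(\<integral>\<^sup>+z. ?F z \<partial>pair_law \<pi> t) = (\<integral>\<^sup>+\<omega>. \<integral>\<^sup>+x. 0 \<partial>next_state t \<omega> \<partial>hist_law \<pi> t)"
      unfolding nn_integral_pair_law[OF \<pi> F]
    proof (intro nn_integral_cong)
      fix \<omega> x assume "\<omega> \<in> space (hist_law \<pi> t)" and x: "x \<in> space (next_state t \<omega>)"
      then have w: "\<omega> \<in> space (OM t)" by (simp add: sets_eq_imp_space_eq[OF fdd_sets[OF \<pi>]])
      have xs: "x \<in> space MX" using x measurable_space[OF next_state_meas w]
        by (auto simp: space_prob_algebra dest: sets_eq_imp_space_eq)
      have h: "(\<omega>, x) \<in> space (Hist MX MA t)" using w xs by (simp add: Hist_def OM space_pair_measure)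
      have p: "sets (\<pi> t (\<omega>, x)) = sets MA" "prob_space (\<pi> t (\<omega>, x))"
        using pol h measurable_space[of "\<pi> t" "Hist MX MA t" "prob_algebra MA"] by (auto simp: is_policy_def space_prob_algebra)
      interpret prob_space "\<pi> t (\<omega>, x)" by (rule p(2))
      have "emeasure (\<pi> t (\<omega>, x)) (Aadm x) = 1" using pol h by (force simp: is_policy_def)
      then have "AE a in \<pi> t (\<omega>, x). a \<in> Aadm x"
        by (intro AE_prob_1) (simp add: measure_def)
      then have "(\<integral>\<^sup>+a. ?F (x, a) \<partial>\<pi> t (\<omega>, x)) = (\<integral>\<^sup>+a. 0 \<partial>\<pi> t (\<omega>, x))"
        by (intro nn_integral_cong_AE) (auto simp: K(2)[OF xs])
      then show "(\<integral>\<^sup>+a. ?F (x, a) \<partial>\<pi> t (\<omega>, x)) = 0" by simp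
    qed
    then show ?thesis by simp
  qed note z = this
  have "(\<integral>\<^sup>+z. indicator Dc (fst z) * ?F z \<partial>pair_law \<pi> t) = 0" for t
  proof -
    have "(\<integral>\<^sup>+z. indicator Dc (fst z) * ?F z \<partial>pair_law \<pi> t) \<le> (\<integral>\<^sup>+z. ?F z \<partial>pair_law \<pi> t)"
      by (intro nn_integral_mono) (auto simp: indicator_def)
    then show ?thesis using z[of t] by simp
  qed
  then show ?thesis unfolding nn_integral_occ[OF \<pi> F] by simp
qed

lemma emeasure_occ_space: "kernels \<pi> \<Longrightarrow> emeasure (occ_measure \<pi>) (space (occ_measure \<pi>)) = (\<Sum>t. alive \<pi> t)"
proof -
  assume \<pi>: "kernels \<pi>"
  have "emeasure (occ_measure \<pi>) (space (occ_measure \<pi>)) = (\<integral>\<^sup>+z. 1 \<partial>occ_measure \<pi>)" by simp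
  also have "\<dots> = (\<Sum>t. \<integral>\<^sup>+z. indicator Dc (fst z) \<partial>pair_law \<pi> t)"
    using nn_integral_occ[OF \<pi>, of "\<lambda>_. 1"] by simp
  also have "\<dots> = (\<Sum>t. alive \<pi> t)"
    unfolding alive_def by (intro suminf_cong nn_integral_pair_law_state[OF \<pi>]) measurable
  finally show ?thesis .
qed

text \<open>The occupation measure has the mean absorption time as total mass, so the bounded reward
  is integrable and its Bochner integral is a genuine difference of finite parts.\<close>

lemma occ_reward_nth:
  fixes r :: "'x \<times> 'a \<Rightarrow> real ^ 'd"
  assumes \<pi>: "kernels \<pi>" and fin: "(\<Sum>t. alive \<pi> t) < \<infinity>" and r[measurable]: "r \<in> borel_measurable SA"
    and C: "\<And>z. z \<in> space SA \<Longrightarrow> norm (r z) \<le> C"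
  shows "occ_reward MX MA Q \<eta> \<Delta> r \<pi> $ i = enn2real (\<integral>\<^sup>+z. ennreal (r z $ i) \<partial>occ_measure \<pi>) -
    enn2real (\<integral>\<^sup>+z. ennreal (- r z $ i) \<partial>occ_measure \<pi>)"
proof -
  interpret finite_measure "occ_measure \<pi>"
    by (rule finite_measureI) (use emeasure_occ_space[OF \<pi>] fin in auto)
  have sp: "space (occ_measure \<pi>) = space SA" by (rule sets_eq_imp_space_eq) simp
  have "integrable (occ_measure \<pi>) (\<lambda>z. r z $ i)"
  proof (rule integrable_const_bound[of _ C])
    show "AE z in occ_measure \<pi>. norm (r z $ i) \<le> C"
    proof (rule AE_I2)
      fix z assume "z \<in> space (occ_measure \<pi>)"
      then have "norm (r z) \<le> C" using C sp by simp
      with component_le_norm_cart[of "r z" i] show "norm (r z $ i) \<le> C" by simp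
    qed
    have "(\<lambda>z. r z $ i) \<in> borel_measurable SA"
      by (rule measurable_compose[OF r borel_measurable_continuous_onI]) (intro continuous_intros)
    then show "(\<lambda>z. r z $ i) \<in> borel_measurable (occ_measure \<pi>)" by measurable
  qed
  then show ?thesis unfolding occ_reward_def by (simp add: real_lebesgue_integral_def)
qed

end

theorem mainTheorem15:
  fixes MX :: "'x measure"
    and AA :: "'a::polish_space set"
    and Aadm :: "'x \<Rightarrow> 'a set"
    and Q :: "'x \<times> 'a \<Rightarrow> 'x measure"
    and \<eta> :: "'x measure"
    and r :: "'x \<times> 'a \<Rightarrow> real ^ 'd"
    and \<Delta> :: "'x set"
    and \<pi> :: "nat \<Rightarrow> (nat \<Rightarrow> 'x \<times> 'a) \<times> 'x \<Rightarrow> 'a measure"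
  assumes "AA \<in> sets borel"
    and "mdp_model MX (restrict_space borel AA) Aadm Q \<eta> r"
    and "uniformly_absorbing MX (restrict_space borel AA) Aadm Q \<eta> r \<Delta>"
    and "is_policy MX (restrict_space borel AA) Aadm \<pi>"
  shows "\<exists>\<beta> \<phi>. chattering MX (restrict_space borel AA) Aadm (CARD('d) + 1) \<beta> \<phi> \<and>
           occ_reward MX (restrict_space borel AA) Q \<eta> \<Delta> r
             (stat_policy (chat_kernel (restrict_space borel AA) (CARD('d) + 1) \<beta> \<phi>))
           = occ_reward MX (restrict_space borel AA) Q \<eta> \<Delta> r \<pi>"
proof -
  define MA where "MA = restrict_space borel AA"
  note assms' = assms(2-4)[folded MA_def]
  have A_sets: "\<And>x. x \<in> space MX \<Longrightarrow> Aadm x \<in> sets MA"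
    and Q[measurable]: "Q \<in> measurable (MX \<Otimes>\<^sub>M MA) (prob_algebra MX)"
    and \<eta>: "\<eta> \<in> space (prob_algebra MX)"
    and r[measurable]: "r \<in> borel_measurable (MX \<Otimes>\<^sub>M MA)"
    and r_bd: "bounded (r ` space (MX \<Otimes>\<^sub>M MA))"
    and K_sets: "{(x, a) \<in> space MX \<times> space MA. a \<in> Aadm x} \<in> sets (MX \<Otimes>\<^sub>M MA)"
    and ex_\<theta>: "\<exists>\<theta>\<in>measurable MX MA. \<forall>x\<in>space MX. \<theta> x \<in> Aadm x"
    using assms'(1) by (auto simp: mdp_model_def XA_def)
  have abs: "absorbing MX MA Aadm Q \<eta> r \<Delta>"
    and unif: "(\<lambda>n. SUP \<pi>\<in>{\<pi>. is_policy MX MA Aadm \<pi>}. (\<Sum>k. emeasure (strat MX MA Q \<eta> \<pi>)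
                {\<omega>\<in>space (Omega MX MA). enat (n + k) < T_Delta \<Delta> \<omega>})) \<longlonglongrightarrow> 0"
    using assms'(2) by (auto simp: uniformly_absorbing_def)
  have \<Delta>: "\<Delta> \<in> sets MX" and Q_\<Delta>: "\<And>x a. x \<in> \<Delta> \<Longrightarrow> a \<in> space MA \<Longrightarrow> emeasure (Q (x, a)) \<Delta> = 1"
    and r_\<Delta>: "\<And>x a. x \<in> \<Delta> \<Longrightarrow> a \<in> space MA \<Longrightarrow> r (x, a) = 0"
    and T_fin: "\<And>\<pi>. is_policy MX MA Aadm \<pi> \<Longrightarrow> (\<integral>\<^sup>+ \<omega>. ennreal_of_enat (T_Delta \<Delta> \<omega>) \<partial>strat MX MA Q \<eta> \<pi>) < \<infinity>"
    using abs by (auto simp: absorbing_def)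
  interpret absorbing_mdp MX MA Q \<eta> \<Delta>
    by unfold_locales (fact Q \<eta> \<Delta> Q_\<Delta>)+
  note pol = assms'(3)
  note \<pi> = is_policy_kernels[OF pol]
  have spMA: "space MA = AA" by (simp add: MA_def space_restrict_space)
  have Dcm[measurable]: "(indicator Dc :: 'x \<Rightarrow> ennreal) \<in> borel_measurable MX" by measurable
  obtain \<theta> where \<theta>[measurable]: "\<theta> \<in> measurable MX MA" and \<theta>_A: "\<And>x. x \<in> space MX \<Longrightarrow> \<theta> x \<in> Aadm x"
    using ex_\<theta> by blast
  have "sets \<eta> = sets MX" "prob_space \<eta>" using \<eta> unfolding space_prob_algebra by blast+
  \<comment> \<open>A probability measure needs a nonempty space; \<open>\<theta> x0\<close> then
    shows that there are actions at all, as \<open>randomization\<close> requires.\<close>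
  then obtain x0 where x0: "x0 \<in> space MX"
    using prob_space.not_empty sets_eq_imp_space_eq by (metis ex_in_conv)
  have "\<theta> x0 \<in> AA" using measurable_space[OF \<theta> x0] spMA by simp
  then have AA_ne: "AA \<noteq> {}" by auto
  define K where "K = {(x, a) \<in> space MX \<times> space MA. a \<in> Aadm x}"
  have K[measurable]: "K \<in> sets SA" using K_sets by (simp add: K_def)
  have A_sub: "x \<in> space MX \<Longrightarrow> Aadm x \<subseteq> space MA" for x using sets.sets_into_space[OF A_sets] by auto
  have K_iff: "(x, a) \<in> K \<longleftrightarrow> a \<in> Aadm x" if "x \<in> space MX" for x a using that A_sub[OF that] by (auto simp: K_def)

  have alive_fin: "(\<Sum>t. alive \<sigma> t) < \<infinity>" if "is_policy MX MA Aadm \<sigma>" for \<sigma>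
    using T_fin[OF that] nn_integral_T[OF is_policy_kernels[OF that]] by simp

  let ?V = "distr (occ_measure \<pi>) MX fst"
  have occ_fin: "finite_measure (occ_measure \<pi>)"
    by (rule finite_measureI) (use emeasure_occ_space[OF \<pi>] alive_fin[OF pol] in auto)
  have "\<exists>S\<in>measurable (MX \<Otimes>\<^sub>M borel) MA. \<forall>F\<in>borel_measurable SA.
      (\<integral>\<^sup>+z. F z \<partial>occ_measure \<pi>) = (\<integral>\<^sup>+x. \<integral>\<^sup>+u. F (x, S (x, u)) \<partial>unif01 \<partial>?V)"
    unfolding MA_def by (rule randomization[OF assms(1) AA_ne occ_fin[unfolded MA_def]]) (simp add: occ_sets[unfolded MA_def])
  then obtain S0 where S0[measurable]: "S0 \<in> measurable (MX \<Otimes>\<^sub>M borel) MA"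
    and S0_int: "\<And>F. F\<in>borel_measurable SA \<Longrightarrow>
      (\<integral>\<^sup>+z. F z \<partial>occ_measure \<pi>) = (\<integral>\<^sup>+x. \<integral>\<^sup>+u. F (x, S0 (x, u)) \<partial>unif01 \<partial>?V)"
    by blast
  \<comment> \<open>\<open>S0\<close> is admissible only almost surely. Falling back on
    \<open>\<theta>\<close> makes the action admissible for every state and every noise value, while
    \<open>disint\<close> shows that the integrals are unchanged.\<close>
  define S where "S z = (if (fst z, S0 z) \<in> K then S0 z else \<theta> (fst z))" for z
  have S[measurable]: "S \<in> measurable (MX \<Otimes>\<^sub>M borel) MA" unfolding S_def by measurable
  have S_A: "S (x, u) \<in> Aadm x" if "x \<in> space MX" for x u
    using \<theta>_A[OF that] K_iff[OF that] by (auto simp: S_def)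
  define \<kappa> where "\<kappa> x = distr unif01 MA (\<lambda>u. S (x, u))" for x
  have \<kappa>: "\<kappa> \<in> measurable MX (prob_algebra MA)" unfolding \<kappa>_def by (rule noise_kernel(1)[OF S])
  have \<kappa>_int: "(\<integral>\<^sup>+a. F a \<partial>\<kappa> x) = (\<integral>\<^sup>+u. F (S (x, u)) \<partial>unif01)"
    if "x \<in> space MX" "F \<in> borel_measurable MA" for x F
    unfolding \<kappa>_def by (rule noise_kernel(2)[OF S that])
  have Fsec: "(\<lambda>a. F (x, a)) \<in> borel_measurable MA" if "x \<in> space MX" "F \<in> borel_measurable SA" for x F
    by (rule measurable_compose[OF measurable_Pair1'[OF that(1)] that(2)])
  have disint: "(\<integral>\<^sup>+z. F z \<partial>occ_measure \<pi>) = (\<integral>\<^sup>+x. \<integral>\<^sup>+a. F (x, a) \<partial>\<kappa> x \<partial>?V)"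
    if F[measurable]: "F \<in> borel_measurable SA" for F
  proof -
    let ?I = "indicator (space SA - K) :: _ \<Rightarrow> ennreal"
    have I[measurable]: "?I \<in> borel_measurable SA" by measurable
    interpret U: prob_space unif01 by (rule prob_space_unif01)
    have Im: "(\<lambda>x. \<integral>\<^sup>+u. ?I (x, S0 (x, u)) \<partial>unif01) \<in> borel_measurable MX"
      by (rule U.borel_measurable_nn_integral_fst[of "\<lambda>z. ?I (fst z, S0 z)", simplified]) (simp cong: measurable_cong_sets sets_pair_measure_cong)
    have "(\<integral>\<^sup>+x. \<integral>\<^sup>+u. ?I (x, S0 (x, u)) \<partial>unif01 \<partial>?V) = 0"
      unfolding S0_int[OF I, symmetric]
      by (rule occ_inadmissible[OF pol A_sets K]) (auto simp: K_iff)
    then have "AE x in ?V. (\<integral>\<^sup>+u. ?I (x, S0 (x, u)) \<partial>unif01) = 0"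
      by (subst (asm) nn_integral_0_iff_AE) (use Im in auto)
    moreover have "AE x in ?V. x \<in> space MX" by (rule AE_I2) simp
    ultimately have "AE x in ?V. (\<integral>\<^sup>+u. F (x, S0 (x, u)) \<partial>unif01) = (\<integral>\<^sup>+u. F (x, S (x, u)) \<partial>unif01)"
    proof eventually_elim
      case (elim x)
      have s: "(\<lambda>u. S0 (x, u)) \<in> measurable borel MA" by (rule measurable_compose[OF measurable_Pair1'[OF elim(2)] S0])
      have "(\<lambda>u. ?I (x, S0 (x, u))) \<in> borel_measurable borel"
        by (rule measurable_compose[OF s Fsec[OF elim(2) I]])
      then have "AE u in unif01. ?I (x, S0 (x, u)) = 0"
        using elim(1) by (subst (asm) nn_integral_0_iff_AE) auto
      then have "AE u in unif01. S0 (x, u) = S (x, u)"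
      proof eventually_elim
        case e: (elim u)
        have "S0 (x, u) \<in> space MA" using measurable_space[OF s, of u] by simp
        then show ?case using e elim(2) by (auto simp: S_def space_pair_measure indicator_def split: if_splits)
      qed
      then show ?case by (intro nn_integral_cong_AE) auto
    qed
    then have "(\<integral>\<^sup>+z. F z \<partial>occ_measure \<pi>) = (\<integral>\<^sup>+x. \<integral>\<^sup>+u. F (x, S (x, u)) \<partial>unif01 \<partial>?V)"
      unfolding S0_int[OF F] by (rule nn_integral_cong_AE)
    also have "\<dots> = (\<integral>\<^sup>+x. \<integral>\<^sup>+a. F (x, a) \<partial>\<kappa> x \<partial>?V)"
      by (intro nn_integral_cong \<kappa>_int[symmetric] Fsec F) simp_all
    finally show ?thesis .
  qed
  have \<kappa>_A: "emeasure (\<kappa> x) (Aadm x) = 1" if x: "x \<in> space MX" for x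
  proof -
    have "emeasure (\<kappa> x) (Aadm x) = (\<integral>\<^sup>+a. indicator (Aadm x) a \<partial>\<kappa> x)"
      using A_sets[OF x] by (simp add: \<kappa>_def)
    also have "\<dots> = (\<integral>\<^sup>+u. 1 \<partial>unif01)"
      using A_sets[OF x] by (subst \<kappa>_int[OF x]) (auto simp: S_A[OF x])
    also have "\<dots> = 1" using prob_space.emeasure_space_1[OF prob_space_unif01] by simp
    finally show ?thesis .
  qed
  \<comment> \<open>Admissibility of \<open>\<kappa>\<close> at every state puts the switched
    policies into the class over which the supremum is taken.\<close>
  have switch_pol: "is_policy MX MA Aadm (switch \<kappa> \<sigma> n)" if \<sigma>: "is_policy MX MA Aadm \<sigma>" for \<sigma> n
    using \<sigma> measurable_compose[OF measurable_snd \<kappa>] \<kappa>_A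
    unfolding is_policy_def switch_def[OF \<kappa>] Hist_def by (auto simp: space_pair_measure)

  define w where "w = Val \<kappa> (indicator Dc)"
  have w[measurable]: "w \<in> borel_measurable MX" unfolding w_def by (rule Val_meas[OF \<kappa> Dcm])
  have w_fin: "(\<integral>\<^sup>+x. w x \<partial>state_law \<sigma> n) < \<infinity>" if \<sigma>: "is_policy MX MA Aadm \<sigma>" for \<sigma> n
  proof -
    have "(\<integral>\<^sup>+x. w x \<partial>state_law \<sigma> n) \<le> (\<Sum>k. alive (switch \<kappa> \<sigma> n) k)"
      unfolding w_def nn_integral_Val_alive[OF \<kappa> is_policy_kernels[OF \<sigma>]] by (rule suminf_shift_le)
    then show ?thesis using alive_fin[OF switch_pol[OF \<sigma>]] by (rule le_less_trans)
  qed
  \<comment> \<open>The switched policy changes with \<open>n\<close>, so the tail of one fixed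
    policy would not give this limit; the supremum over all policies does.\<close>
  have w_lim: "(\<lambda>n. \<integral>\<^sup>+x. w x \<partial>state_law \<sigma> n) \<longlonglongrightarrow> 0" if \<sigma>: "is_policy MX MA Aadm \<sigma>" for \<sigma>
  proof (rule tendsto_sandwich[OF _ _ tendsto_const unif])
    show "\<forall>\<^sub>F n in sequentially. (\<integral>\<^sup>+x. w x \<partial>state_law \<sigma> n) \<le>
      (SUP \<pi>\<in>{\<pi>. is_policy MX MA Aadm \<pi>}. (\<Sum>k. emeasure (path_law \<pi>)
                {\<omega>\<in>space (Omega MX MA). enat (n + k) < T_Delta \<Delta> \<omega>}))"
    proof (rule always_eventually, rule allI)
      fix n
      have "(\<integral>\<^sup>+x. w x \<partial>state_law \<sigma> n) = (\<Sum>k. emeasure (path_law (switch \<kappa> \<sigma> n))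
                {\<omega>\<in>space (Omega MX MA). enat (n + k) < T_Delta \<Delta> \<omega>})"
        unfolding w_def nn_integral_Val_alive[OF \<kappa> is_policy_kernels[OF \<sigma>]]
        by (intro suminf_cong emeasure_less_T[symmetric] is_policy_kernels[OF switch_pol[OF \<sigma>]])
      also have "\<dots> \<le> (SUP \<pi>\<in>{\<pi>. is_policy MX MA Aadm \<pi>}. (\<Sum>k. emeasure (path_law \<pi>)
                {\<omega>\<in>space (Omega MX MA). enat (n + k) < T_Delta \<Delta> \<omega>}))"
        by (rule SUP_upper) (use switch_pol[OF \<sigma>] in simp)
      finally show "(\<integral>\<^sup>+x. w x \<partial>state_law \<sigma> n) \<le> \<dots>" .
    qed
  qed simp

  obtain C where C: "\<And>z. z \<in> space SA \<Longrightarrow> norm (r z) \<le> C"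
    using r_bd unfolding bounded_iff by auto
  have r_nth[measurable]: "(\<lambda>z. r z $ i) \<in> borel_measurable SA" for i
    by (rule measurable_compose[OF r borel_measurable_continuous_onI]) (intro continuous_intros)
  \<comment> \<open>Since \<open>ennreal\<close> sends negative reals to 0, the signs
    \<open>s = 1\<close> and \<open>s = -1\<close> give the positive and negative parts of the
    \<open>i\<close>-th reward component.\<close>
  define c where "c s i z = ennreal (s * r z $ i)" for s :: real and i z
  have c[measurable]: "c s i \<in> borel_measurable SA" for s i unfolding c_def by measurable
  have c_le: "c s i z \<le> ennreal C * indicator Dc (fst z)" if s: "\<bar>s\<bar> = 1" and z: "z \<in> space SA" for s i z
  proof (cases "fst z \<in> \<Delta>")
    case True
    then show ?thesis using r_\<Delta>[of "fst z" "snd z"] z by (simp add: c_def space_pair_measure mem_Times_iff)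
  next
    case False
    have "s * r z $ i \<le> \<bar>s\<bar> * \<bar>r z $ i\<bar>" by (metis abs_ge_self abs_mult)
    also have "\<dots> \<le> norm (r z)" using s component_le_norm_cart[of "r z" i] by simp
    also have "\<dots> \<le> C" by (rule C[OF z])
    finally show ?thesis using False z by (simp add: c_def space_pair_measure mem_Times_iff ennreal_leI)
  qed
  define f where "f s i x = (\<integral>\<^sup>+a. c s i (x, a) \<partial>\<kappa> x)" for s i x
  have f[measurable]: "f s i \<in> borel_measurable MX" for s i
    unfolding f_def by (rule kernel_integral_meas[OF \<kappa> c])
  have f_le: "f s i x \<le> ennreal C * indicator Dc x" if s: "\<bar>s\<bar> = 1" and x: "x \<in> space MX" for s i x
  proof -
    have "f s i x \<le> (\<integral>\<^sup>+a. ennreal C * indicator Dc x \<partial>\<kappa> x)"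
      unfolding f_def using c_le[OF s] x kernel_space(1)[OF \<kappa> x]
      by (intro nn_integral_mono) (force simp: space_pair_measure)
    also have "\<dots> = ennreal C * indicator Dc x"
      using kernel_space(3)[OF \<kappa> x] by (simp add: prob_space.emeasure_space_1)
    finally show ?thesis .
  qed
  define H where "H s i = Val \<kappa> (f s i)" for s i
  have H[measurable]: "H s i \<in> borel_measurable MX" for s i unfolding H_def by (rule Val_meas[OF \<kappa> f])
  have H_le: "H s i x \<le> ennreal C * w x" if s: "\<bar>s\<bar> = 1" and x: "x \<in> space MX" for s i x
    unfolding H_def w_def by (rule Val_le_cmult[OF \<kappa> f_le[OF s] Dcm x])
  \<comment> \<open>The start value of each part equals the corresponding part of the reward of
    \<open>\<pi>\<close>, through the disintegration and the potential of
    \<open>f s i\<close>.\<close>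
  have H_\<eta>: "(\<integral>\<^sup>+x. H s i x \<partial>\<eta>) = (\<integral>\<^sup>+z. c s i z \<partial>occ_measure \<pi>)" if s: "\<bar>s\<bar> = 1" for s i
    unfolding disint[OF c] H_def f_def[symmetric]
    by (rule nn_integral_marginal_eq_Val[symmetric, OF \<kappa> \<pi> disint alive_fin[OF pol] w_fin[OF pol, unfolded w_def] f f_le[OF s]])

  \<comment> \<open>The one-step look-ahead as a function of state and noise instead of state and
    action.\<close>
  define g where "g s i z = c s i (fst z, S z) + (\<integral>\<^sup>+y. H s i y \<partial>Q (fst z, S z))" for s i z
  have FS: "(\<lambda>z. F (fst z, S z)) \<in> borel_measurable (MX \<Otimes>\<^sub>M borel)" if "F \<in> borel_measurable SA" for F :: "'x \<times> 'a \<Rightarrow> ennreal"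
    by (rule measurable_compose[OF _ that]) measurable
  have g[measurable]: "g s i \<in> borel_measurable (MX \<Otimes>\<^sub>M borel)" for s i
    unfolding g_def by (intro borel_measurable_add FS[OF c] FS[OF nn_integral_Q_meas[OF H]])
  have g_int: "(\<integral>\<^sup>+u. g s i (x, u) \<partial>unif01) = H s i x" if x: "x \<in> space MX" for s i x
  proof -
    have m: "(\<lambda>a. c s i (x, a)) \<in> borel_measurable MA" "(\<lambda>a. \<integral>\<^sup>+y. H s i y \<partial>Q (x, a)) \<in> borel_measurable MA"
      by (rule Fsec[OF x c], rule Fsec[OF x nn_integral_Q_meas[OF H]])
    have "(\<integral>\<^sup>+u. g s i (x, u) \<partial>unif01) = (\<integral>\<^sup>+a. c s i (x, a) + (\<integral>\<^sup>+y. H s i y \<partial>Q (x, a)) \<partial>\<kappa> x)"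
      using m by (subst \<kappa>_int[OF x]) (auto simp: g_def)
    also have "\<dots> = f s i x + Top \<kappa> (H s i) x"
      unfolding f_def Top_def
      by (rule nn_integral_add) (simp_all add: m measurable_cong_sets[OF kernel_space(2)[OF \<kappa> x] refl])
    also have "\<dots> = H s i x" unfolding H_def by (rule Val_unfold[symmetric, OF \<kappa> f x])
    finally show ?thesis .
  qed
  define wQ where "wQ z = (\<integral>\<^sup>+y. w y \<partial>Q (fst z, S z))" for z
  have wQ[measurable]: "wQ \<in> borel_measurable (MX \<Otimes>\<^sub>M borel)"
    unfolding wQ_def by (rule FS[OF nn_integral_Q_meas[OF w]])
  \<comment> \<open>For these noise values the expected absorption time after one step is finite, so
    both parts of the look-ahead are finite and \<open>G\<close> is their true difference.\<close>
  define E where "E = {z \<in> space (MX \<Otimes>\<^sub>M borel). wQ z < \<infinity>}"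
  define X0 where "X0 = {x \<in> space MX. w x < \<infinity>}"
  have zS: "(fst z, S z) \<in> space SA" if "z \<in> space (MX \<Otimes>\<^sub>M borel)" for z
    using that measurable_space[OF S that] by (auto simp: space_pair_measure)
  have g_fin: "g s i z < \<infinity>" if s: "\<bar>s\<bar> = 1" and z: "z \<in> E" for s i z
  proof -
    have z': "z \<in> space (MX \<Otimes>\<^sub>M borel)" "wQ z < \<infinity>" using z by (auto simp: E_def)
    have "(\<integral>\<^sup>+y. H s i y \<partial>Q (fst z, S z)) \<le> (\<integral>\<^sup>+y. ennreal C * w y \<partial>Q (fst z, S z))"
      using H_le[OF s] by (intro nn_integral_mono) (simp add: sets_eq_imp_space_eq[OF Q_sets[OF zS[OF z'(1)]]])
    also have "\<dots> = ennreal C * wQ z"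
      unfolding wQ_def by (rule nn_integral_cmult) (simp add: measurable_cong_sets[OF Q_sets[OF zS[OF z'(1)]] refl])
    also have "\<dots> < \<infinity>" using z'(2) by (simp add: ennreal_mult_less_top)
    finally have "(\<integral>\<^sup>+y. H s i y \<partial>Q (fst z, S z)) < \<infinity>" .
    then show ?thesis by (simp add: g_def c_def)
  qed
  have H_fin: "H s i x < \<infinity>" if "\<bar>s\<bar> = 1" "x \<in> X0" for s i x
  proof -
    have x: "x \<in> space MX" "w x < \<infinity>" using that(2) by (auto simp: X0_def)
    have "ennreal C * w x < \<infinity>" using x(2) by (simp add: ennreal_mult_less_top)
    with H_le[OF that(1) x(1), of i] show ?thesis by (rule le_less_trans)
  qed
  define G where "G z = (\<chi> i. enn2real (g 1 i z) - enn2real (g (-1) i z))" for z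
  define h where "h x = (\<chi> i. enn2real (H 1 i x) - enn2real (H (-1) i x))" for x
  have "\<exists>\<beta> s. (\<forall>i. \<beta> i \<in> borel_measurable MX \<and> s i \<in> borel_measurable MX) \<and>
    (\<forall>x\<in>space MX. (\<forall>i. 0 \<le> \<beta> i x) \<and> (\<Sum>i<CARD('d)+1. \<beta> i x) = 1) \<and>
    (\<forall>x\<in>X0. (\<forall>i. (x, s i x) \<in> E) \<and> (\<Sum>i<CARD('d)+1. \<beta> i x *\<^sub>R G (x, s i x)) = h x)"
  proof (rule measurable_caratheodory_selection)
    show "G \<in> borel_measurable (MX \<Otimes>\<^sub>M borel)" unfolding G_def by (intro borel_measurable_vec_lambda) measurable
    show "h \<in> borel_measurable MX" unfolding h_def by (intro borel_measurable_vec_lambda) measurable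
    show "E \<in> sets (MX \<Otimes>\<^sub>M borel)" unfolding E_def by measurable
    show "X0 \<in> sets MX" unfolding X0_def by measurable
    fix x assume x0: "x \<in> X0"
    then have x: "x \<in> space MX" "w x < \<infinity>" by (auto simp: X0_def)
    have sec: "(\<lambda>u. F (x, u)) \<in> borel_measurable unif01" if "F \<in> borel_measurable (MX \<Otimes>\<^sub>M borel)" for F :: "'x \<times> real \<Rightarrow> ennreal"
      using measurable_compose[OF measurable_Pair1'[OF x(1)] that] by (simp cong: measurable_cong_sets)
    \<comment> \<open>Since \<open>w = indicator Dc + Top \<kappa> w\<close>, a finite
      \<open>w x\<close> leaves only a null set of noise values outside \<open>E\<close>.\<close>
    have "Top \<kappa> w x \<le> w x" unfolding w_def
      by (rule ord_le_eq_trans[OF _ Val_unfold[OF \<kappa> Dcm x(1), symmetric]]) (simp add: add_increasing)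
    moreover have "Top \<kappa> w x = (\<integral>\<^sup>+u. wQ (x, u) \<partial>unif01)"
      unfolding Top_def by (subst \<kappa>_int[OF x(1) Fsec[OF x(1) nn_integral_Q_meas[OF w]]]) (simp add: wQ_def)
    ultimately have "(\<integral>\<^sup>+u. wQ (x, u) \<partial>unif01) \<noteq> \<infinity>" using x(2) by auto
    then have "AE u in unif01. wQ (x, u) \<noteq> \<infinity>" by (rule nn_integral_PInf_AE[OF sec[OF wQ]])
    then show "AE u in unif01. (x, u) \<in> E"
      by eventually_elim (use x in \<open>auto simp: E_def less_top space_pair_measure\<close>)
    have gi: "(\<integral>\<^sup>+u. g s i (x, u) \<partial>unif01) < \<infinity>" if "\<bar>s\<bar> = 1" for s i
      using g_int[OF x(1)] H_fin[OF that x0] by simp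
    have d: "integrable unif01 (\<lambda>u. enn2real (g 1 i (x, u)) - enn2real (g (-1) i (x, u)))"
      "(LINT u|unif01. enn2real (g 1 i (x, u)) - enn2real (g (-1) i (x, u))) = enn2real (H 1 i x) - enn2real (H (-1) i x)" for i
      using nn_integral_finite_diff[OF sec[OF g] sec[OF g] gi gi, of 1 "-1" i i] by (simp_all add: g_int[OF x(1)])
    show "integrable unif01 (\<lambda>u. G (x, u))" unfolding G_def by (rule integral_vec_lambda(1)[OF d(1)])
    show "(LINT u|unif01. G (x, u)) = h x" unfolding G_def h_def by (subst integral_vec_lambda(2)[OF d(1)]) (simp add: d(2))
  qed
  then obtain \<beta> s where \<beta>s: "\<forall>i. \<beta> i \<in> borel_measurable MX \<and> s i \<in> borel_measurable MX"
    and simplex: "\<forall>x\<in>space MX. (\<forall>i. 0 \<le> \<beta> i x) \<and> (\<Sum>i<CARD('d)+1. \<beta> i x) = 1"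
    and bary: "\<forall>x\<in>X0. (\<forall>i. (x, s i x) \<in> E) \<and> (\<Sum>i<CARD('d)+1. \<beta> i x *\<^sub>R G (x, s i x)) = h x"
    by blast
  have \<beta>[measurable]: "\<beta> i \<in> borel_measurable MX" and s[measurable]: "s i \<in> borel_measurable MX" for i
    using \<beta>s by auto
  \<comment> \<open>As \<open>S\<close> is admissible for every noise value, the resulting kernel is
    admissible also at states outside \<open>X0\<close>, where the selection promises nothing about
    \<open>G\<close>.\<close>
  define \<phi> where "\<phi> i x = S (x, s i x)" for i x
  have \<phi>[measurable]: "\<phi> i \<in> measurable MX MA" for i unfolding \<phi>_def by measurable
  let ?p = "CARD('d) + 1"
  define \<gamma> where "\<gamma> = chat_kernel MA ?p \<beta> \<phi>"
  have \<gamma>: "\<gamma> \<in> measurable MX (prob_algebra MA)"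
    unfolding \<gamma>_def by (rule chat_kernel_measurable) (use simplex in auto)
  have \<gamma>_int: "(\<integral>\<^sup>+a. F a \<partial>\<gamma> x) = (\<Sum>i<?p. ennreal (\<beta> i x) * F (\<phi> i x))"
    if "x \<in> space MX" "F \<in> borel_measurable MA" for x F
    unfolding \<gamma>_def by (rule nn_integral_chat_kernel[OF _ that(2)]) (rule measurable_space[OF \<phi> that(1)])
  have \<gamma>_A: "emeasure (\<gamma> x) (Aadm x) = 1" if x: "x \<in> space MX" for x
  proof -
    have "emeasure (\<gamma> x) (Aadm x) = (\<integral>\<^sup>+a. indicator (Aadm x) a \<partial>\<gamma> x)"
      using A_sets[OF x] kernel_space(2)[OF \<gamma> x] by simp
    also have "\<dots> = (\<Sum>i<?p. ennreal (\<beta> i x))"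
      using A_sets[OF x] by (subst \<gamma>_int[OF x]) (auto simp: \<phi>_def S_A[OF x])
    also have "\<dots> = 1" using simplex x by (subst sum_ennreal) auto
    finally show ?thesis .
  qed
  have chat: "chattering MX MA Aadm ?p \<beta> \<phi>"
    unfolding chattering_def \<gamma>_def[symmetric] using simplex \<gamma>_A by auto
  have \<gamma>_pol: "is_policy MX MA Aadm (stat_policy \<gamma>)"
    using measurable_compose[OF measurable_snd \<gamma>] \<gamma>_A
    unfolding is_policy_def stat_policy_def[abs_def] Hist_def by (auto simp: space_pair_measure)
  note \<gamma>k = is_policy_kernels[OF \<gamma>_pol]
  \<comment> \<open>On \<open>X0\<close> all terms are finite: the barycentric identity for
    \<open>G\<close> is read componentwise in the reals, rearranged so that no negative term
    remains, and lifted back to \<open>ennreal\<close>.\<close>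
  have eq: "H 1 i x + (\<integral>\<^sup>+a. c (-1) i (x, a) + (\<integral>\<^sup>+y. H (-1) i y \<partial>Q (x, a)) \<partial>\<gamma> x) =
      H (-1) i x + (\<integral>\<^sup>+a. c 1 i (x, a) + (\<integral>\<^sup>+y. H 1 i y \<partial>Q (x, a)) \<partial>\<gamma> x)"
    if x: "x \<in> space MX" "w x < \<infinity>" for i x
  proof -
    have x0: "x \<in> X0" using x by (simp add: X0_def)
    define b where "b \<sigma> j = enn2real (g \<sigma> i (x, s j x))" for \<sigma> j
    have b: "g \<sigma> i (x, s j x) = ennreal (b \<sigma> j)" if "\<bar>\<sigma>\<bar> = 1" for \<sigma> j
      using g_fin[OF that, of "(x, s j x)" i] bary x0 by (simp add: b_def less_top)
    have b0: "0 \<le> b \<sigma> j" for \<sigma> j by (simp add: b_def)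
    have \<beta>0: "0 \<le> \<beta> j x" for j using simplex x(1) by auto
    define e where "e \<sigma> = enn2real (H \<sigma> i x)" for \<sigma>
    have e: "H \<sigma> i x = ennreal (e \<sigma>)" if "\<bar>\<sigma>\<bar> = 1" for \<sigma>
      using H_fin[OF that x0, of i] by (simp add: e_def less_top)
    have e0: "0 \<le> e \<sigma>" for \<sigma> by (simp add: e_def)
    have int: "(\<integral>\<^sup>+a. c \<sigma> i (x, a) + (\<integral>\<^sup>+y. H \<sigma> i y \<partial>Q (x, a)) \<partial>\<gamma> x) = ennreal (\<Sum>j<?p. \<beta> j x * b \<sigma> j)"
      if \<sigma>: "\<bar>\<sigma>\<bar> = 1" for \<sigma>
    proof -
      have "(\<integral>\<^sup>+a. c \<sigma> i (x, a) + (\<integral>\<^sup>+y. H \<sigma> i y \<partial>Q (x, a)) \<partial>\<gamma> x) = (\<Sum>j<?p. ennreal (\<beta> j x) * g \<sigma> i (x, s j x))"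
        by (subst \<gamma>_int[OF x(1)])
           (auto simp: g_def \<phi>_def intro!: borel_measurable_add Fsec[OF x(1) c] Fsec[OF x(1) nn_integral_Q_meas[OF H]])
      also have "\<dots> = (\<Sum>j<?p. ennreal (\<beta> j x * b \<sigma> j))"
        by (intro sum.cong refl) (simp add: b[OF \<sigma>] ennreal_mult \<beta>0 b0)
      also have "\<dots> = ennreal (\<Sum>j<?p. \<beta> j x * b \<sigma> j)" by (rule sum_ennreal) (simp add: \<beta>0 b0)
      finally show ?thesis .
    qed
    have "(\<Sum>j<?p. \<beta> j x *\<^sub>R G (x, s j x)) $ i = h x $ i" using bary x0 by simp
    then have "(\<Sum>j<?p. \<beta> j x * (b 1 j - b (-1) j)) = e 1 - e (-1)"
      by (simp add: sum_component G_def h_def b_def e_def)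
    then have "e 1 + (\<Sum>j<?p. \<beta> j x * b (-1) j) = e (-1) + (\<Sum>j<?p. \<beta> j x * b 1 j)"
      by (simp add: right_diff_distrib sum_subtractf)
    moreover have "0 \<le> (\<Sum>j<?p. \<beta> j x * b \<sigma> j)" for \<sigma> by (intro sum_nonneg) (simp add: \<beta>0 b0)
    ultimately show ?thesis
      by (simp add: int e e0 flip: ennreal_plus del: sum.lessThan_Suc)
  qed
  \<comment> \<open>Only differences are matched, since the selection reproduces the mean of
    \<open>G\<close> and not the means of \<open>g 1 i\<close> and \<open>g (-1) i\<close>
    separately.\<close>
  have main: "enn2real (\<integral>\<^sup>+x. H 1 i x \<partial>\<eta>) - enn2real (\<integral>\<^sup>+x. H (-1) i x \<partial>\<eta>) =
    enn2real (\<integral>\<^sup>+z. c 1 i z \<partial>occ_measure (stat_policy \<gamma>)) - enn2real (\<integral>\<^sup>+z. c (-1) i z \<partial>occ_measure (stat_policy \<gamma>))" for i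
    by (rule verification[OF \<gamma> \<gamma>k _ H H c c w w_fin[OF \<gamma>_pol] w_lim[OF \<gamma>_pol] H_le H_le c_le c_le alive_fin[OF \<gamma>_pol] eq])
       (simp_all add: stat_policy_def)
  have rew: "occ_reward MX MA Q \<eta> \<Delta> r \<sigma> $ i =
    enn2real (\<integral>\<^sup>+z. c 1 i z \<partial>occ_measure \<sigma>) - enn2real (\<integral>\<^sup>+z. c (-1) i z \<partial>occ_measure \<sigma>)"
    if "is_policy MX MA Aadm \<sigma>" for \<sigma> i
    using occ_reward_nth[OF is_policy_kernels[OF that] alive_fin[OF that] r C] by (simp add: c_def)
  have "occ_reward MX MA Q \<eta> \<Delta> r (stat_policy \<gamma>) = occ_reward MX MA Q \<eta> \<Delta> r \<pi>"
    unfolding vec_eq_iff using main by (simp add: rew[OF \<gamma>_pol] rew[OF pol] H_\<eta>)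
  with chat show ?thesis unfolding \<gamma>_def MA_def by blast
qed

end
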